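(* Let $X$ be a Tychonoff space with an action of a group $G$ as in the context. Let $d:G\times X\to\mathbf F$ be a function such that $d(g,x)$ is continuous in the variable $x\in X$ for each $g\in G$. Let $p$ be a bounded linear functional on $C(X,\mathbf F)$ such that $$p(f^{g^{-1}})=p(d(g,\cdot)f)\quad\text{for each } f\in C_b(X,\mathbf F)\text{ and }g\in G,$$ where $f^g(x):=f(g^{-1}x)$ (in particular $f^{g^{-1}}\in C(X,\mathbf F)$). Then there exists a quasi-invariant $\sigma$-smooth measure $m\in Q^d_\sigma(X,\mathbf F)$ such that $$p(f)=\int_X f(x)\,m(dx)\quad\text{for each }f\in C(X,\mathbf R).$$ Moreover, $d$ satisfies the following conditions $m$-almost everywhere on $X$ (in the variable $x$, for each fixed $s,g\in G$): (1) $d(e,x)=1$; (2) $d(g,x)\ne0$; (3) $d(sg,x)=d(g,s^{-1}x)\,d(s,x)$.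
   Context: $\mathbf F$ is $\mathbf R$ or $\mathbf C$; $C(X,\mathbf F)$ (resp. $C_b(X,\mathbf F)$) is the space of continuous (resp. bounded continuous) functions. $\mathcal F=\mathcal F(X)$ is the smallest algebra of subsets containing all zero sets $f^{-1}(0)$, $f\in C_b(X,\mathbf R)$, and their complements; $\mathcal B(X)$ is the smallest such $\sigma$-algebra. $G$ (neutral element $e$) acts on $X$ by maps $h_g$ with $h_g\circ h_j=h_{gj}$, $h_e=\mathrm{id}$, $gx=h_g(x)$; standing assumption: each $g$ maps $\mathcal F$ into $\mathcal F$ and $gX=X$. Bounded functionals: $V\subset C(X,\mathbf R)$ is bounded if there are $f,h\in C(X,\mathbf R)$ with $f\le u\le h$ for all $u\in V$. A linear functional $p:C(X,\mathbf R)\to\mathbf R$ is bounded if $p(V)$ is bounded in $\mathbf R$ for each bounded $V$. A $\mathbf C$-linear functional $p$ on $C(X,\mathbf C)$ is bounded if $p=p_1+ip_2$ with $p_1,p_2$ $\mathbf C$-linear functionals whose restrictions to $C(X,\mathbf R)$ are real-valued and bounded. A measure is a bounded finitely additive zero-set regular $m:\mathcal F\to\mathbf F$ (for $A\in\mathcal F$, $\epsilon>0$ there is a zero set $Z\subset A$ with $|m|(A\setminus Z)<\epsilon$, $|m|$ the variation). It is $\sigma$-smooth if $\int f_n\,dm\to0$ for every sequence $f_n\in C_b(X,\mathbf R)$ decreasing pointwise to $0$; equivalently it is countably additive and so extends to $\mathcal B(X)$. $m^g(A):=m(g^{-1}A)$. $m$ is quasi-invariant relative to $G$ if $m^g$ and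 $m$ are equivalent ($|m^g|(A)=0\Leftrightarrow|m|(A)=0$) for each $g$. The quasi-invariance factor is the Radon–Nikodym derivative $d_m(g,x)=m^g(dx)/m(dx)$. $Q^d_\sigma(X,\mathbf F)$ is the set of $\sigma$-smooth quasi-invariant measures $m$ whose quasi-invariance factor exists with $d_m(g,x)=d(g,x)$ for each $g\in G$ and $m$-almost all $x\in X$. *)

theory Defs
  imports "HOL-Analysis.Analysis" "HOL-Algebra.Group_Action"
begin

text \<open>The scalar field is a set \<open>F\<close> of complex numbers, either \<^term>\<open>\<real> :: complex set\<close> or
  \<^term>\<open>UNIV :: complex set\<close>. Real-valued functions, functionals and set functions are thus
  complex-valued ones with values in \<open>\<real>\<close>, so that \<open>C(X, \<real>)\<close> is literally contained in
  \<open>C(X, \<complex>)\<close>; order comparisons of elements of \<open>C(X, \<real>)\<close> are made through \<^const>\<open>Re\<close>.\<close>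

subsection \<open>Function spaces and bounded functionals\<close>

definition Cont :: "complex set \<Rightarrow> ('a::topological_space \<Rightarrow> complex) set" where
  "Cont F = {f. continuous_on UNIV f \<and> range f \<subseteq> F}"

definition Cont_bdd :: "complex set \<Rightarrow> ('a::topological_space \<Rightarrow> complex) set" where
  "Cont_bdd F = {f \<in> Cont F. bounded (range f)}"

definition linear_functional ::
  "complex set \<Rightarrow> (('a::topological_space \<Rightarrow> complex) \<Rightarrow> complex) \<Rightarrow> bool" where
  "linear_functional F p \<longleftrightarrow>
     (\<forall>f\<in>Cont F. p f \<in> F) \<and>
     (\<forall>f\<in>Cont F. \<forall>u\<in>Cont F. p (\<lambda>x. f x + u x) = p f + p u) \<and>
     (\<forall>c\<in>F. \<forall>f\<in>Cont F. p (\<lambda>x. c * f x) = c * p f)"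

definition bounded_family :: "('a::topological_space \<Rightarrow> complex) set \<Rightarrow> bool" where
  "bounded_family V \<longleftrightarrow> V \<subseteq> Cont \<real> \<and>
     (\<exists>f\<in>Cont \<real>. \<exists>h\<in>Cont \<real>. \<forall>u\<in>V. \<forall>x. Re (f x) \<le> Re (u x) \<and> Re (u x) \<le> Re (h x))"

definition real_and_bounded_on_reals ::
  "(('a::topological_space \<Rightarrow> complex) \<Rightarrow> complex) \<Rightarrow> bool" where
  "real_and_bounded_on_reals p \<longleftrightarrow>
     (\<forall>u\<in>Cont \<real>. p u \<in> \<real>) \<and> (\<forall>V. bounded_family V \<longrightarrow> bounded (p ` V))"

definition bounded_functional ::
  "complex set \<Rightarrow> (('a::topological_space \<Rightarrow> complex) \<Rightarrow> complex) \<Rightarrow> bool" where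
  "bounded_functional F p \<longleftrightarrow> linear_functional F p \<and>
     (if F = \<real> then real_and_bounded_on_reals p
      else \<exists>p1 p2. linear_functional UNIV p1 \<and> linear_functional UNIV p2 \<and>
             real_and_bounded_on_reals p1 \<and> real_and_bounded_on_reals p2 \<and>
             (\<forall>f\<in>Cont UNIV. p f = p1 f + \<i> * p2 f))"


subsection \<open>Zero sets and finitely additive measures\<close>

definition zero_sets :: "'a::topological_space set set" where
  "zero_sets = {f -` {0} | f. f \<in> Cont_bdd \<real>}"

definition zero_algebra :: "'a::topological_space set set" where
  "zero_algebra = \<Inter>{M. algebra UNIV M \<and> zero_sets \<union> uminus ` zero_sets \<subseteq> M}"

definition variation :: "('a::topological_space set \<Rightarrow> complex) \<Rightarrow> 'a set \<Rightarrow> ennreal" where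
  "variation m A =
     (SUP P\<in>{P. finite P \<and> P \<subseteq> zero_algebra \<and> partition_on A P}. \<Sum>B\<in>P. ennreal (norm (m B)))"

text \<open>Only the values of a measure on \<^const>\<open>zero_algebra\<close> are relevant.\<close>

definition regular_measure ::
  "complex set \<Rightarrow> ('a::topological_space set \<Rightarrow> complex) \<Rightarrow> bool" where
  "regular_measure F m \<longleftrightarrow>
     (\<forall>A\<in>zero_algebra. m A \<in> F) \<and>
     additive zero_algebra m \<and>
     bounded (m ` zero_algebra) \<and>
     (\<forall>A\<in>zero_algebra. \<forall>\<epsilon>>0. \<exists>Z\<in>zero_sets. Z \<subseteq> A \<and> variation m (A - Z) < ennreal \<epsilon>)"

text \<open>The integral of a bounded function against a finitely additive measure, as the limit of
  Riemann-type sums along the finite partitions of the space into members of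
  \<^const>\<open>zero_algebra\<close>, directed by refinement.\<close>

definition has_fa_integral ::
  "('a::topological_space set \<Rightarrow> complex) \<Rightarrow> ('a \<Rightarrow> complex) \<Rightarrow> complex \<Rightarrow> bool" where
  "has_fa_integral m f I \<longleftrightarrow>
     (\<forall>\<epsilon>>0. \<exists>P. finite P \<and> P \<subseteq> zero_algebra \<and> partition_on UNIV P \<and>
        (\<forall>Q \<xi>. finite Q \<and> Q \<subseteq> zero_algebra \<and> refines UNIV Q P \<and> (\<forall>A\<in>Q. \<xi> A \<in> A) \<longrightarrow>
           norm ((\<Sum>A\<in>Q. f (\<xi> A) * m A) - I) < \<epsilon>))"

definition fa_integral ::
  "('a::topological_space set \<Rightarrow> complex) \<Rightarrow> ('a \<Rightarrow> complex) \<Rightarrow> complex" where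
  "fa_integral m f = (THE I. has_fa_integral m f I)"

definition sigma_smooth :: "('a::topological_space set \<Rightarrow> complex) \<Rightarrow> bool" where
  "sigma_smooth m \<longleftrightarrow>
     (\<forall>f :: nat \<Rightarrow> 'a \<Rightarrow> complex.
        (\<forall>n. f n \<in> Cont_bdd \<real>) \<and> (\<forall>x. decseq (\<lambda>n. Re (f n x))) \<and>
        (\<forall>x. (\<lambda>n. f n x) \<longlonglongrightarrow> 0) \<longrightarrow>
        (\<lambda>n. fa_integral m (f n)) \<longlonglongrightarrow> 0)"


subsection \<open>Integration against sigma-smooth measures\<close>

text \<open>The extension of a countably additive set function on \<^const>\<open>zero_algebra\<close> to the
  sigma-algebra generated by the zero sets.\<close>

definition baire_extension :: "('a::topological_space set \<Rightarrow> ennreal) \<Rightarrow> 'a measure" where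
  "baire_extension \<mu> = extend_measure UNIV zero_algebra (\<lambda>A. A) \<mu>"

abbreviation var_measure :: "('a::topological_space set \<Rightarrow> complex) \<Rightarrow> 'a measure" where
  "var_measure m \<equiv> baire_extension (variation m)"

text \<open>The positive part in the Jordan decomposition of a real set function; \<^const>\<open>ennreal\<close>
  truncates negative values to \<open>0\<close>, the value at the empty set. The negative part of \<open>\<nu>\<close> is
  the positive part of \<open>- \<nu>\<close>.\<close>

definition pos_part :: "('a::topological_space set \<Rightarrow> real) \<Rightarrow> 'a set \<Rightarrow> ennreal" where
  "pos_part \<nu> A = (SUP B\<in>{B \<in> zero_algebra. B \<subseteq> A}. ennreal (\<nu> B))"

definition real_measure_integral ::
  "('a::topological_space set \<Rightarrow> real) \<Rightarrow> ('a \<Rightarrow> complex) \<Rightarrow> complex" where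
  "real_measure_integral \<nu> f =
     (\<integral>x. f x \<partial>baire_extension (pos_part \<nu>)) -
     (\<integral>x. f x \<partial>baire_extension (pos_part (\<lambda>A. - \<nu> A)))"

definition measure_integral ::
  "('a::topological_space set \<Rightarrow> complex) \<Rightarrow> ('a \<Rightarrow> complex) \<Rightarrow> complex" where
  "measure_integral m f =
     real_measure_integral (\<lambda>A. Re (m A)) f + \<i> * real_measure_integral (\<lambda>A. Im (m A)) f"

definition has_measure_integral ::
  "('a::topological_space set \<Rightarrow> complex) \<Rightarrow> ('a \<Rightarrow> complex) \<Rightarrow> complex \<Rightarrow> bool" where
  "has_measure_integral m f I \<longleftrightarrow> integrable (var_measure m) f \<and> measure_integral m f = I"


subsection \<open>Quasi-invariance\<close>

definition translate_fun ::
  "('g, 'b) monoid_scheme \<Rightarrow> ('g \<Rightarrow> 'a \<Rightarrow> 'a) \<Rightarrow> 'g \<Rightarrow> ('a \<Rightarrow> complex) \<Rightarrow> 'a \<Rightarrow> complex" where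
  "translate_fun G h g f x = f (h (inv\<^bsub>G\<^esub> g) x)"

definition translate_measure ::
  "('g, 'b) monoid_scheme \<Rightarrow> ('g \<Rightarrow> 'a \<Rightarrow> 'a) \<Rightarrow> 'g \<Rightarrow> ('a set \<Rightarrow> complex) \<Rightarrow> 'a set \<Rightarrow> complex" where
  "translate_measure G h g m A = m (h (inv\<^bsub>G\<^esub> g) ` A)"

definition quasi_invariant ::
  "('g, 'b) monoid_scheme \<Rightarrow> ('g \<Rightarrow> 'a \<Rightarrow> 'a) \<Rightarrow> ('a::topological_space set \<Rightarrow> complex) \<Rightarrow> bool" where
  "quasi_invariant G h m \<longleftrightarrow>
     (\<forall>g\<in>carrier G. \<forall>A\<in>zero_algebra.
        variation (translate_measure G h g m) A = 0 \<longleftrightarrow> variation m A = 0)"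

text \<open>\<open>D\<close> is a density of \<open>\<nu>\<close> with respect to \<open>m\<close>. Both sides are countably additive for
  sigma-smooth \<open>m\<close> and \<open>\<nu>\<close>, so agreement on the algebra gives agreement of the extensions.\<close>

definition is_RN_derivative ::
  "('a::topological_space set \<Rightarrow> complex) \<Rightarrow> ('a set \<Rightarrow> complex) \<Rightarrow> ('a \<Rightarrow> complex) \<Rightarrow> bool" where
  "is_RN_derivative m \<nu> D \<longleftrightarrow> integrable (var_measure m) D \<and>
     (\<forall>A\<in>zero_algebra. has_measure_integral m (\<lambda>x. indicator A x * D x) (\<nu> A))"

definition Q_sigma ::
  "('g, 'b) monoid_scheme \<Rightarrow> ('g \<Rightarrow> 'a::topological_space \<Rightarrow> 'a) \<Rightarrow> complex set \<Rightarrow>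
   ('g \<Rightarrow> 'a \<Rightarrow> complex) \<Rightarrow> ('a set \<Rightarrow> complex) set" where
  "Q_sigma G h F d =
     {m. regular_measure F m \<and> sigma_smooth m \<and> quasi_invariant G h m \<and>
         (\<forall>g\<in>carrier G. \<exists>D. is_RN_derivative m (translate_measure G h g m) D \<and>
            (AE x in var_measure m. D x = d g x))}"

end

theory Submission
  imports Defs
begin

text \<open>
  The functional is represented by a measure and the translation identity is read off as an
  identity of densities.

  A bounded functional on the continuous functions is a complex combination of order-bounded real
  ones, and by Riesz each of these is a difference of positive functionals (lemma
  \<open>riesz_decomposition\<close>). A positive functional on all continuous functions, including
  the unbounded ones, is continuous along sequences decreasing to \<open>0\<close> (lemma \<open>decreasing_limit\<close>),
  so Daniell's construction yields a finite Baire measure that represents it: the upper integral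
  \<open>upper\<close> gives an outer measure for which zero sets are Caratheodory measurable, and comparison
  with layers of a function gives \<open>nn_integral_daniell\<close>. With the measure \<open>M\<close> of the sum of the four
  positive functionals and Radon-Nikodym, the functional becomes integration of \<open>f \<theta>\<close> against \<open>M\<close>
  for one integrable complex density \<open>\<theta>\<close> (theorem \<open>bounded_functional_representation\<close>), for every
  continuous \<open>f\<close>.

  The required measure is \<open>m A = \<integral>\<^sub>A \<theta> dM\<close>. Since finite Baire measures are inner regular with
  respect to zero sets, suprema over the algebra generated by the zero sets agree with their
  counterparts over the sigma-algebra. Hence the total variation of \<open>m\<close> is the measure with density
  \<open>norm \<theta>\<close>, the Jordan parts of its real and imaginary parts have the obvious densities, and
  integration against \<open>m\<close>, in either sense, is integration of \<open>f \<theta>\<close> against \<open>M\<close>.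

  In a Tychonoff space the hypothesis on translates makes each \<open>h g\<close> continuous. The translation
  identity for bounded continuous functions then extends to indicators of Baire sets (lemma
  \<open>indicator_integral_eq\<close>), which says that \<open>d g\<close> is the density of the translate of \<open>m\<close>. A null set of
  \<open>m\<close> is thus a null set of every translate, and applying this to the inverse element gives
  quasi-invariance. The translate vanishes on subsets of the zero set of \<open>d g\<close>, so this set is
  \<open>m\<close>-null. The remaining identities for \<open>d\<close> follow from uniqueness of densities; for the cocycle
  identity the translation identity is applied to the unbounded function \<open>d g (h (inv s) x) * f x\<close>,
  which is possible after truncation because all continuous functions are integrable.
\<close>


section \<open>Zero sets and the Baire sigma-algebra\<close>

text \<open>The space with the sigma-algebra of Baire sets, as the null measure: only its sets matter.\<close>

definition baire :: "'a::topological_space measure" where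
  "baire = sigma UNIV zero_sets"

lemma space_baire [simp]: "space baire = UNIV"
  by (simp add: baire_def space_measure_of_conv)

lemma sets_baire: "sets baire = sigma_sets UNIV zero_sets"
  by (simp add: baire_def sets_measure_of_conv)

lemma space_if_sets_baire: "sets M = sets baire \<Longrightarrow> space M = UNIV"
  using sets_eq_imp_space_eq by fastforce

lemma zero_setI:
  fixes f :: "'a::topological_space \<Rightarrow> real"
  assumes "continuous_on UNIV f"
  shows "{x. f x = 0} \<in> zero_sets"
proof -
  define g where "g x = complex_of_real (min 1 \<bar>f x\<bar>)" for x
  have "continuous_on UNIV g"
    unfolding g_def by (intro continuous_intros assms)
  moreover have "bounded (range g)"
    by (rule boundedI[of _ 1]) (auto simp: g_def)
  ultimately have "g \<in> Cont_bdd \<real>"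
    by (auto simp: Cont_bdd_def Cont_def g_def)
  moreover have "{x. f x = 0} = g -` {0}"
    by (auto simp: g_def min_def split: if_splits)
  ultimately show ?thesis
    unfolding zero_sets_def by blast
qed

lemma zero_setE:
  assumes "Z \<in> zero_sets"
  obtains f :: "'a::topological_space \<Rightarrow> real"
  where "continuous_on UNIV f" "\<And>x. 0 \<le> f x" "\<And>x. f x \<le> 1" "Z = {x. f x = 0}"
proof -
  obtain g where g: "g \<in> Cont_bdd \<real>" "Z = g -` {0}"
    using assms by (auto simp: zero_sets_def)
  have "continuous_on UNIV g"
    using g by (auto simp: Cont_bdd_def Cont_def)
  then have "continuous_on UNIV (\<lambda>x. min 1 (norm (g x)))"
    by (intro continuous_intros)
  then show ?thesis
    by (rule that) (auto simp: g(2) min_def)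
qed

lemma zero_set_le:
  fixes f g :: "'a::topological_space \<Rightarrow> real"
  assumes "continuous_on UNIV f" "continuous_on UNIV g"
  shows "{x. f x \<le> g x} \<in> zero_sets"
proof -
  have "continuous_on UNIV (\<lambda>x. max 0 (f x - g x))"
    by (intro continuous_intros assms)
  from zero_setI[OF this] show ?thesis
    by (rule back_subst[of "\<lambda>A. A \<in> zero_sets"]) (auto simp: max_def)
qed

lemma zero_sets_Int:
  assumes "Z \<in> zero_sets" "W \<in> zero_sets"
  shows "Z \<inter> W \<in> zero_sets"
proof -
  obtain f :: "'a \<Rightarrow> real" where f: "continuous_on UNIV f" "\<And>x. 0 \<le> f x" "Z = {x. f x = 0}"
    using zero_setE[OF assms(1)] by metis
  obtain g :: "'a \<Rightarrow> real" where g: "continuous_on UNIV g" "\<And>x. 0 \<le> g x" "W = {x. g x = 0}"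
    using zero_setE[OF assms(2)] by metis
  have "{x. f x + g x = 0} \<in> zero_sets"
    by (intro zero_setI continuous_intros f g)
  moreover have "{x. f x + g x = 0} = Z \<inter> W"
    using f(2) g(2) by (auto simp: f(3) g(3) add_nonneg_eq_0_iff)
  ultimately show ?thesis by simp
qed

lemma zero_sets_Un:
  assumes "Z \<in> zero_sets" "W \<in> zero_sets"
  shows "Z \<union> W \<in> zero_sets"
proof -
  obtain f :: "'a \<Rightarrow> real" where f: "continuous_on UNIV f" "Z = {x. f x = 0}"
    using zero_setE[OF assms(1)] by metis
  obtain g :: "'a \<Rightarrow> real" where g: "continuous_on UNIV g" "W = {x. g x = 0}"
    using zero_setE[OF assms(2)] by metis
  have "{x. f x * g x = 0} \<in> zero_sets"
    by (intro zero_setI continuous_intros f g)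
  moreover have "{x. f x * g x = 0} = Z \<union> W"
    by (auto simp: f g)
  ultimately show ?thesis by simp
qed

lemma empty_zero_set [simp]: "{} \<in> zero_sets"
  using zero_setI[of "\<lambda>_. 1"] by simp

lemma UNIV_zero_set [simp]: "UNIV \<in> zero_sets"
  using zero_setI[of "\<lambda>_. 0"] by simp

lemma zero_sets_finite_UN:
  "finite I \<Longrightarrow> (\<And>i. i \<in> I \<Longrightarrow> Z i \<in> zero_sets) \<Longrightarrow> (\<Union>i\<in>I. Z i) \<in> zero_sets"
  by (induction I rule: finite_induct) (auto intro: zero_sets_Un)

lemma zero_sets_countable_INT:
  assumes "\<And>n::nat. Z n \<in> zero_sets"
  shows "(\<Inter>n. Z n) \<in> (zero_sets :: 'a::topological_space set set)"
proof -
  have "\<exists>f::'a \<Rightarrow> real. continuous_on UNIV f \<and> (\<forall>x. 0 \<le> f x \<and> f x \<le> 1) \<and> Z n = {x. f x = 0}" for n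
    using zero_setE[OF assms[of n]] by metis
  then obtain f :: "nat \<Rightarrow> 'a \<Rightarrow> real" where f: "\<And>n. continuous_on UNIV (f n)"
      "\<And>n x. 0 \<le> f n x" "\<And>n x. f n x \<le> 1" "\<And>n. Z n = {x. f n x = 0}"
    by metis
  define s where "s n x = (1/2) ^ n * f n x" for n x
  have s_le: "norm (s n x) \<le> (1/2) ^ n" for n x
    using f(2,3)[of n x] by (simp add: s_def abs_mult mult_left_le)
  have s_summable: "summable (\<lambda>n. s n x)" for x
    by (rule summable_comparison_test'[where g = "\<lambda>n. (1/2) ^ n" and N = 0])
       (use s_le in \<open>auto intro: summable_geometric\<close>)
  have "uniform_limit UNIV (\<lambda>n x. \<Sum>i<n. s i x) (\<lambda>x. \<Sum>i. s i x) sequentially"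
    by (rule Weierstrass_m_test[where M = "\<lambda>n. (1/2) ^ n"])
       (use s_le in \<open>auto intro: summable_geometric\<close>)
  then have "continuous_on UNIV (\<lambda>x. \<Sum>i. s i x)"
    by (rule uniform_limit_theorem[rotated])
       (auto simp: s_def intro!: continuous_intros f always_eventually)
  then have "{x. (\<Sum>i. s i x) = 0} \<in> zero_sets"
    by (rule zero_setI)
  moreover have "(\<Sum>i. s i x) = 0 \<longleftrightarrow> (\<forall>n. f n x = 0)" for x
    using suminf_eq_zero_iff[OF s_summable[of x]] f(2) by (simp add: s_def)
  ultimately show ?thesis
    by (simp add: f(4) Collect_all_eq)
qed

lemma zero_sets_vimage:
  fixes T :: "'a::topological_space \<Rightarrow> 'b::topological_space"
  assumes "continuous_on UNIV T" "Z \<in> zero_sets"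
  shows "T -` Z \<in> zero_sets"
proof -
  obtain f :: "'b \<Rightarrow> real" where f: "continuous_on UNIV f" "Z = {x. f x = 0}"
    using zero_setE[OF assms(2)] by metis
  have "{x. f (T x) = 0} \<in> zero_sets"
    by (intro zero_setI continuous_on_compose2[OF f(1) assms(1)]) auto
  then show ?thesis
    by (simp add: f vimage_def)
qed

lemma algebra_zero_algebra: "algebra UNIV zero_algebra"
proof -
  have "algebra UNIV (\<Inter>S)" if "\<forall>M\<in>S. algebra UNIV M" for S :: "'a set set set"
    using that unfolding algebra_iff_Un by blast
  then show ?thesis
    unfolding zero_algebra_def by simp
qed

lemma zero_sets_subset_zero_algebra: "zero_sets \<subseteq> zero_algebra"
  unfolding zero_algebra_def by auto

lemma zero_algebra_subset_baire: "zero_algebra \<subseteq> sets baire"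
proof -
  have "algebra UNIV (sets (baire :: 'a measure))"
    using sets.algebra_axioms[of "baire :: 'a measure"] by simp
  moreover have "zero_sets \<union> uminus ` zero_sets \<subseteq> sets (baire :: 'a measure)"
    by (auto simp: sets_baire Compl_eq_Diff_UNIV intro: sigma_sets.intros)
  ultimately show ?thesis
    unfolding zero_algebra_def by blast
qed

lemma zero_sets_subset_baire: "zero_sets \<subseteq> sets baire"
  using zero_sets_subset_zero_algebra zero_algebra_subset_baire by blast

lemma sets_baire_zero_algebra: "sets baire = sigma_sets UNIV zero_algebra"
proof
  show "sets baire \<subseteq> sigma_sets UNIV (zero_algebra :: 'a set set)"
    unfolding sets_baire by (rule sigma_sets_mono'[OF zero_sets_subset_zero_algebra])
  show "sigma_sets UNIV zero_algebra \<subseteq> sets (baire :: 'a measure)"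
    using zero_algebra_subset_baire sets.sigma_sets_subset[of zero_algebra "baire :: 'a measure"]
    by simp
qed

interpretation zero_algebra: algebra UNIV "zero_algebra :: 'a::topological_space set set"
  by (rule algebra_zero_algebra)

lemma continuous_le_less_in_zero_algebra:
  fixes f :: "'a::topological_space \<Rightarrow> real"
  assumes "continuous_on UNIV f"
  shows "{x. a \<le> f x \<and> f x < b} \<in> zero_algebra"
proof -
  have "{x. a \<le> f x} \<in> zero_algebra" "{x. b \<le> f x} \<in> zero_algebra"
    using zero_set_le[OF continuous_on_const assms] zero_sets_subset_zero_algebra by blast+
  then have "{x. a \<le> f x} - {x. b \<le> f x} \<in> zero_algebra"
    by (rule zero_algebra.Diff)
  then show ?thesis
    by (rule back_subst[of "\<lambda>A. A \<in> zero_algebra"]) auto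
qed

lemma continuous_baire_measurable_real:
  fixes f :: "'a::topological_space \<Rightarrow> real"
  assumes "continuous_on UNIV f"
  shows "f \<in> borel_measurable baire"
proof (rule borel_measurableI_le)
  fix c
  show "{x \<in> space baire. f x \<le> c} \<in> sets baire"
    using zero_set_le[OF assms continuous_on_const[of _ c]] zero_sets_subset_baire by auto
qed

lemma continuous_baire_measurable:
  fixes f :: "'a::topological_space \<Rightarrow> complex"
  assumes "continuous_on UNIV f"
  shows "f \<in> borel_measurable baire"
  unfolding borel_measurable_complex_iff
  by (intro conjI continuous_baire_measurable_real continuous_intros assms)

lemma continuous_measurable_baire_baire:
  assumes "continuous_on UNIV T"
  shows "T \<in> measurable baire baire"
proof (rule measurable_sigma_sets[OF sets_baire])
  fix Z :: "'b set" assume "Z \<in> zero_sets"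
  then show "T -` Z \<inter> space baire \<in> sets baire"
    using zero_sets_vimage[OF assms] zero_sets_subset_baire by auto
qed auto

lemma Int_stable_zero_sets: "Int_stable zero_sets"
  by (auto simp: Int_stable_def zero_sets_Int)

text \<open>The indicator of a zero set is the decreasing limit of a sequence of continuous functions
  with values between \<open>0\<close> and \<open>1\<close>.\<close>

lemma zero_set_indicator_limit:
  assumes "Z \<in> zero_sets"
  obtains u :: "nat \<Rightarrow> 'a::topological_space \<Rightarrow> real"
  where "\<And>n. continuous_on UNIV (u n)" "\<And>n x. 0 \<le> u n x" "\<And>n x. u n x \<le> 1"
    "\<And>x. (\<lambda>n. u n x) \<longlonglongrightarrow> indicator Z x"
proof -
  obtain f :: "'a \<Rightarrow> real" where f: "continuous_on UNIV f" "\<And>x. 0 \<le> f x" "\<And>x. f x \<le> 1" "Z = {x. f x = 0}"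
    using zero_setE[OF assms] by metis
  define u where "u n x = (1 - f x) ^ n" for n x
  show ?thesis
  proof
    show "continuous_on UNIV (u n)" for n
      unfolding u_def by (intro continuous_intros f)
    show "0 \<le> u n x" "u n x \<le> 1" for n x
      using f(2,3) by (auto simp: u_def intro: power_le_one)
    fix x
    show "(\<lambda>n. u n x) \<longlonglongrightarrow> indicator Z x"
    proof (cases "f x = 0")
      case True
      then show ?thesis by (simp add: u_def f(4))
    next
      case False
      then have "norm (1 - f x) < 1"
        using f(2)[of x] f(3)[of x] by auto
      then show ?thesis
        using False unfolding u_def by (simp add: f(4) LIMSEQ_power_zero)
    qed
  qed
qed

section \<open>Regularity of finite Baire measures\<close>

text \<open>A zero set \<open>{f = 0}\<close> is the decreasing intersection of the complements of the zero sets
  \<open>{f \<ge> 1 / (n + 1)}\<close>.\<close>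

lemma zero_set_outer_regular:
  assumes "finite_measure M" and sets_M: "sets M = sets baire"
    and Z: "Z \<in> zero_sets" and "\<epsilon> > 0"
  obtains W where "W \<in> zero_sets" "Z \<subseteq> - W" "measure M (- W - Z) < \<epsilon>"
proof -
  interpret finite_measure M by fact
  obtain f :: "'a \<Rightarrow> real" where f: "continuous_on UNIV f" "\<And>x. 0 \<le> f x" "Z = {x. f x = 0}"
    using zero_setE[OF Z] by metis
  define W where "W n = {x. inverse (real (Suc n)) \<le> f x}" for n
  have W: "W n \<in> zero_sets" for n
    unfolding W_def by (intro zero_set_le f continuous_on_const)
  have meas: "- W n - Z \<in> sets M" for n
  proof -
    have "space M - W n - Z \<in> sets M"
      using W[of n] Z zero_sets_subset_baire by (intro sets.Diff sets.top) (auto simp: sets_M)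
    then show ?thesis by (simp add: space_if_sets_baire[OF sets_M] Compl_eq_Diff_UNIV)
  qed
  have "decseq (\<lambda>n. - W n - Z)"
  proof (rule decseq_SucI)
    fix n
    have le: "inverse (real (Suc (Suc n))) \<le> inverse (real (Suc n))"
      by simp
    then show "- W (Suc n) - Z \<subseteq> - W n - Z"
      using order_trans[OF le] unfolding W_def by blast
  qed
  then have "(\<lambda>n. measure M (- W n - Z)) \<longlonglongrightarrow> measure M (\<Inter>n. - W n - Z)"
    by (intro finite_Lim_measure_decseq) (use meas in auto)
  moreover have "(\<Inter>n. - W n - Z) = {}"
  proof -
    have "\<exists>n. x \<in> W n" if "x \<notin> Z" for x
    proof -
      have "0 < f x"
        using that f(2)[of x] by (auto simp: f(3))
      then obtain n where "inverse (real (Suc n)) < f x"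
        using reals_Archimedean by blast
      then show ?thesis
        by (auto simp: W_def intro!: exI[of _ n])
    qed
    then show ?thesis by blast
  qed
  ultimately have "(\<lambda>n. measure M (- W n - Z)) \<longlonglongrightarrow> 0"
    by (metis measure_empty)
  then have "\<forall>\<^sub>F n in sequentially. measure M (- W n - Z) < \<epsilon>"
    using \<open>\<epsilon> > 0\<close> by (rule order_tendstoD)
  then obtain n where "measure M (- W n - Z) < \<epsilon>"
    by (auto simp: eventually_sequentially)
  moreover have "Z \<subseteq> - W n"
    by (auto simp: W_def f(3))
  ultimately show ?thesis
    using that W by blast
qed

text \<open>The sets that can be enclosed between a zero set and the complement of a zero set, up to
  arbitrarily small measure, form a sigma-algebra.\<close>

lemma baire_approximation:
  assumes fin: "finite_measure M" and sets_M: "sets M = sets baire"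
    and A: "A \<in> sets baire"
  shows "\<forall>\<epsilon>>0. \<exists>Z\<in>zero_sets. \<exists>W\<in>zero_sets. Z \<subseteq> A \<and> A \<subseteq> - W \<and> measure M (- W - Z) < \<epsilon>"
  using A unfolding sets_baire
proof (induction A rule: sigma_sets.induct)
  case (Basic Z)
  then show ?case
    using zero_set_outer_regular[OF fin sets_M] by (metis order_refl)
next
  case Empty
  have "({}::'a set) \<subseteq> {} \<and> {} \<subseteq> - (UNIV::'a set) \<and> measure M (- UNIV - {}) < \<epsilon>" if "\<epsilon> > 0" for \<epsilon>
    using that by simp
  then show ?case
    by (meson UNIV_zero_set empty_zero_set)
next
  case (Compl A)
  show ?case
  proof (intro allI impI)
    fix \<epsilon> :: real assume "\<epsilon> > 0"
    then obtain Z W where "Z \<in> zero_sets" "W \<in> zero_sets" "Z \<subseteq> A" "A \<subseteq> - W" "measure M (- W - Z) < \<epsilon>"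
      using Compl.IH by blast
    then show "\<exists>Z\<in>zero_sets. \<exists>W\<in>zero_sets. Z \<subseteq> UNIV - A \<and> UNIV - A \<subseteq> - W \<and> measure M (- W - Z) < \<epsilon>"
      by (intro bexI[of _ W] bexI[of _ Z]) (auto simp: Diff_eq Int_commute)
  qed
next
  case (Union A)
  interpret finite_measure M by fact
  have sp: "space M = UNIV" by (rule space_if_sets_baire[OF sets_M])
  show ?case
  proof (intro allI impI)
    fix \<epsilon> :: real assume "\<epsilon> > 0"
    define \<delta> where "\<delta> i = \<epsilon> / 4 * (1/2) ^ i" for i :: nat
    have "\<delta> i > 0" for i using \<open>\<epsilon> > 0\<close> by (simp add: \<delta>_def)
    then have "\<exists>Z W. Z \<in> zero_sets \<and> W \<in> zero_sets \<and> Z \<subseteq> A i \<and> A i \<subseteq> - W \<and> measure M (- W - Z) < \<delta> i" for i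
      using Union.IH[of i] by blast
    then obtain Z W where ZW: "\<And>i. Z i \<in> zero_sets" "\<And>i. W i \<in> zero_sets" "\<And>i. Z i \<subseteq> A i"
        "\<And>i. A i \<subseteq> - W i" "\<And>i. measure M (- W i - Z i) < \<delta> i"
      by metis
    have "\<delta> sums (\<epsilon> / 4 * (1 / (1 - 1/2)))"
      unfolding \<delta>_def by (intro sums_mult geometric_sums) simp
    then have \<delta>_sums: "\<delta> sums (\<epsilon> / 2)"
      by simp
    note \<delta>_summable = sums_summable[OF \<delta>_sums]
    have ZW_sets: "Z i \<in> sets M" "W i \<in> sets M" "- W i \<in> sets M" for i
      using ZW(1,2)[of i] zero_sets_subset_baire sets.compl_sets[of "W i" M]
      by (auto simp: sets_M sp Compl_eq_Diff_UNIV)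
    define U where "U = - (\<Inter>i. W i)"
    have U_sets: "U \<in> sets M"
      using ZW_sets unfolding U_def by (auto simp: Compl_INT)
    have D: "measure M (U - (\<Union>i. Z i)) \<le> \<epsilon> / 2"
    proof -
      have sm: "summable (\<lambda>i. measure M (- W i - Z i))"
        by (rule summable_comparison_test'[where g = \<delta> and N = 0])
           (use ZW(5) \<delta>_summable in \<open>auto intro!: less_imp_le\<close>)
      have "measure M (U - (\<Union>i. Z i)) \<le> measure M (\<Union>i. - W i - Z i)"
        using ZW_sets by (intro finite_measure_mono) (auto simp: U_def)
      also have "\<dots> \<le> (\<Sum>i. measure M (- W i - Z i))"
        using ZW_sets by (intro finite_measure_subadditive_countably sm) auto
      also have "\<dots> \<le> (\<Sum>i. \<delta> i)"
        using ZW(5) by (intro suminf_le sm \<delta>_summable less_imp_le)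
      also have "\<dots> = \<epsilon> / 2"
        using sums_unique[OF \<delta>_sums] by simp
      finally show ?thesis .
    qed
    define Y where "Y n = (\<Union>i\<le>n. Z i)" for n
    have "(\<lambda>n. measure M (U - Y n)) \<longlonglongrightarrow> measure M (\<Inter>n. U - Y n)"
      using ZW_sets U_sets by (intro finite_Lim_measure_decseq) (auto simp: Y_def decseq_def le_trans)
    moreover have "(\<Inter>n. U - Y n) = U - (\<Union>i. Z i)"
      unfolding Y_def by auto
    ultimately have "(\<lambda>n. measure M (U - Y n)) \<longlonglongrightarrow> measure M (U - (\<Union>i. Z i))"
      by simp
    then have "\<forall>\<^sub>F n in sequentially. measure M (U - Y n) < \<epsilon>"
      by (rule order_tendstoD(2)) (use D \<open>\<epsilon> > 0\<close> in linarith)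
    then obtain n where "measure M (U - Y n) < \<epsilon>"
      by (auto simp: eventually_sequentially)
    moreover have "Y n \<in> zero_sets" "(\<Inter>i. W i) \<in> zero_sets"
      unfolding Y_def by (auto intro!: zero_sets_finite_UN zero_sets_countable_INT ZW)
    moreover have "Y n \<subseteq> \<Union> (range A)" "\<Union> (range A) \<subseteq> U"
      using ZW(3,4) unfolding Y_def U_def by blast+
    ultimately show "\<exists>Z\<in>zero_sets. \<exists>W\<in>zero_sets. Z \<subseteq> \<Union> (range A) \<and> \<Union> (range A) \<subseteq> - W \<and> measure M (- W - Z) < \<epsilon>"
      unfolding U_def by blast
  qed
qed

lemma baire_inner_regular:
  assumes fin: "finite_measure M" and sets_M: "sets M = sets baire"
    and A: "A \<in> sets baire" and "\<epsilon> > 0"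
  obtains Z where "Z \<in> zero_sets" "Z \<subseteq> A" "measure M (A - Z) < \<epsilon>"
proof -
  interpret finite_measure M by fact
  obtain Z W where Z: "Z \<in> zero_sets" "W \<in> zero_sets" "Z \<subseteq> A" "A \<subseteq> - W" "measure M (- W - Z) < \<epsilon>"
    using baire_approximation[OF fin sets_M A] \<open>\<epsilon> > 0\<close> by blast
  have "space M - W - Z \<in> sets M"
    using Z(1,2) zero_sets_subset_baire by (intro sets.Diff sets.top) (auto simp: sets_M)
  then have "- W - Z \<in> sets M"
    by (simp add: space_if_sets_baire[OF sets_M] Compl_eq_Diff_UNIV)
  then have "measure M (A - Z) \<le> measure M (- W - Z)"
    using Z(4) by (intro finite_measure_mono) auto
  with Z that show ?thesis by force
qed


section \<open>The Daniell measure of a positive functional\<close>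

text \<open>The cone of non-negative continuous functions. Positive functionals are only considered on
  this cone, which avoids extending them to differences.\<close>

definition nonneg_cont :: "('a::topological_space \<Rightarrow> real) set" where
  "nonneg_cont = {f. continuous_on UNIV f \<and> (\<forall>x. 0 \<le> f x)}"

lemma nonneg_contI: "continuous_on UNIV f \<Longrightarrow> (\<And>x. 0 \<le> f x) \<Longrightarrow> f \<in> nonneg_cont"
  by (simp add: nonneg_cont_def)

lemma nonneg_contD:
  assumes "f \<in> nonneg_cont"
  shows "continuous_on UNIV f" "0 \<le> f x"
  using assms by (auto simp: nonneg_cont_def)

lemma nonneg_cont_add: "f \<in> nonneg_cont \<Longrightarrow> g \<in> nonneg_cont \<Longrightarrow> (\<lambda>x. f x + g x) \<in> nonneg_cont"
  by (auto simp: nonneg_cont_def intro!: continuous_intros)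

lemma nonneg_cont_mult: "f \<in> nonneg_cont \<Longrightarrow> g \<in> nonneg_cont \<Longrightarrow> (\<lambda>x. f x * g x) \<in> nonneg_cont"
  by (auto simp: nonneg_cont_def intro!: continuous_intros)

lemma nonneg_cont_const: "0 \<le> c \<Longrightarrow> (\<lambda>x. c) \<in> nonneg_cont"
  by (auto simp: nonneg_cont_def)

lemma nonneg_cont_sum:
  "(\<And>i. i \<in> I \<Longrightarrow> f i \<in> nonneg_cont) \<Longrightarrow> (\<lambda>x. \<Sum>i\<in>I. f i x) \<in> nonneg_cont"
  by (auto simp: nonneg_cont_def intro!: continuous_intros sum_nonneg)

text \<open>Additive, positively homogeneous, non-negative functionals on the cone; the values of \<open>p\<close> outside
  the cone are irrelevant.\<close>

locale positive_functional =
  fixes p :: "('a::topological_space \<Rightarrow> real) \<Rightarrow> real"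
  assumes nonneg: "f \<in> nonneg_cont \<Longrightarrow> 0 \<le> p f"
    and add: "f \<in> nonneg_cont \<Longrightarrow> g \<in> nonneg_cont \<Longrightarrow> p (\<lambda>x. f x + g x) = p f + p g"
    and scale: "0 \<le> c \<Longrightarrow> f \<in> nonneg_cont \<Longrightarrow> p (\<lambda>x. c * f x) = c * p f"
begin

lemma mono:
  assumes "f \<in> nonneg_cont" "g \<in> nonneg_cont" "\<And>x. f x \<le> g x"
  shows "p f \<le> p g"
proof -
  have d: "(\<lambda>x. g x - f x) \<in> nonneg_cont"
    using assms by (auto simp: nonneg_cont_def intro!: continuous_intros)
  have "p (\<lambda>x. f x + (g x - f x)) = p f + p (\<lambda>x. g x - f x)"
    by (rule add[OF assms(1) d])
  then show ?thesis
    using nonneg[OF d] by simp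
qed

lemma zero [simp]: "p (\<lambda>x. 0) = 0"
  using scale[of 0 "\<lambda>x. 0"] nonneg_cont_const[of 0] by simp

lemma sum:
  "finite I \<Longrightarrow> (\<And>i. i \<in> I \<Longrightarrow> f i \<in> nonneg_cont) \<Longrightarrow> p (\<lambda>x. \<Sum>i\<in>I. f i x) = (\<Sum>i\<in>I. p (f i))"
  by (induction I rule: finite_induct) (simp_all add: add nonneg_cont_sum)

text \<open>Since \<open>p\<close> is defined on unbounded continuous functions as well, it is automatically
  continuous along decreasing sequences: if \<open>f n\<close> decreases to \<open>0\<close>, the sum of the functions
  \<open>max 0 (f n - \<delta>)\<close> is locally finite, hence continuous, and its value under \<open>p\<close> bounds all
  partial sums of the values \<open>p (max 0 (f n - \<delta>))\<close>.\<close>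

lemma decreasing_limit:
  fixes f :: "nat \<Rightarrow> 'a \<Rightarrow> real"
  assumes f: "\<And>n. f n \<in> nonneg_cont" and dec: "\<And>x. decseq (\<lambda>n. f n x)"
    and lim: "\<And>x. (\<lambda>n. f n x) \<longlonglongrightarrow> 0"
  shows "(\<lambda>n. p (f n)) \<longlonglongrightarrow> 0"
proof (rule LIMSEQ_I)
  fix \<epsilon> :: real assume "\<epsilon> > 0"
  have one: "(\<lambda>x. 1) \<in> nonneg_cont" by (rule nonneg_cont_const) simp
  have p1: "0 \<le> p (\<lambda>x. 1)" by (rule nonneg[OF one])
  define \<delta> where "\<delta> = \<epsilon> / (2 * (p (\<lambda>x. 1) + 1))"
  have \<delta>: "\<delta> > 0" "\<delta> * p (\<lambda>x. 1) < \<epsilon> / 2 + 0"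
    using \<open>\<epsilon> > 0\<close> p1 by (auto simp: \<delta>_def field_simps)
  define g where "g n x = max 0 (f n x - \<delta>)" for n x
  have g: "g n \<in> nonneg_cont" for n
    using nonneg_contD(1)[OF f] by (auto simp: nonneg_cont_def g_def intro!: continuous_intros)
  have vanish: "g i y = 0" if "f N y < \<delta>" "N \<le> i" for N i y
    using decseqD[OF dec that(2), of y] that(1) by (simp add: g_def)
  have ex: "\<exists>N. f N x < \<delta>" for x
    using order_tendstoD(2)[OF lim \<delta>(1), of x] by (auto simp: eventually_sequentially)
  have fin: "(\<Sum>i. g i y) = (\<Sum>i<N. g i y)" "summable (\<lambda>i. g i y)" if "f N y < \<delta>" for N y
    using that by (auto intro!: suminf_finite summable_finite[of "{..<N}"] vanish)
  have g_summable: "summable (\<lambda>i. g i x)" for x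
    using ex fin(2) by blast
  define s where "s x = (\<Sum>i. g i x)" for x
  have cont_s: "continuous_on {y. f N y < \<delta>} s" for N
  proof -
    have "continuous_on {y. f N y < \<delta>} (\<lambda>y. \<Sum>i<N. g i y)"
      using nonneg_contD(1)[OF nonneg_cont_sum[of "{..<N}", OF g]] by (rule continuous_on_subset) auto
    moreover have "s y = (\<Sum>i<N. g i y)" if "y \<in> {y. f N y < \<delta>}" for y
      using that fin(1) by (simp add: s_def)
    ultimately show ?thesis
      by (metis (mono_tags, lifting) continuous_on_cong)
  qed
  have "open {y. f N y < \<delta>}" for N
    using nonneg_contD(1)[OF f] by (intro open_Collect_less continuous_intros)
  then have "continuous_on (\<Union>N. {y. f N y < \<delta>}) s"
    by (intro continuous_on_open_UN cont_s) auto
  moreover have "(\<Union>N. {y. f N y < \<delta>}) = UNIV"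
    using ex by auto
  ultimately have "continuous_on UNIV s"
    by simp
  moreover have "0 \<le> s x" for x
    unfolding s_def by (intro suminf_nonneg g_summable nonneg_contD(2)[OF g])
  ultimately have s: "s \<in> nonneg_cont"
    by (rule nonneg_contI)
  have "summable (\<lambda>n. p (g n))"
  proof (rule summableI_nonneg_bounded)
    show "0 \<le> p (g n)" for n by (rule nonneg[OF g])
    fix n
    have "(\<Sum>i<n. p (g i)) = p (\<lambda>x. \<Sum>i<n. g i x)"
      by (simp add: sum g)
    also have "\<dots> \<le> p s"
    proof (rule mono[OF nonneg_cont_sum s])
      show "(\<Sum>i<n. g i x) \<le> s x" for x
        unfolding s_def using nonneg_contD(2)[OF g] by (intro sum_le_suminf g_summable) auto
    qed (rule g)
    finally show "(\<Sum>i<n. p (g i)) \<le> p s" .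
  qed
  then have "(\<lambda>n. p (g n)) \<longlonglongrightarrow> 0"
    by (rule summable_LIMSEQ_zero)
  then have "\<forall>\<^sub>F n in sequentially. p (g n) < \<epsilon> / 2"
    using \<open>\<epsilon> > 0\<close> by (intro order_tendstoD) auto
  then obtain N where N: "\<And>n. n \<ge> N \<Longrightarrow> p (g n) < \<epsilon> / 2"
    by (auto simp: eventually_sequentially)
  have "p (f n) < \<epsilon>" if "n \<ge> N" for n
  proof -
    have c: "(\<lambda>x. \<delta> * 1) \<in> nonneg_cont"
      using \<delta> by (intro nonneg_cont_const) auto
    have "p (f n) \<le> p (\<lambda>x. \<delta> * 1 + g n x)"
      by (intro mono f nonneg_cont_add c g) (simp add: g_def)
    also have "\<dots> = \<delta> * p (\<lambda>x. 1) + p (g n)"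
      using \<delta> by (subst add[OF c g], subst scale[OF _ one]) auto
    also have "\<dots> < \<epsilon>"
      using \<delta>(2) N[OF that] by simp
    finally show ?thesis .
  qed
  then show "\<exists>N. \<forall>n\<ge>N. norm (p (f n) - 0) < \<epsilon>"
    using nonneg[OF f] by (auto intro!: exI[of _ N])
qed

text \<open>The upper integral: the infimum of the total \<open>p\<close>-mass of countable covers by non-negative
  continuous functions.\<close>

definition covers :: "('a \<Rightarrow> ennreal) \<Rightarrow> (nat \<Rightarrow> 'a \<Rightarrow> real) set" where
  "covers \<phi> = {f. (\<forall>n. f n \<in> nonneg_cont) \<and> (\<forall>x. \<phi> x \<le> (\<Sum>n. ennreal (f n x)))}"

definition upper :: "('a \<Rightarrow> ennreal) \<Rightarrow> ennreal" where
  "upper \<phi> = (INF f\<in>covers \<phi>. \<Sum>n. ennreal (p (f n)))"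

lemma upper_le: "f \<in> covers \<phi> \<Longrightarrow> upper \<phi> \<le> (\<Sum>n. ennreal (p (f n)))"
  unfolding upper_def by (rule INF_lower)

lemma upper_mono: "(\<And>x. \<phi> x \<le> \<psi> x) \<Longrightarrow> upper \<phi> \<le> upper \<psi>"
  unfolding upper_def by (rule INF_superset_mono) (auto simp: covers_def intro: order_trans)

lemma upper_continuous:
  assumes f: "f \<in> nonneg_cont"
  shows "upper (\<lambda>x. ennreal (f x)) = ennreal (p f)"
proof (rule antisym)
  define g where "g n = (if n = 0 then f else (\<lambda>x. 0))" for n :: nat
  have "(\<Sum>n. ennreal (g n x)) = ennreal (f x)" for x
    by (subst suminf_finite[of "{0}"]) (auto simp: g_def)
  then have "g \<in> covers (\<lambda>x. ennreal (f x))"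
    using f nonneg_cont_const[of 0] by (auto simp: covers_def g_def)
  then have "upper (\<lambda>x. ennreal (f x)) \<le> (\<Sum>n. ennreal (p (g n)))"
    by (rule upper_le)
  also have "\<dots> = ennreal (p f)"
    by (subst suminf_finite[of "{0}"]) (auto simp: g_def)
  finally show "upper (\<lambda>x. ennreal (f x)) \<le> ennreal (p f)" .
  show "ennreal (p f) \<le> upper (\<lambda>x. ennreal (f x))"
    unfolding upper_def
  proof (rule INF_greatest)
    fix g assume "g \<in> covers (\<lambda>x. ennreal (f x))"
    then have g: "\<And>n. g n \<in> nonneg_cont" and le: "\<And>x. ennreal (f x) \<le> (\<Sum>n. ennreal (g n x))"
      by (auto simp: covers_def)
    define h where "h N x = max 0 (f x - (\<Sum>n<N. g n x))" for N x
    have h: "h N \<in> nonneg_cont" for N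
      using nonneg_contD(1)[OF f] nonneg_contD(1)[OF g]
      by (auto simp: nonneg_cont_def h_def intro!: continuous_intros)
    have "(\<lambda>N. p (h N)) \<longlonglongrightarrow> 0"
    proof (rule decreasing_limit[OF h])
      show "decseq (\<lambda>N. h N x)" for x
      proof (rule decseq_SucI)
        show "h (Suc n) x \<le> h n x" for n
          using nonneg_contD(2)[OF g, of n x] by (simp add: h_def max.coboundedI2)
      qed
      show "(\<lambda>N. h N x) \<longlonglongrightarrow> 0" for x
      proof (rule order_tendstoI)
        show "\<forall>\<^sub>F N in sequentially. a < h N x" if "a < 0" for a
          using that by (auto simp: h_def intro!: always_eventually less_le_trans[OF that])
        fix a :: real assume "0 < a"
        show "\<forall>\<^sub>F N in sequentially. h N x < a"
        proof (cases "f x < a")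
          case True
          then show ?thesis
            using \<open>0 < a\<close> nonneg_contD(2)[OF g]
            by (intro always_eventually allI) (smt (verit) h_def sum_nonneg)
        next
          case False
          have "ennreal (f x - a) < ennreal (f x)"
            using False \<open>0 < a\<close> by (intro ennreal_lessI) auto
          also have "\<dots> \<le> (\<Sum>n. ennreal (g n x))" by (rule le)
          finally have "\<forall>\<^sub>F N in sequentially. ennreal (f x - a) < (\<Sum>n<N. ennreal (g n x))"
            by (intro order_tendstoD(1)[OF summable_LIMSEQ]) auto
          then show ?thesis
          proof eventually_elim
            case (elim N)
            then have "f x - a < (\<Sum>n<N. g n x)"
              using nonneg_contD(2)[OF g] False
              by (subst (asm) sum_ennreal) (auto simp: ennreal_less_iff)
            then show ?case using \<open>0 < a\<close> by (simp add: h_def)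
          qed
        qed
      qed
    qed
    then have "(\<lambda>N. ennreal (p (h N)) + (\<Sum>n. ennreal (p (g n)))) \<longlonglongrightarrow> ennreal 0 + (\<Sum>n. ennreal (p (g n)))"
      by (intro tendsto_add tendsto_ennrealI tendsto_const)
    moreover have "ennreal (p f) \<le> ennreal (p (h N)) + (\<Sum>n. ennreal (p (g n)))" for N
    proof -
      have "p f \<le> p (\<lambda>x. h N x + (\<Sum>n<N. g n x))"
        by (intro mono f nonneg_cont_add h nonneg_cont_sum g) (simp add: h_def)
      also have "\<dots> = p (h N) + (\<Sum>n<N. p (g n))"
        by (simp add: add h nonneg_cont_sum g sum)
      finally have "ennreal (p f) \<le> ennreal (p (h N) + (\<Sum>n<N. p (g n)))"
        by (rule ennreal_leI)
      also have "\<dots> = ennreal (p (h N)) + (\<Sum>n<N. ennreal (p (g n)))"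
        by (simp add: ennreal_plus nonneg h g sum_nonneg sum_ennreal)
      also have "\<dots> \<le> ennreal (p (h N)) + (\<Sum>n. ennreal (p (g n)))"
        by (intro add_left_mono sum_le_suminf) auto
      finally show ?thesis .
    qed
    ultimately show "ennreal (p f) \<le> (\<Sum>n. ennreal (p (g n)))"
      by (intro LIMSEQ_le_const[of _ _ "ennreal (p f)"]) auto
  qed
qed

lemma upper_countably_subadditive:
  fixes \<phi> :: "nat \<Rightarrow> 'a \<Rightarrow> ennreal"
  assumes le: "\<And>x. \<psi> x \<le> (\<Sum>n. \<phi> n x)"
  shows "upper \<psi> \<le> (\<Sum>n. upper (\<phi> n))"
proof (rule ennreal_le_epsilon)
  fix e :: real assume "0 < e" and fin: "(\<Sum>n. upper (\<phi> n)) < top_class.top"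
  have lt: "upper (\<phi> n) < upper (\<phi> n) + e * (1/2) ^ Suc n" for n
    using \<open>0 < e\<close> ennreal_suminf_lessD[OF fin, of n] by (auto simp: less_top)
  have "\<exists>f\<in>covers (\<phi> n). (\<Sum>i. ennreal (p (f i))) < upper (\<phi> n) + e * (1/2) ^ Suc n" for n
    using lt[of n] unfolding upper_def INF_less_iff .
  then obtain F where F: "\<And>n. F n \<in> covers (\<phi> n)"
      "\<And>n. (\<Sum>i. ennreal (p (F n i))) < upper (\<phi> n) + e * (1/2) ^ Suc n"
    by metis
  define C where "C i = F (fst (prod_decode i)) (snd (prod_decode i))" for i
  have F_cont: "F n i \<in> nonneg_cont" for n i
    using F(1)[of n] by (simp add: covers_def)
  have F_cov: "\<phi> n x \<le> (\<Sum>i. ennreal (F n i x))" for n x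
    using F(1)[of n] by (simp add: covers_def)
  have C_sum: "(\<Sum>i. ennreal (C i x)) = (\<Sum>n. \<Sum>i. ennreal (F n i x))" for x
    using suminf_ennreal_2dimen[of "\<lambda>n. \<Sum>i. ennreal (F n i x)" "\<lambda>(n, i). ennreal (F n i x)"]
    by (simp add: C_def comp_def split_beta)
  have "C \<in> covers \<psi>"
    unfolding covers_def
  proof (intro CollectI conjI allI)
    show "C i \<in> nonneg_cont" for i
      by (simp add: C_def F_cont)
    show "\<psi> x \<le> (\<Sum>i. ennreal (C i x))" for x
      unfolding C_sum by (rule order_trans[OF le]) (intro suminf_le F_cov summableI)
  qed
  then have "upper \<psi> \<le> (\<Sum>i. ennreal (p (C i)))"
    by (rule upper_le)
  also have "\<dots> = (\<Sum>n. \<Sum>i. ennreal (p (F n i)))"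
    using suminf_ennreal_2dimen[of "\<lambda>n. \<Sum>i. ennreal (p (F n i))" "\<lambda>(n, i). ennreal (p (F n i))"]
    by (simp add: C_def comp_def split_beta)
  also have "\<dots> \<le> (\<Sum>n. upper (\<phi> n) + e * (1/2) ^ Suc n)"
    using F(2) by (intro suminf_le less_imp_le summableI) auto
  also have "\<dots> = (\<Sum>n. upper (\<phi> n)) + (\<Sum>n. ennreal e * ennreal ((1/2) ^ Suc n))"
    using \<open>0 < e\<close> by (subst suminf_add[symmetric])
       (auto simp del: ennreal_suminf_cmult simp add: ennreal_mult[symmetric])
  also have "\<dots> = (\<Sum>n. upper (\<phi> n)) + e"
    unfolding ennreal_suminf_cmult
    by (subst suminf_ennreal_eq[OF zero_le_power power_half_series]) auto
  finally show "upper \<psi> \<le> (\<Sum>n. upper (\<phi> n)) + e" .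
qed

text \<open>Multiplication of a cover by the members of a continuous partition of unity splits it, so the
  upper integral is superadditive along such partitions.\<close>

lemma upper_partition_le:
  assumes "finite I" and v: "\<And>i. i \<in> I \<Longrightarrow> v i \<in> nonneg_cont" and le1: "\<And>x. (\<Sum>i\<in>I. v i x) \<le> 1"
  shows "(\<Sum>i\<in>I. upper (\<lambda>x. \<phi> x * ennreal (v i x))) \<le> upper \<phi>"
  unfolding upper_def[of \<phi>]
proof (rule INF_greatest)
  fix f assume "f \<in> covers \<phi>"
  then have f: "\<And>n. f n \<in> nonneg_cont" and cov: "\<And>x. \<phi> x \<le> (\<Sum>n. ennreal (f n x))"
    by (auto simp: covers_def)
  have "(\<lambda>n x. f n x * v i x) \<in> covers (\<lambda>x. \<phi> x * ennreal (v i x))" if "i \<in> I" for i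
  proof -
    have "(\<Sum>n. ennreal (f n x * v i x)) = (\<Sum>n. ennreal (f n x)) * ennreal (v i x)" for x
      using nonneg_contD(2)[OF f] nonneg_contD(2)[OF v[OF that]] by (simp add: ennreal_mult)
    then show ?thesis
      using f v[OF that] cov by (auto simp: covers_def intro!: nonneg_cont_mult mult_right_mono)
  qed
  then have "(\<Sum>i\<in>I. upper (\<lambda>x. \<phi> x * ennreal (v i x))) \<le> (\<Sum>i\<in>I. \<Sum>n. ennreal (p (\<lambda>x. f n x * v i x)))"
    by (intro sum_mono upper_le)
  also have "\<dots> = (\<Sum>n. \<Sum>i\<in>I. ennreal (p (\<lambda>x. f n x * v i x)))"
    by (rule suminf_sum[symmetric]) auto
  also have "\<dots> \<le> (\<Sum>n. ennreal (p (f n)))"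
  proof (intro suminf_le summableI)
    fix n
    have fv: "(\<lambda>x. f n x * v i x) \<in> nonneg_cont" if "i \<in> I" for i
      using f v that by (intro nonneg_cont_mult)
    have "(\<Sum>i\<in>I. ennreal (p (\<lambda>x. f n x * v i x))) = ennreal (\<Sum>i\<in>I. p (\<lambda>x. f n x * v i x))"
      by (intro sum_ennreal nonneg fv)
    also have "(\<Sum>i\<in>I. p (\<lambda>x. f n x * v i x)) = p (\<lambda>x. \<Sum>i\<in>I. f n x * v i x)"
      by (intro sum[symmetric] \<open>finite I\<close> fv)
    also have "\<dots> \<le> p (f n)"
    proof (intro mono nonneg_cont_sum fv f)
      show "(\<Sum>i\<in>I. f n x * v i x) \<le> f n x" for x
        using mult_left_mono[OF le1[of x] nonneg_contD(2)[OF f, of n x]] by (simp add: sum_distrib_left)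
    qed
    finally show "(\<Sum>i\<in>I. ennreal (p (\<lambda>x. f n x * v i x))) \<le> ennreal (p (f n))"
      by (simp add: ennreal_leI)
  qed
  finally show "(\<Sum>i\<in>I. upper (\<lambda>x. \<phi> x * ennreal (v i x))) \<le> (\<Sum>n. ennreal (p (f n)))" .
qed

lemma upper_scale_le:
  assumes "0 \<le> c"
  shows "upper (\<lambda>x. ennreal c * \<phi> x) \<le> ennreal c * upper \<phi>"
proof (cases "c = 0")
  case True
  have "upper (\<lambda>x. 0) = 0"
    using upper_continuous[of "\<lambda>x. 0"] nonneg_cont_const[of 0] by simp
  then show ?thesis by (simp add: True)
next
  case False
  have "upper (\<lambda>x. ennreal c * \<phi> x) \<le> ennreal c * (\<Sum>n. ennreal (p (f n)))" if "f \<in> covers \<phi>" for f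
  proof -
    have f: "\<And>n. f n \<in> nonneg_cont" and cov: "\<And>x. \<phi> x \<le> (\<Sum>n. ennreal (f n x))"
      using that by (auto simp: covers_def)
    have "(\<Sum>n. ennreal (c * f n x)) = ennreal c * (\<Sum>n. ennreal (f n x))" for x
      using nonneg_contD(2)[OF f] assms by (simp add: ennreal_mult)
    then have "(\<lambda>n x. c * f n x) \<in> covers (\<lambda>x. ennreal c * \<phi> x)"
      using f cov assms by (auto simp: covers_def intro!: nonneg_cont_mult nonneg_cont_const mult_left_mono)
    then have "upper (\<lambda>x. ennreal c * \<phi> x) \<le> (\<Sum>n. ennreal (p (\<lambda>x. c * f n x)))"
      by (rule upper_le)
    also have "\<dots> = ennreal c * (\<Sum>n. ennreal (p (f n)))"
      using assms nonneg[OF f] by (simp add: scale f ennreal_mult)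
    finally show ?thesis .
  qed
  then have le: "ennreal (1 / c) * upper (\<lambda>x. ennreal c * \<phi> x) \<le> ennreal (1 / c) * (ennreal c * (\<Sum>n. ennreal (p (f n))))"
    if "f \<in> covers \<phi>" for f
    using that by (intro mult_left_mono) auto
  have inv: "ennreal (1 / c) * (ennreal c * y) = y" "ennreal c * (ennreal (1 / c) * y) = y" for y
    using False assms by (simp_all add: mult.assoc[symmetric] ennreal_mult[symmetric])
  have "ennreal (1 / c) * upper (\<lambda>x. ennreal c * \<phi> x) \<le> upper \<phi>"
    unfolding upper_def[of \<phi>] using le unfolding inv by (rule INF_greatest)
  then have "ennreal c * (ennreal (1 / c) * upper (\<lambda>x. ennreal c * \<phi> x)) \<le> ennreal c * upper \<phi>"
    by (rule mult_left_mono) simp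
  then show ?thesis
    by (simp only: inv)
qed

text \<open>The outer measure induced by the upper integral.\<close>

definition outer :: "'a set \<Rightarrow> ennreal" where
  "outer A = upper (indicator A)"

lemma outer_measure_space_outer: "outer_measure_space (Pow UNIV) outer"
  unfolding outer_measure_space_def
proof (intro conjI)
  have "upper (\<lambda>x. 0) = 0"
    using upper_continuous[of "\<lambda>x. 0"] nonneg_cont_const[of 0] by simp
  moreover have "indicator {} = (\<lambda>x::'a. 0::ennreal)"
    by auto
  ultimately show "positive (Pow UNIV) outer"
    by (simp add: positive_def outer_def)
  show "increasing (Pow UNIV) outer"
    by (auto simp: increasing_def outer_def indicator_def intro!: upper_mono)
  show "countably_subadditive (Pow UNIV) outer"
    unfolding countably_subadditive_def
  proof (intro allI impI)
    fix A :: "nat \<Rightarrow> 'a set"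
    show "outer (\<Union>i. A i) \<le> (\<Sum>i. outer (A i))"
      unfolding outer_def
    proof (rule upper_countably_subadditive)
      fix x
      show "indicator (\<Union>i. A i) x \<le> (\<Sum>n. indicator (A n) x :: ennreal)"
      proof (cases "x \<in> (\<Union>i. A i)")
        case True
        then obtain i where "x \<in> A i" by blast
        then show ?thesis
          using sum_le_suminf[of "\<lambda>n. indicator (A n) x :: ennreal" "{i}"] True by simp
      qed simp
    qed
  qed
qed

text \<open>A zero set \<open>{f = 0}\<close> is measurable in the sense of Caratheodory: the functions
  \<open>min 1 ((k + 1) f) - min 1 (k f)\<close> are continuous and add up to the indicator of its
  complement.\<close>

lemma zero_set_in_lambda_system:
  assumes "Z \<in> zero_sets"
  shows "Z \<in> lambda_system UNIV (Pow UNIV) outer"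
proof -
  obtain f :: "'a \<Rightarrow> real" where f: "continuous_on UNIV f" "\<And>x. 0 \<le> f x" "Z = {x. f x = 0}"
    using zero_setE[OF assms] by metis
  define u where "u k x = min 1 (real k * f x)" for k x
  define v where "v k x = u (Suc k) x - u k x" for k x
  have u_cont: "continuous_on UNIV (u k)" for k
    unfolding u_def by (intro continuous_intros f)
  have v: "v k \<in> nonneg_cont" for k
  proof (rule nonneg_contI)
    show "continuous_on UNIV (v k)"
      unfolding v_def by (intro continuous_intros u_cont)
    show "0 \<le> v k x" for x
      using f(2)[of x] by (auto simp: v_def u_def algebra_simps min_def)
  qed
  have v_sum: "(\<Sum>k<K. v k x) = u K x" for K x
    using f(2)[of x] sum_lessThan_telescope[of "\<lambda>k. u k x" K] by (simp add: v_def u_def)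
  have ineq: "outer (E - Z) + outer (E \<inter> Z) \<le> outer E" for E
  proof -
    have "outer (E - Z) \<le> (\<Sum>k. upper (\<lambda>x. indicator E x * ennreal (v k x)))"
      unfolding outer_def
    proof (rule upper_countably_subadditive)
      fix x
      show "indicator (E - Z) x \<le> (\<Sum>k. indicator E x * ennreal (v k x))"
      proof (cases "x \<in> E - Z")
        case True
        then have "0 < f x" using f(2)[of x] by (auto simp: f(3))
        then obtain K where "1 < real K * f x"
          using reals_Archimedean3 by blast
        then have "u K x = 1" by (simp add: u_def)
        then have "1 = ennreal (\<Sum>k<K. v k x)"
          by (simp add: v_sum)
        also have "\<dots> = (\<Sum>k<K. ennreal (v k x))"
          using nonneg_contD(2)[OF v] by (simp add: sum_ennreal)
        also have "\<dots> \<le> (\<Sum>k. ennreal (v k x))"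
          by (intro sum_le_suminf) auto
        finally show ?thesis using True by simp
      qed simp
    qed
    moreover have "(\<Sum>k<K. upper (\<lambda>x. indicator E x * ennreal (v k x))) + outer (E \<inter> Z) \<le> outer E" for K
    proof -
      define w where "w k = (if k < K then v k else (\<lambda>x. 1 - u K x))" for k
      have w: "w k \<in> nonneg_cont" for k
        using v by (auto simp: w_def nonneg_cont_def u_def intro!: continuous_intros f)
      have "(\<Sum>k<K. w k x) = u K x" for x
        unfolding v_sum[symmetric] by (rule sum.cong) (auto simp: w_def)
      then have w_sum: "(\<Sum>k\<in>{..<Suc K}. w k x) \<le> 1" for x
        by (simp add: w_def)
      have "outer (E \<inter> Z) \<le> upper (\<lambda>x. indicator E x * ennreal (w K x))"
        unfolding outer_def by (rule upper_mono) (auto simp: w_def u_def f(3) indicator_def)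
      moreover have "(\<Sum>k<K. upper (\<lambda>x. indicator E x * ennreal (v k x)))
          = (\<Sum>k<K. upper (\<lambda>x. indicator E x * ennreal (w k x)))"
        by (rule sum.cong) (auto simp: w_def)
      ultimately have "(\<Sum>k<K. upper (\<lambda>x. indicator E x * ennreal (v k x))) + outer (E \<inter> Z)
          \<le> (\<Sum>k<Suc K. upper (\<lambda>x. indicator E x * ennreal (w k x)))"
        by (simp add: add_left_mono)
      also have "\<dots> \<le> outer E"
        unfolding outer_def by (rule upper_partition_le[OF _ w w_sum]) simp
      finally show ?thesis .
    qed
    then have "(\<Sum>k. upper (\<lambda>x. indicator E x * ennreal (v k x))) + outer (E \<inter> Z) \<le> outer E"
      by (rule ennreal_suminf_bound_add)
    ultimately show ?thesis
      by (meson add_right_mono order_trans)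
  qed
  have "outer E \<le> outer (E - Z) + outer (E \<inter> Z)" for E
  proof -
    define A where "A n = (if n = 0 then E - Z else if n = 1 then E \<inter> Z else {})" for n :: nat
    have o0: "outer {} = 0"
      using outer_measure_space_outer by (simp add: outer_measure_space_def positive_def)
    have "disjoint_family A"
      by (auto simp: disjoint_family_on_def A_def)
    then have "outer (\<Union>n. A n) \<le> (\<Sum>n. outer (A n))"
      using outer_measure_space_outer by (simp add: outer_measure_space_def countably_subadditive_def)
    also have "\<dots> = outer (E - Z) + outer (E \<inter> Z)"
      by (subst suminf_finite[of "{0, 1}"]) (auto simp: A_def o0)
    also have "(\<Union>n. A n) = E"
      by (auto simp: A_def split: if_splits)
    finally show ?thesis .
  qed
  with ineq have "outer (E - Z) + outer (E \<inter> Z) = outer E" for E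
    by (rule antisym)
  moreover have "(UNIV - Z) \<inter> E = E - Z" "Z \<inter> E = E \<inter> Z" for E
    by auto
  ultimately have "outer (Z \<inter> E) + outer ((UNIV - Z) \<inter> E) = outer E" for E
    by (simp add: add.commute)
  then show ?thesis
    by (simp add: lambda_system_def)
qed

text \<open>The restriction of the outer measure to the Baire sets.\<close>

definition daniell_measure :: "'a measure" where
  "daniell_measure = measure_of UNIV zero_sets outer"

lemma sets_daniell_measure: "sets daniell_measure = sets baire"
  by (simp add: daniell_measure_def sets_baire sets_measure_of_conv)

lemma space_daniell_measure: "space daniell_measure = UNIV"
  by (rule space_if_sets_baire[OF sets_daniell_measure])

lemma emeasure_daniell_measure:
  assumes "A \<in> sets baire"
  shows "emeasure daniell_measure A = outer A"
proof -
  have L: "measure_space UNIV (lambda_system UNIV (Pow UNIV) outer) outer"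
    using sigma_algebra.caratheodory_lemma[OF sigma_algebra_Pow outer_measure_space_outer] .
  then have "sigma_algebra UNIV (lambda_system UNIV (Pow UNIV) outer)"
    by (simp add: measure_space_def)
  then have "sigma_sets UNIV zero_sets \<subseteq> lambda_system UNIV (Pow UNIV) outer"
    by (rule sigma_algebra.sigma_sets_subset) (use zero_set_in_lambda_system in blast)
  then have "measure_space UNIV (sigma_sets UNIV zero_sets) outer"
    by (intro measure_down[OF L] sigma_algebra_sigma_sets) auto
  then show ?thesis
    using assms unfolding daniell_measure_def sets_baire
    by (intro emeasure_measure_of[OF refl]) (auto simp: measure_space_def)
qed

lemma emeasure_daniell_UNIV: "emeasure daniell_measure UNIV = ennreal (p (\<lambda>x. 1))"
proof -
  have "UNIV \<in> sets (baire :: 'a measure)"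
    using sets.top[of "baire :: 'a measure"] by simp
  then show ?thesis
    using upper_continuous[OF nonneg_cont_const[of 1]]
    by (simp add: emeasure_daniell_measure outer_def)
qed

lemma finite_daniell_measure: "finite_measure daniell_measure"
  by (rule finite_measureI) (simp add: space_daniell_measure emeasure_daniell_UNIV)

lemma measurable_daniell:
  "f \<in> nonneg_cont \<Longrightarrow> f \<in> borel_measurable daniell_measure"
  using continuous_baire_measurable_real[OF nonneg_contD(1)]
  by (simp add: measurable_cong_sets[OF sets_daniell_measure refl])

text \<open>A function is dominated by \<open>\<delta>\<close> times the sum of the indicators of its superlevel sets at the
  multiples of \<open>\<delta>\<close>, with an error of at most \<open>\<delta>\<close>, and the upper integral is countably
  subadditive.\<close>

lemma functional_le_nn_integral:
  assumes f: "f \<in> nonneg_cont"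
  shows "ennreal (p f) \<le> (\<integral>\<^sup>+x. f x \<partial>daniell_measure)"
proof -
  interpret D: finite_measure daniell_measure by (rule finite_daniell_measure)
  have [measurable]: "f \<in> borel_measurable daniell_measure"
    by (rule measurable_daniell[OF f])
  have bound: "ennreal (p f) \<le> (\<integral>\<^sup>+x. f x \<partial>daniell_measure) + ennreal \<delta> * ennreal (p (\<lambda>x. 1))"
    if "\<delta> > 0" for \<delta>
  proof -
    define A where "A k = {x. real k * \<delta> < f x}" for k :: nat
    have A: "A k \<in> sets daniell_measure" for k
    proof -
      have "{x \<in> space daniell_measure. real k * \<delta> < f x} \<in> sets daniell_measure"
        by measurable
      then show ?thesis by (simp add: A_def space_daniell_measure)
    qed
    \<comment> \<open>The number of \<open>k\<close> with \<open>k \<delta> < f x\<close> is the ceiling of \<open>f x / \<delta>\<close>.\<close>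
    have layers: "(\<Sum>k. ennreal \<delta> * indicator (A k) x) = ennreal (\<delta> * of_int \<lceil>f x / \<delta>\<rceil>)" for x
    proof -
      have fx: "0 \<le> f x / \<delta>" using nonneg_contD(2)[OF f, of x] that by simp
      have in_A: "x \<in> A k \<longleftrightarrow> k < nat \<lceil>f x / \<delta>\<rceil>" for k
      proof -
        have "x \<in> A k \<longleftrightarrow> of_int (int k) < f x / \<delta>"
          using that by (simp add: A_def field_simps)
        also have "\<dots> \<longleftrightarrow> int k < \<lceil>f x / \<delta>\<rceil>"
          by (rule less_ceiling_iff[symmetric])
        finally show ?thesis by (simp add: zless_nat_eq_int_zless)
      qed
      have "(\<Sum>k. ennreal \<delta> * indicator (A k) x) = (\<Sum>k<nat \<lceil>f x / \<delta>\<rceil>. ennreal \<delta> * indicator (A k) x)"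
        by (rule suminf_finite) (auto simp: in_A)
      also have "\<dots> = (\<Sum>k<nat \<lceil>f x / \<delta>\<rceil>. ennreal \<delta>)"
        by (rule sum.cong) (auto simp: in_A)
      also have "\<dots> = ennreal (\<Sum>k<nat \<lceil>f x / \<delta>\<rceil>. \<delta>)"
        using that by (intro sum_ennreal) auto
      also have "\<dots> = ennreal (\<delta> * of_int \<lceil>f x / \<delta>\<rceil>)"
        using fx by (simp add: mult.commute)
      finally show ?thesis .
    qed
    have "ennreal (p f) = upper (\<lambda>x. ennreal (f x))"
      by (rule upper_continuous[OF f, symmetric])
    also have "\<dots> \<le> (\<Sum>k. upper (\<lambda>x. ennreal \<delta> * indicator (A k) x))"
    proof (rule upper_countably_subadditive)
      fix x
      have "f x / \<delta> * \<delta> \<le> of_int \<lceil>f x / \<delta>\<rceil> * \<delta>"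
        using that by (intro mult_right_mono le_of_int_ceiling) auto
      then show "ennreal (f x) \<le> (\<Sum>k. ennreal \<delta> * indicator (A k) x)"
        unfolding layers using that by (intro ennreal_leI) (simp add: mult.commute)
    qed
    also have "\<dots> \<le> (\<Sum>k. ennreal \<delta> * outer (A k))"
      using that unfolding outer_def by (intro suminf_le upper_scale_le summableI) auto
    also have "\<dots> = (\<Sum>k. \<integral>\<^sup>+x. ennreal \<delta> * indicator (A k) x \<partial>daniell_measure)"
      using A by (intro suminf_cong) (simp add: nn_integral_cmult_indicator emeasure_daniell_measure sets_daniell_measure)
    also have "\<dots> = (\<integral>\<^sup>+x. (\<Sum>k. ennreal \<delta> * indicator (A k) x) \<partial>daniell_measure)"
      using A by (intro nn_integral_suminf[symmetric]) auto
    also have "\<dots> \<le> (\<integral>\<^sup>+x. ennreal (f x) + ennreal \<delta> \<partial>daniell_measure)"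
    proof (rule nn_integral_mono)
      fix x
      have "\<delta> * of_int \<lceil>f x / \<delta>\<rceil> \<le> \<delta> * (f x / \<delta> + 1)"
        using that by (intro mult_left_mono of_int_ceiling_le_add_one) auto
      then have "\<delta> * of_int \<lceil>f x / \<delta>\<rceil> \<le> f x + \<delta>"
        using that by (simp add: distrib_left)
      then show "(\<Sum>k. ennreal \<delta> * indicator (A k) x) \<le> ennreal (f x) + ennreal \<delta>"
        unfolding layers using that nonneg_contD(2)[OF f, of x]
        by (metis ennreal_leI ennreal_plus less_imp_le)
    qed
    also have "\<dots> = (\<integral>\<^sup>+x. f x \<partial>daniell_measure) + ennreal \<delta> * ennreal (p (\<lambda>x. 1))"
      by (simp add: nn_integral_add space_daniell_measure emeasure_daniell_UNIV)
    finally show ?thesis .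
  qed
  show ?thesis
  proof (rule ennreal_le_epsilon)
    fix e :: real assume "e > 0"
    have p1: "0 \<le> p (\<lambda>x. 1)" by (rule nonneg[OF nonneg_cont_const]) simp
    define \<delta> where "\<delta> = e / (p (\<lambda>x. 1) + 1)"
    have \<delta>: "\<delta> > 0" "\<delta> * p (\<lambda>x. 1) \<le> e"
      using \<open>e > 0\<close> p1 by (auto simp: \<delta>_def field_simps)
    have "ennreal (p f) \<le> (\<integral>\<^sup>+x. f x \<partial>daniell_measure) + ennreal (\<delta> * p (\<lambda>x. 1))"
      using bound[OF \<delta>(1)] \<delta>(1) p1 by (simp add: ennreal_mult)
    also have "\<dots> \<le> (\<integral>\<^sup>+x. f x \<partial>daniell_measure) + ennreal e"
      using \<delta>(2) by (intro add_left_mono ennreal_leI)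
    finally show "ennreal (p f) \<le> (\<integral>\<^sup>+x. f x \<partial>daniell_measure) + ennreal e" .
  qed
qed

text \<open>For bounded \<open>f \<le> N\<close> the converse inequality is the previous one applied to \<open>N - f\<close>.\<close>

lemma nn_integral_daniell_bounded:
  assumes f: "f \<in> nonneg_cont" and le: "\<And>x. f x \<le> N"
  shows "(\<integral>\<^sup>+x. f x \<partial>daniell_measure) = ennreal (p f)"
proof -
  have N: "0 \<le> N"
    using nonneg_contD(2)[OF f, of undefined] le[of undefined] by simp
  have g: "(\<lambda>x. N - f x) \<in> nonneg_cont"
    using nonneg_contD(1)[OF f] le by (auto simp: nonneg_cont_def intro!: continuous_intros)
  note [measurable] = measurable_daniell[OF f] measurable_daniell[OF g]
  let ?I = "\<lambda>f. \<integral>\<^sup>+x. ennreal (f x) \<partial>daniell_measure"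
  have "?I f + ?I (\<lambda>x. N - f x) = (\<integral>\<^sup>+x. ennreal (f x) + ennreal (N - f x) \<partial>daniell_measure)"
    by (simp add: nn_integral_add)
  also have "\<dots> = (\<integral>\<^sup>+x. ennreal N \<partial>daniell_measure)"
    using nonneg_contD(2)[OF f] nonneg_contD(2)[OF g]
    by (intro nn_integral_cong) (simp add: ennreal_plus[symmetric] del: ennreal_plus)
  also have "\<dots> = ennreal (p (\<lambda>x. N * 1))"
    using N nonneg[OF nonneg_cont_const[of 1]]
    by (subst scale) (simp_all add: space_daniell_measure emeasure_daniell_UNIV ennreal_mult nonneg_cont_const)
  also have "p (\<lambda>x. N * 1) = p f + p (\<lambda>x. N - f x)"
    using add[OF f g] by simp
  also have "ennreal (p f + p (\<lambda>x. N - f x)) = ennreal (p f) + ennreal (p (\<lambda>x. N - f x))"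
    using nonneg[OF f] nonneg[OF g] by (rule ennreal_plus)
  finally have eq: "?I f + ?I (\<lambda>x. N - f x) = ennreal (p f) + ennreal (p (\<lambda>x. N - f x))" .
  have "?I f \<le> ennreal (p f)"
  proof -
    have "?I f + ennreal (p (\<lambda>x. N - f x)) \<le> ennreal (p f) + ennreal (p (\<lambda>x. N - f x))"
      using functional_le_nn_integral[OF g] unfolding eq[symmetric] by (rule add_left_mono)
    then show ?thesis
      by (simp add: ennreal_add_left_cancel_le add.commute[of _ "ennreal (p (\<lambda>x. N - f x))"])
  qed
  then show ?thesis
    using functional_le_nn_integral[OF f] by (rule antisym)
qed

theorem nn_integral_daniell:
  assumes f: "f \<in> nonneg_cont"
  shows "(\<integral>\<^sup>+x. f x \<partial>daniell_measure) = ennreal (p f)"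
proof (rule antisym)
  note [measurable] = measurable_daniell[OF f]
  have fn: "(\<lambda>x. min (f x) (real n)) \<in> nonneg_cont" for n
    using f by (auto simp: nonneg_cont_def intro!: continuous_intros)
  have eq: "(\<integral>\<^sup>+x. ennreal (min (f x) (real n)) \<partial>daniell_measure) = ennreal (p (\<lambda>x. min (f x) (real n)))" for n
    by (rule nn_integral_daniell_bounded[OF fn, of n "real n"]) simp
  have sup: "(SUP n. ennreal (min (f x) (real n))) = ennreal (f x)" for x
  proof (rule antisym)
    show "(SUP n. ennreal (min (f x) (real n))) \<le> ennreal (f x)"
      by (intro SUP_least ennreal_leI) simp
    obtain n where "f x \<le> real n" using real_arch_simple by blast
    then have "ennreal (f x) = ennreal (min (f x) (real n))" by simp
    then show "ennreal (f x) \<le> (SUP n. ennreal (min (f x) (real n)))"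
      by (metis SUP_upper UNIV_I)
  qed
  have "(\<integral>\<^sup>+x. f x \<partial>daniell_measure) = (\<integral>\<^sup>+x. (SUP n. ennreal (min (f x) (real n))) \<partial>daniell_measure)"
    by (simp add: sup)
  also have "\<dots> = (SUP n. \<integral>\<^sup>+x. ennreal (min (f x) (real n)) \<partial>daniell_measure)"
    by (intro nn_integral_monotone_convergence_SUP) (auto simp: incseq_def le_fun_def intro!: ennreal_leI)
  also have "\<dots> = (SUP n. ennreal (p (\<lambda>x. min (f x) (real n))))"
    by (simp add: eq)
  also have "\<dots> \<le> ennreal (p f)"
    by (intro SUP_least ennreal_leI mono fn f) simp
  finally show "(\<integral>\<^sup>+x. f x \<partial>daniell_measure) \<le> ennreal (p f)" .
qed (rule functional_le_nn_integral[OF f])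

end


section \<open>Order-bounded functionals and complex Baire measures\<close>

text \<open>Real-linear functionals on the continuous real functions that are bounded on order
  intervals.\<close>

definition order_bounded :: "(('a::topological_space \<Rightarrow> real) \<Rightarrow> real) \<Rightarrow> bool" where
  "order_bounded q \<longleftrightarrow>
     (\<forall>f g. continuous_on UNIV f \<longrightarrow> continuous_on UNIV g \<longrightarrow> q (\<lambda>x. f x + g x) = q f + q g) \<and>
     (\<forall>c f. continuous_on UNIV f \<longrightarrow> q (\<lambda>x. c * f x) = c * q f) \<and>
     (\<forall>h\<in>nonneg_cont. bdd_above (q ` {u\<in>nonneg_cont. \<forall>x. u x \<le> h x}))"

text \<open>The Riesz decomposition: the positive part of \<open>q\<close> at \<open>h \<ge> 0\<close> is the supremum of the values
  of \<open>q\<close> on the order interval from \<open>0\<close> to \<open>h\<close>.\<close>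

lemma riesz_decomposition:
  fixes q :: "('a::topological_space \<Rightarrow> real) \<Rightarrow> real"
  assumes "order_bounded q"
  obtains p1 p2 where "positive_functional p1" "positive_functional p2"
    "\<And>f. f \<in> nonneg_cont \<Longrightarrow> q f = p1 f - p2 f"
proof -
  have add: "q (\<lambda>x. f x + g x) = q f + q g" if "continuous_on UNIV f" "continuous_on UNIV g" for f g
    using assms that by (simp add: order_bounded_def)
  have scale: "q (\<lambda>x. c * f x) = c * q f" if "continuous_on UNIV f" for c f
    using assms that by (simp add: order_bounded_def)
  define I where "I h = {u\<in>nonneg_cont. \<forall>x. u x \<le> h x}" for h :: "'a \<Rightarrow> real"
  have bdd: "bdd_above (q ` I h)" if "h \<in> nonneg_cont" for h
    using assms that by (simp add: order_bounded_def I_def)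
  define p1 where "p1 h = (SUP u\<in>I h. q u)" for h
  have upper: "q u \<le> p1 h" if "h \<in> nonneg_cont" "u \<in> nonneg_cont" "\<And>x. u x \<le> h x" for u h
    unfolding p1_def using that by (intro cSUP_upper bdd) (auto simp: I_def)
  have I_ne: "I h \<noteq> {}" if "h \<in> nonneg_cont" for h
    using that by (auto simp: I_def)
  have least: "p1 h \<le> c" if "h \<in> nonneg_cont"
    "\<And>u. u \<in> nonneg_cont \<Longrightarrow> (\<And>x. u x \<le> h x) \<Longrightarrow> q u \<le> c" for h c
    unfolding p1_def using that by (intro cSUP_least I_ne) (auto simp: I_def)
  have p1_add: "p1 (\<lambda>x. f x + g x) = p1 f + p1 g" if f: "f \<in> nonneg_cont" and g: "g \<in> nonneg_cont" for f g
  proof (rule antisym)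
    have fg: "(\<lambda>x. f x + g x) \<in> nonneg_cont" by (rule nonneg_cont_add[OF f g])
    show "p1 (\<lambda>x. f x + g x) \<le> p1 f + p1 g"
    proof (rule least[OF fg])
      fix w assume w: "w \<in> nonneg_cont" and le: "\<And>x. w x \<le> f x + g x"
      define u where "u x = min (w x) (f x)" for x
      define v where "v x = w x - u x" for x
      have u: "u \<in> nonneg_cont"
        using f w by (auto simp: nonneg_cont_def u_def intro!: continuous_intros)
      have v: "v \<in> nonneg_cont"
        using f w by (auto simp: nonneg_cont_def u_def v_def intro!: continuous_intros)
      have "q w = q (\<lambda>x. u x + v x)" by (simp add: v_def)
      also have "\<dots> = q u + q v" by (intro add nonneg_contD u v)
      also have "\<dots> \<le> p1 f + p1 g"
      proof (intro add_mono upper f g u v)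
        show "u x \<le> f x" for x by (simp add: u_def)
        show "v x \<le> g x" for x using le[of x] nonneg_contD(2)[OF g, of x] by (simp add: u_def v_def min_def)
      qed
      finally show "q w \<le> p1 f + p1 g" .
    qed
    have "p1 g \<le> p1 (\<lambda>x. f x + g x) - p1 f"
    proof (rule least[OF g])
      fix v assume v: "v \<in> nonneg_cont" and v_le: "\<And>x. v x \<le> g x"
      have "p1 f \<le> p1 (\<lambda>x. f x + g x) - q v"
      proof (rule least[OF f])
        fix u assume u: "u \<in> nonneg_cont" and u_le: "\<And>x. u x \<le> f x"
        have "q u + q v = q (\<lambda>x. u x + v x)" by (intro add[symmetric] nonneg_contD u v)
        also have "\<dots> \<le> p1 (\<lambda>x. f x + g x)"
          by (intro upper[OF fg] nonneg_cont_add u v add_mono u_le v_le)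
        finally show "q u \<le> p1 (\<lambda>x. f x + g x) - q v" by simp
      qed
      then show "q v \<le> p1 (\<lambda>x. f x + g x) - p1 f" by simp
    qed
    then show "p1 f + p1 g \<le> p1 (\<lambda>x. f x + g x)" by simp
  qed
  have q0: "q (\<lambda>x. 0) = 0"
    using scale[of "\<lambda>x. 0" 0] by simp
  have scale_cont: "(\<lambda>x. c * f x) \<in> nonneg_cont" if "0 \<le> c" "f \<in> nonneg_cont" for c f
    using that by (auto simp: nonneg_cont_def intro!: continuous_intros)
  have p1_scale_le: "p1 (\<lambda>x. c * f x) \<le> c * p1 f" if c: "0 < c" and f: "f \<in> nonneg_cont" for c f
  proof (rule least[OF scale_cont[OF less_imp_le[OF c] f]])
    fix w assume w: "w \<in> nonneg_cont" and le: "\<And>x. w x \<le> c * f x"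
    have w': "(\<lambda>x. (1 / c) * w x) \<in> nonneg_cont"
      using c by (intro scale_cont w) auto
    have "q w = q (\<lambda>x. c * ((1 / c) * w x))"
      using c by simp
    also have "\<dots> = c * q (\<lambda>x. (1 / c) * w x)"
      by (rule scale[OF nonneg_contD(1)[OF w']])
    also have "\<dots> \<le> c * p1 f"
      using c le by (intro mult_left_mono upper f w') (auto simp: field_simps)
    finally show "q w \<le> c * p1 f" .
  qed
  have "positive_functional p1"
  proof
    fix f :: "'a \<Rightarrow> real" assume f: "f \<in> nonneg_cont"
    show "0 \<le> p1 f"
      using upper[OF f, of "\<lambda>x. 0"] nonneg_contD(2)[OF f] by (simp add: q0 nonneg_cont_const)
    fix c :: real assume "0 \<le> c"
    show "p1 (\<lambda>x. c * f x) = c * p1 f"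
    proof (cases "c = 0")
      case True
      have "p1 (\<lambda>x. 0) = 0"
        using p1_add[of "\<lambda>x. 0" "\<lambda>x. 0"] by (simp add: nonneg_cont_const)
      then show ?thesis using True by simp
    next
      case False
      then have c: "0 < c" using \<open>0 \<le> c\<close> by simp
      have "p1 (\<lambda>x. (1 / c) * (c * f x)) \<le> (1 / c) * p1 (\<lambda>x. c * f x)"
        using c by (intro p1_scale_le scale_cont f) auto
      then have "c * p1 f \<le> p1 (\<lambda>x. c * f x)"
        using c by (simp add: field_simps)
      with p1_scale_le[OF c f] show ?thesis by simp
    qed
  qed (rule p1_add)
  moreover from this have "positive_functional (\<lambda>f. p1 f - q f)"
    using scale_cont by unfold_locales
      (auto simp: positive_functional.add positive_functional.scale add scale nonneg_contD(1) algebra_simps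
        intro!: upper)
  ultimately show ?thesis
    by (rule that) simp
qed

lemma positive_functional_add:
  assumes "positive_functional p1" "positive_functional p2"
  shows "positive_functional (\<lambda>f. p1 f + p2 f)"
proof -
  interpret p1: positive_functional p1 by fact
  interpret p2: positive_functional p2 by fact
  show ?thesis
    by unfold_locales (auto simp: p1.nonneg p2.nonneg p1.add p2.add p1.scale p2.scale algebra_simps)
qed

text \<open>A positive functional dominated by another one has a density with respect to the Daniell
  measure of the larger one.\<close>

lemma dominated_functional_density:
  fixes p p' :: "('a::topological_space \<Rightarrow> real) \<Rightarrow> real"
  assumes p: "positive_functional p" and p': "positive_functional p'"
    and le: "\<And>f. f \<in> nonneg_cont \<Longrightarrow> p f \<le> p' f"
  obtains D :: "'a \<Rightarrow> real" where
    "\<And>f. f \<in> nonneg_cont \<Longrightarrow>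
      has_bochner_integral (positive_functional.daniell_measure p') (\<lambda>x. D x * f x) (p f)"
proof -
  interpret p: positive_functional p by fact
  interpret p': positive_functional p' by fact
  interpret M': finite_measure p'.daniell_measure by (rule p'.finite_daniell_measure)
  have upper_le: "p.upper \<phi> \<le> p'.upper \<phi>" for \<phi>
    unfolding p.upper_def p'.upper_def p.covers_def p'.covers_def
    by (rule INF_mono) (auto intro!: suminf_le ennreal_leI le)
  have ac: "absolutely_continuous p'.daniell_measure p.daniell_measure"
    unfolding absolutely_continuous_def
  proof
    fix A assume "A \<in> null_sets p'.daniell_measure"
    then have A: "A \<in> sets baire" "p'.outer A = 0"
      by (auto simp: null_sets_def p'.sets_daniell_measure p'.emeasure_daniell_measure)
    then have "p.outer A = 0"
      using upper_le[of "indicator A"] by (simp add: p.outer_def p'.outer_def)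
    then show "A \<in> null_sets p.daniell_measure"
      using A by (simp add: null_sets_def p.sets_daniell_measure p.emeasure_daniell_measure)
  qed
  have sets_eq: "sets p.daniell_measure = sets p'.daniell_measure"
    by (simp add: p.sets_daniell_measure p'.sets_daniell_measure)
  obtain D where D: "D \<in> borel_measurable p'.daniell_measure" "\<And>x. 0 \<le> D x"
      "AE x in p'.daniell_measure. RN_deriv p'.daniell_measure p.daniell_measure x = ennreal (D x)"
    using M'.real_RN_deriv[OF p.finite_daniell_measure ac sets_eq] by metis
  have dens: "density p'.daniell_measure (\<lambda>x. ennreal (D x)) = p.daniell_measure"
  proof -
    have "density p'.daniell_measure (\<lambda>x. ennreal (D x))
        = density p'.daniell_measure (RN_deriv p'.daniell_measure p.daniell_measure)"
      using D by (intro density_cong) auto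
    also have "\<dots> = p.daniell_measure"
      by (rule M'.density_RN_deriv[OF ac sets_eq])
    finally show ?thesis .
  qed
  show ?thesis
  proof (rule that)
    fix f :: "'a \<Rightarrow> real" assume f: "f \<in> nonneg_cont"
    note [measurable] = D(1) p'.measurable_daniell[OF f]
    have "(\<integral>\<^sup>+x. ennreal (D x * f x) \<partial>p'.daniell_measure)
        = (\<integral>\<^sup>+x. ennreal (f x) \<partial>density p'.daniell_measure (\<lambda>x. ennreal (D x)))"
      using D(2) nonneg_contD(2)[OF f] by (simp add: nn_integral_density ennreal_mult)
    also have "\<dots> = ennreal (p f)"
      unfolding dens by (rule p.nn_integral_daniell[OF f])
    finally show "has_bochner_integral p'.daniell_measure (\<lambda>x. D x * f x) (p f)"
      using D(2) nonneg_contD(2)[OF f] p.nonneg[OF f] by (intro has_bochner_integral_nn_integral) auto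
  qed
qed

text \<open>The two functionals become real and imaginary part of integration against one complex
  density. The base measure is the Daniell measure of the sum of the four positive functionals in
  their Riesz decompositions, so that each of these is dominated.\<close>

theorem order_bounded_pair_representation:
  fixes q1 q2 :: "('a::topological_space \<Rightarrow> real) \<Rightarrow> real"
  assumes q1: "order_bounded q1" and q2: "order_bounded q2"
  obtains M :: "'a measure" and \<theta> :: "'a \<Rightarrow> complex"
  where "finite_measure M" "sets M = sets baire"
    "\<And>f. continuous_on UNIV f \<Longrightarrow>
      has_bochner_integral M (\<lambda>x. complex_of_real (f x) * \<theta> x) (Complex (q1 f) (q2 f))"
proof -
  obtain p1 p2 where p12: "positive_functional p1" "positive_functional p2"
      "\<And>f. f \<in> nonneg_cont \<Longrightarrow> q1 f = p1 f - p2 f"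
    using riesz_decomposition[OF q1] by metis
  obtain p3 p4 where p34: "positive_functional p3" "positive_functional p4"
      "\<And>f. f \<in> nonneg_cont \<Longrightarrow> q2 f = p3 f - p4 f"
    using riesz_decomposition[OF q2] by metis
  define p where "p f = (p1 f + p2 f) + (p3 f + p4 f)" for f
  have p: "positive_functional p"
    unfolding p_def by (intro positive_functional_add p12 p34)
  interpret p: positive_functional p by fact
  note nonneg = p12(1,2)[THEN positive_functional.nonneg] p34(1,2)[THEN positive_functional.nonneg]
  let ?M = p.daniell_measure
  have le: "p1 f \<le> p f" "p2 f \<le> p f" "p3 f \<le> p f" "p4 f \<le> p f" if "f \<in> nonneg_cont" for f
    using nonneg[OF that] by (auto simp: p_def)
  obtain D1 where D1: "\<And>f. f \<in> nonneg_cont \<Longrightarrow> has_bochner_integral ?M (\<lambda>x. D1 x * f x) (p1 f)"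
    using dominated_functional_density[OF p12(1) p le(1)] by metis
  obtain D2 where D2: "\<And>f. f \<in> nonneg_cont \<Longrightarrow> has_bochner_integral ?M (\<lambda>x. D2 x * f x) (p2 f)"
    using dominated_functional_density[OF p12(2) p le(2)] by metis
  obtain D3 where D3: "\<And>f. f \<in> nonneg_cont \<Longrightarrow> has_bochner_integral ?M (\<lambda>x. D3 x * f x) (p3 f)"
    using dominated_functional_density[OF p34(1) p le(3)] by metis
  obtain D4 where D4: "\<And>f. f \<in> nonneg_cont \<Longrightarrow> has_bochner_integral ?M (\<lambda>x. D4 x * f x) (p4 f)"
    using dominated_functional_density[OF p34(2) p le(4)] by metis
  \<comment> \<open>The passage from the cone to all continuous functions, by splitting into positive and
    negative parts.\<close>
  have extend: "has_bochner_integral ?M (\<lambda>x. (D x - D' x) * f x) (q f)"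
    if q: "order_bounded q" and eq: "\<And>f. f \<in> nonneg_cont \<Longrightarrow> q f = r f - r' f"
      and D: "\<And>f. f \<in> nonneg_cont \<Longrightarrow> has_bochner_integral ?M (\<lambda>x. D x * f x) (r f)"
      and D': "\<And>f. f \<in> nonneg_cont \<Longrightarrow> has_bochner_integral ?M (\<lambda>x. D' x * f x) (r' f)"
      and f: "continuous_on UNIV f" for q r r' D D' f
  proof -
    define u where "u x = max 0 (f x)" for x
    define v where "v x = max 0 (- f x)" for x
    have uv: "u \<in> nonneg_cont" "v \<in> nonneg_cont"
      using f by (auto simp: nonneg_cont_def u_def v_def intro!: continuous_intros)
    have f_eq: "f x = u x - v x" for x
      by (simp add: u_def v_def)
    have "q u = q (\<lambda>x. f x + v x)"
      by (simp add: f_eq)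
    also have "\<dots> = q f + q v"
      using q f nonneg_contD(1)[OF uv(2)] by (simp add: order_bounded_def)
    finally have "q f = (r u - r' u) - (r v - r' v)"
      by (simp add: eq uv)
    moreover have "has_bochner_integral ?M (\<lambda>x. (D x * u x - D' x * u x) - (D x * v x - D' x * v x))
        ((r u - r' u) - (r v - r' v))"
      by (intro has_bochner_integral_diff D D' uv)
    moreover have "(\<lambda>x. (D x * u x - D' x * u x) - (D x * v x - D' x * v x)) = (\<lambda>x. (D x - D' x) * f x)"
      by (simp add: fun_eq_iff f_eq algebra_simps)
    ultimately show ?thesis
      by (simp only:)
  qed
  define \<theta> where "\<theta> x = Complex (D1 x - D2 x) (D3 x - D4 x)" for x
  show ?thesis
  proof (rule that[OF p.finite_daniell_measure p.sets_daniell_measure, of \<theta>])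
    fix f :: "'a \<Rightarrow> real" assume f: "continuous_on UNIV f"
    have "has_bochner_integral ?M
        (\<lambda>x. complex_of_real ((D1 x - D2 x) * f x) + \<i> * complex_of_real ((D3 x - D4 x) * f x))
        (complex_of_real (q1 f) + \<i> * complex_of_real (q2 f))"
      by (intro has_bochner_integral_add has_bochner_integral_mult_right has_bochner_integral_of_real
          extend[OF q1 p12(3) D1 D2 f] extend[OF q2 p34(3) D3 D4 f])
    then show "has_bochner_integral ?M (\<lambda>x. complex_of_real (f x) * \<theta> x) (Complex (q1 f) (q2 f))"
      by (simp add: \<theta>_def complex_eq_iff Complex_eq algebra_simps)
  qed
qed


section \<open>The measure with a given complex density\<close>

text \<open>A set function on the algebra that agrees with a finite Baire measure has that measure as its
  extension.\<close>

lemma baire_extension_eq: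
  assumes "finite_measure N" and sets_N: "sets N = sets baire"
    and eq: "\<And>A. A \<in> zero_algebra \<Longrightarrow> \<mu> A = emeasure N A"
  shows "baire_extension \<mu> = N"
proof -
  interpret N: finite_measure N by fact
  let ?E = "extend_measure UNIV zero_algebra (\<lambda>A. A) \<mu>"
  have sets_E: "sets ?E = sigma_sets UNIV zero_algebra"
    by (subst sets_extend_measure) auto
  have emeas: "emeasure ?E A = emeasure N A" if "A \<in> zero_algebra" for A
  proof -
    have sets_eq: "sets ?E = sets N"
      by (simp add: sets_E sets_N sets_baire_zero_algebra)
    have "emeasure ?E ((\<lambda>A. A) A) = \<mu> A"
    proof (rule emeasure_extend_measure[OF refl, where \<mu>' = "emeasure N"])
      show "positive (sets ?E) (emeasure N)" "countably_additive (sets ?E) (emeasure N)"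
        unfolding sets_eq by (rule emeasure_positive emeasure_countably_additive)+
    qed (use that eq in auto)
    then show ?thesis using eq[OF that] by simp
  qed
  have "?E = N"
  proof (rule measure_eqI_generator_eq[where \<Omega> = UNIV and E = zero_algebra and A = "\<lambda>_. UNIV"])
    show "Int_stable (zero_algebra :: 'a set set)"
      by (auto simp: Int_stable_def)
    show "sets N = sigma_sets UNIV zero_algebra"
      by (simp add: sets_N sets_baire_zero_algebra)
    show "emeasure ?E UNIV \<noteq> \<infinity>"
      using emeas[OF zero_algebra.top] N.emeasure_finite by (simp add: top_unique)
  qed (use emeas sets_E zero_algebra.top in auto)
  then show ?thesis by (simp add: baire_extension_def)
qed

lemma Cont_bdd_real_eq: "f \<in> Cont_bdd \<real> \<Longrightarrow> f x = of_real (Re (f x))"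
  unfolding Cont_bdd_def Cont_def by (auto simp: image_subset_iff)

text \<open>A finite measure on the Baire sets with an integrable complex density.\<close>

locale baire_density = finite_measure M for M :: "'a::topological_space measure" +
  fixes \<theta> :: "'a \<Rightarrow> complex"
  assumes sets_M: "sets M = sets baire" and integrable_\<theta>: "integrable M \<theta>"
begin

text \<open>The complex measure with density \<open>\<theta>\<close>; it is used only on Baire sets.\<close>

definition m :: "'a set \<Rightarrow> complex" where
  "m A = (LINT x:A|M. \<theta> x)"

text \<open>The measure that turns out to be the total variation of \<open>m\<close>.\<close>

definition abs_m :: "'a measure" where
  "abs_m = density M (\<lambda>x. ennreal (norm (\<theta> x)))"

lemma space_M: "space M = UNIV"
  by (rule space_if_sets_baire[OF sets_M])

lemma measurable_\<theta> [measurable]: "\<theta> \<in> borel_measurable M"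
  using integrable_\<theta> by (rule borel_measurable_integrable)

lemma zero_algebra_sets: "A \<in> zero_algebra \<Longrightarrow> A \<in> sets M"
  using zero_algebra_subset_baire by (auto simp: sets_M)

lemma zero_sets_sets: "A \<in> zero_sets \<Longrightarrow> A \<in> sets M"
  using zero_sets_subset_baire by (auto simp: sets_M)

lemma set_integrableI: "integrable M f \<Longrightarrow> A \<in> sets M \<Longrightarrow> set_integrable M A f"
  for f :: "'a \<Rightarrow> 'c::{banach, second_countable_topology}"
  unfolding set_integrable_def by (rule integrable_mult_indicator)

lemma density_emeasure:
  fixes t :: "'a \<Rightarrow> real"
  assumes "integrable M t" and A: "A \<in> sets M" and nn: "\<And>x. x \<in> A \<Longrightarrow> 0 \<le> t x"
  shows "emeasure (density M (\<lambda>x. ennreal (t x))) A = ennreal (LINT x:A|M. t x)"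
proof -
  have [measurable]: "t \<in> borel_measurable M"
    using assms(1) by (rule borel_measurable_integrable)
  have "emeasure (density M (\<lambda>x. ennreal (t x))) A = (\<integral>\<^sup>+x. ennreal (t x) * indicator A x \<partial>M)"
    using A by (intro emeasure_density) auto
  also have "\<dots> = (\<integral>\<^sup>+x. ennreal (indicator A x *\<^sub>R t x) \<partial>M)"
    by (intro nn_integral_cong) (auto simp: indicator_def)
  also have "\<dots> = ennreal (\<integral>x. indicator A x *\<^sub>R t x \<partial>M)"
    using nn by (intro nn_integral_eq_integral integrable_mult_indicator assms) (auto simp: indicator_def)
  finally show ?thesis by (simp add: set_lebesgue_integral_def)
qed

lemma finite_density:
  fixes t :: "'a \<Rightarrow> real"
  assumes t: "integrable M t"
  shows "finite_measure (density M (\<lambda>x. ennreal (t x)))"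
proof (rule finite_measureI)
  have [measurable]: "t \<in> borel_measurable M"
    using t by (rule borel_measurable_integrable)
  have "emeasure (density M (\<lambda>x. ennreal (t x))) (space M) = (\<integral>\<^sup>+x. ennreal (t x) * indicator (space M) x \<partial>M)"
    by (intro emeasure_density) auto
  also have "\<dots> \<le> (\<integral>\<^sup>+x. ennreal (norm (t x)) \<partial>M)"
    by (intro nn_integral_mono) (auto simp: indicator_def intro!: ennreal_leI)
  also have "\<dots> < \<infinity>"
    using t by (simp add: integrable_iff_bounded)
  finally show "emeasure (density M (\<lambda>x. ennreal (t x))) (space (density M (\<lambda>x. ennreal (t x)))) \<noteq> \<infinity>"
    by simp
qed

lemma finite_abs_m: "finite_measure abs_m"
  unfolding abs_m_def by (rule finite_density) (use integrable_\<theta> in simp)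

lemma sets_abs_m: "sets abs_m = sets baire"
  by (simp add: abs_m_def sets_M)

lemma emeasure_abs_m: "A \<in> sets M \<Longrightarrow> emeasure abs_m A = ennreal (LINT x:A|M. norm (\<theta> x))"
  unfolding abs_m_def using integrable_\<theta> by (intro density_emeasure) auto

lemma set_integral_norm_nonneg: "0 \<le> (LINT x:A|M. norm (f x))"
  for f :: "'a \<Rightarrow> complex"
  unfolding set_lebesgue_integral_def by (rule integral_nonneg_AE) auto

lemma measure_abs_m: "A \<in> sets M \<Longrightarrow> measure abs_m A = (LINT x:A|M. norm (\<theta> x))"
  by (simp add: measure_def emeasure_abs_m set_integral_norm_nonneg)

lemma norm_set_integral_le:
  fixes f :: "'a \<Rightarrow> complex"
  shows "norm (LINT x:A|M. f x) \<le> (LINT x:A|M. norm (f x))"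
proof -
  have "norm (\<integral>x. indicator A x *\<^sub>R f x \<partial>M) \<le> (\<integral>x. norm (indicator A x *\<^sub>R f x) \<partial>M)"
    by (rule integral_norm_bound)
  then show ?thesis by (simp add: set_lebesgue_integral_def)
qed

lemma norm_m_le: "A \<in> sets M \<Longrightarrow> norm (m A) \<le> measure abs_m A"
  unfolding m_def measure_abs_m by (rule norm_set_integral_le)

lemma m_empty [simp]: "m {} = 0"
  by (simp add: m_def set_lebesgue_integral_def)

lemma m_Un: "A \<in> sets M \<Longrightarrow> B \<in> sets M \<Longrightarrow> A \<inter> B = {} \<Longrightarrow> m (A \<union> B) = m A + m B"
  unfolding m_def by (intro set_integral_Un set_integrableI integrable_\<theta>)

lemma variation_le:
  assumes A: "A \<in> zero_algebra"
  shows "variation m A \<le> emeasure abs_m A"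
  unfolding variation_def
proof (rule SUP_least, clarify)
  interpret abs: finite_measure abs_m by (rule finite_abs_m)
  fix P assume P: "finite P" "P \<subseteq> zero_algebra" "partition_on A P"
  have P_sets: "B \<in> sets abs_m" if "B \<in> P" for B
    using that P(2) zero_algebra_subset_baire by (auto simp: sets_abs_m)
  have disj: "disjoint_family_on (\<lambda>B. B) P"
    using P(3) by (auto simp: partition_on_def disjoint_family_on_def pairwise_def disjnt_def)
  have "(\<Sum>B\<in>P. ennreal (norm (m B))) \<le> (\<Sum>B\<in>P. emeasure abs_m B)"
    using P_sets by (intro sum_mono) (simp add: abs.emeasure_eq_measure norm_m_le sets_abs_m sets_M ennreal_leI)
  also have "\<dots> = emeasure abs_m (\<Union>B\<in>P. B)"
    using P_sets by (intro sum_emeasure disj P) auto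
  also have "(\<Union>B\<in>P. B) = A"
    using P(3) by (simp add: partition_on_def)
  finally show "(\<Sum>B\<in>P. ennreal (norm (m B))) \<le> emeasure abs_m A" .
qed

text \<open>Finitely many disjoint, possibly empty, members of the algebra inside \<open>A\<close> are completed to a
  partition of \<open>A\<close> by the rest of \<open>A\<close>.\<close>

lemma sum_norm_le_variation:
  assumes A: "A \<in> zero_algebra" and "finite V" and Z: "\<And>c. c \<in> V \<Longrightarrow> Z c \<in> zero_algebra"
    and Z_sub: "\<And>c. c \<in> V \<Longrightarrow> Z c \<subseteq> A" and disj: "disjoint_family_on Z V"
  shows "(\<Sum>c\<in>V. ennreal (norm (m (Z c)))) \<le> variation m A"
proof -
  define V' where "V' = {c\<in>V. Z c \<noteq> {}}"
  define R where "R = A - (\<Union>c\<in>V. Z c)"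
  define P where "P = Z ` V' \<union> ({R} - {{}})"
  have fin: "finite V'" "finite P"
    using \<open>finite V\<close> by (auto simp: V'_def P_def)
  have R: "R \<in> zero_algebra"
    unfolding R_def using \<open>finite V\<close> A Z by (intro zero_algebra.Diff zero_algebra.finite_UN) auto
  have disjD: "c = c'" if "c \<in> V" "c' \<in> V" "x \<in> Z c" "x \<in> Z c'" for c c' x
    using disj that by (auto simp: disjoint_family_on_def)
  have "partition_on A P"
  proof (rule partition_onI)
    have "\<Union>P = (\<Union>c\<in>V. Z c) \<union> R"
      by (auto simp: P_def V'_def)
    moreover have "(\<Union>c\<in>V. Z c) \<subseteq> A"
      by (rule UN_least) (rule Z_sub)
    ultimately show "\<Union>P = A"
      by (auto simp: R_def)
    show "disjnt B C" if "B \<in> P" "C \<in> P" "B \<noteq> C" for B C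
    proof -
      have P_cases: "D = R \<or> (\<exists>c\<in>V. D = Z c)" if "D \<in> P" for D
        using that by (auto simp: P_def V'_def)
      have "B = C" if x: "x \<in> B" "x \<in> C" for x
      proof (cases "B = R \<or> C = R")
        case True
        then show ?thesis
          using P_cases[OF \<open>B \<in> P\<close>] P_cases[OF \<open>C \<in> P\<close>] x unfolding R_def by blast
      next
        case False
        then obtain c c' where "c \<in> V" "c' \<in> V" "B = Z c" "C = Z c'"
          using P_cases[OF \<open>B \<in> P\<close>] P_cases[OF \<open>C \<in> P\<close>] by blast
        with disjD[of c c' x] x show ?thesis by simp
      qed
      with \<open>B \<noteq> C\<close> show ?thesis by (auto simp: disjnt_iff)
    qed
  qed (auto simp: P_def V'_def)
  moreover have "P \<subseteq> zero_algebra"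
    using Z R by (auto simp: P_def V'_def)
  ultimately have "(\<Sum>B\<in>P. ennreal (norm (m B))) \<le> variation m A"
    unfolding variation_def using fin by (intro SUP_upper) auto
  moreover have "(\<Sum>c\<in>V. ennreal (norm (m (Z c)))) = (\<Sum>c\<in>V'. ennreal (norm (m (Z c))))"
    unfolding V'_def using \<open>finite V\<close> by (intro sum.mono_neutral_right) auto
  moreover have "inj_on Z V'"
  proof (rule inj_onI)
    fix c c' assume c: "c \<in> V'" "c' \<in> V'" "Z c = Z c'"
    then obtain x where "x \<in> Z c" by (auto simp: V'_def)
    with c disjD[of c c' x] show "c = c'" by (simp add: V'_def)
  qed
  then have "(\<Sum>c\<in>V'. ennreal (norm (m (Z c)))) = (\<Sum>B\<in>Z ` V'. ennreal (norm (m B)))"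
    by (simp add: sum.reindex)
  moreover have "\<dots> \<le> (\<Sum>B\<in>P. ennreal (norm (m B)))"
    using fin by (intro sum_mono2) (auto simp: P_def)
  ultimately show ?thesis by simp
qed

text \<open>The density is approximated in mean by a simple function, and the sets where the latter is
  constant are approximated from inside by zero sets; on those the mass of \<open>m\<close> is close to that of
  \<open>abs_m\<close>.\<close>

lemma le_variation:
  assumes A: "A \<in> zero_algebra"
  shows "emeasure abs_m A \<le> variation m A"
proof (rule ennreal_le_epsilon)
  interpret abs: finite_measure abs_m by (rule finite_abs_m)
  fix e :: real assume "e > 0"
  define \<epsilon> where "\<epsilon> = e / 3"
  have "\<epsilon> > 0" using \<open>e > 0\<close> by (simp add: \<epsilon>_def)
  obtain S where S: "\<And>i. Bochner_Integration.simple_bochner_integrable M (S i)"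
      "(\<lambda>i. \<integral>\<^sup>+x. ennreal (norm (\<theta> x - S i x)) \<partial>M) \<longlonglongrightarrow> 0"
    using integrable_\<theta> by (elim integrable.cases has_bochner_integral.cases) blast
  have "\<forall>\<^sub>F i in sequentially. (\<integral>\<^sup>+x. ennreal (norm (\<theta> x - S i x)) \<partial>M) < ennreal \<epsilon>"
    using S(2) \<open>\<epsilon> > 0\<close> by (intro order_tendstoD) auto
  then obtain i where i: "(\<integral>\<^sup>+x. ennreal (norm (\<theta> x - S i x)) \<partial>M) < ennreal \<epsilon>"
    by (auto simp: eventually_sequentially)
  define s where "s = S i"
  have s: "simple_function M s"
    using S(1)[of i] by (simp add: s_def Bochner_Integration.simple_bochner_integrable.simps)
  have [measurable]: "s \<in> borel_measurable M"
    using s by (rule borel_measurable_simple_function)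
  have int_d: "integrable M (\<lambda>x. \<theta> x - s x)"
    unfolding integrable_iff_bounded
  proof
    show "(\<lambda>x. \<theta> x - s x) \<in> borel_measurable M"
      by measurable
    show "(\<integral>\<^sup>+x. ennreal (norm (\<theta> x - s x)) \<partial>M) < \<infinity>"
      using less_trans[OF i ennreal_less_top] by (simp add: s_def)
  qed
  have int_d': "integrable M (\<lambda>x. norm (\<theta> x - s x))"
    using int_d by simp
  have d_le: "(LINT x:UNIV|M. norm (\<theta> x - s x)) \<le> \<epsilon>"
  proof -
    have "ennreal (\<integral>x. norm (\<theta> x - s x) \<partial>M) = (\<integral>\<^sup>+x. ennreal (norm (\<theta> x - S i x)) \<partial>M)"
      unfolding s_def by (intro nn_integral_eq_integral[symmetric]) (use int_d' s_def in auto)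
    then have "ennreal (\<integral>x. norm (\<theta> x - s x) \<partial>M) \<le> ennreal \<epsilon>"
      using i by simp
    then have "(\<integral>x. norm (\<theta> x - s x) \<partial>M) \<le> \<epsilon>"
      using \<open>\<epsilon> > 0\<close> by (simp add: ennreal_le_iff)
    then show ?thesis by (simp add: set_lebesgue_integral_def)
  qed
  define V where "V = range s"
  have fin_V: "finite V"
    using s by (simp add: simple_function_def V_def space_M)
  define E where "E c = A \<inter> s -` {c}" for c
  have E: "E c \<in> sets M" for c
  proof -
    have "s -` {c} \<inter> space M \<in> sets M"
      by (rule measurable_sets[of s M borel]) auto
    then show ?thesis
      using zero_algebra_sets[OF A] by (auto simp: E_def space_M)
  qed
  define \<delta> where "\<delta> = \<epsilon> / (real (card V) + 1)"
  have \<delta>: "\<delta> > 0" "real (card V) * \<delta> \<le> \<epsilon>"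
    using \<open>\<epsilon> > 0\<close> by (auto simp: \<delta>_def field_simps)
  have "\<exists>Z. Z \<in> zero_sets \<and> Z \<subseteq> E c \<and> measure abs_m (E c - Z) < \<delta>" for c
    using baire_inner_regular[OF finite_abs_m sets_abs_m, of "E c" \<delta>] E[of c] \<delta>(1) sets_M by metis
  then obtain Z where Z: "\<And>c. Z c \<in> zero_sets" "\<And>c. Z c \<subseteq> E c" "\<And>c. measure abs_m (E c - Z c) < \<delta>"
    by metis
  have Z_sets: "Z c \<in> sets M" for c
    by (rule zero_sets_sets[OF Z(1)])
  have disj_E: "disjoint_family_on E V"
    by (auto simp: disjoint_family_on_def E_def)
  have disj_Z: "disjoint_family_on Z V"
    using disj_E Z(2) by (fastforce simp: disjoint_family_on_def)
  have on_Z: "measure abs_m (Z c) \<le> norm (m (Z c)) + 2 * (LINT x:Z c|M. norm (\<theta> x - s x))" for c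
  proof -
    have s_eq: "s x = c" if "x \<in> Z c" for x
      using that Z(2)[of c] by (auto simp: E_def)
    have const: "set_integrable M (Z c) (\<lambda>x. c)"
      by (intro set_integrableI Z_sets) simp
    note ints = set_integrableI[OF integrable_\<theta> Z_sets, of c] set_integrableI[OF int_d' Z_sets, of c]
    have "measure abs_m (Z c) = (LINT x:Z c|M. norm (\<theta> x))"
      by (rule measure_abs_m[OF Z_sets])
    also have "\<dots> \<le> (LINT x:Z c|M. norm (\<theta> x - s x) + norm c)"
    proof (rule set_integral_mono)
      show "set_integrable M (Z c) (\<lambda>x. norm (\<theta> x))"
        by (intro set_integrableI Z_sets) (use integrable_\<theta> in simp)
      show "set_integrable M (Z c) (\<lambda>x. norm (\<theta> x - s x) + norm c)"
        by (intro set_integrableI Z_sets Bochner_Integration.integrable_add int_d') simp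
      show "norm (\<theta> x) \<le> norm (\<theta> x - s x) + norm c" if "x \<in> Z c" for x
        using norm_triangle_sub[of "\<theta> x" c] by (simp add: s_eq[OF that] add.commute)
    qed
    also have "\<dots> = (LINT x:Z c|M. norm (\<theta> x - s x)) + (LINT x:Z c|M. norm c)"
      by (intro set_integral_add ints set_integrableI Z_sets) simp
    also have "(LINT x:Z c|M. norm c) = norm (LINT x:Z c|M. c)"
      by (simp add: set_integral_const Z_sets)
    also have "(LINT x:Z c|M. c) = (LINT x:Z c|M. \<theta> x - (\<theta> x - s x))"
      unfolding set_lebesgue_integral_def
      by (intro Bochner_Integration.integral_cong refl) (auto simp: indicator_def s_eq)
    also have "\<dots> = m (Z c) - (LINT x:Z c|M. \<theta> x - s x)"
      unfolding m_def by (intro set_integral_diff ints set_integrableI[OF int_d] Z_sets)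
    also have "norm (m (Z c) - (LINT x:Z c|M. \<theta> x - s x)) \<le> norm (m (Z c)) + norm (LINT x:Z c|M. \<theta> x - s x)"
      by (rule norm_triangle_ineq4)
    also have "norm (LINT x:Z c|M. \<theta> x - s x) \<le> (LINT x:Z c|M. norm (\<theta> x - s x))"
      by (rule norm_set_integral_le)
    finally show ?thesis by simp
  qed
  have sum_d: "(\<Sum>c\<in>V. LINT x:Z c|M. norm (\<theta> x - s x)) \<le> \<epsilon>"
  proof -
    have "(\<Sum>c\<in>V. LINT x:Z c|M. norm (\<theta> x - s x)) = (LINT x:(\<Union>c\<in>V. Z c)|M. norm (\<theta> x - s x))"
      by (intro set_integral_finite_Union[symmetric] fin_V disj_Z set_integrableI int_d' Z_sets)
    also have "\<dots> \<le> (LINT x:UNIV|M. norm (\<theta> x - s x))"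
    proof -
      have "(\<Union>c\<in>V. Z c) \<in> sets M"
        using Z_sets fin_V by auto
      from integrable_mult_indicator[OF this int_d'] show ?thesis
        unfolding set_lebesgue_integral_def
        by (intro integral_mono) (auto simp: indicator_def int_d')
    qed
    finally show ?thesis using d_le by simp
  qed
  have "measure abs_m A = measure abs_m (\<Union>c\<in>V. E c)"
    by (rule arg_cong[where f = "measure abs_m"]) (auto simp: E_def V_def)
  also have "\<dots> = (\<Sum>c\<in>V. measure abs_m (E c))"
    using E by (intro abs.finite_measure_finite_Union fin_V disj_E) (auto simp: sets_abs_m sets_M)
  also have "\<dots> = (\<Sum>c\<in>V. measure abs_m (Z c) + measure abs_m (E c - Z c))"
  proof (rule sum.cong)
    show "measure abs_m (E c) = measure abs_m (Z c) + measure abs_m (E c - Z c)" for c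
      using abs.finite_measure_Diff[of "E c" "Z c"] E Z_sets Z(2) by (simp add: sets_abs_m sets_M)
  qed simp
  also have "\<dots> \<le> (\<Sum>c\<in>V. (norm (m (Z c)) + 2 * (LINT x:Z c|M. norm (\<theta> x - s x))) + \<delta>)"
    using Z(3) by (intro sum_mono add_mono on_Z) (auto intro: less_imp_le)
  also have "\<dots> = (\<Sum>c\<in>V. norm (m (Z c))) + 2 * (\<Sum>c\<in>V. LINT x:Z c|M. norm (\<theta> x - s x)) + real (card V) * \<delta>"
    by (simp add: sum.distrib sum_distrib_left)
  also have "\<dots> \<le> (\<Sum>c\<in>V. norm (m (Z c))) + e"
    using sum_d \<delta>(2) by (simp add: \<epsilon>_def)
  finally have "emeasure abs_m A \<le> ennreal ((\<Sum>c\<in>V. norm (m (Z c))) + e)"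
    by (simp add: abs.emeasure_eq_measure ennreal_leI)
  also have "\<dots> = (\<Sum>c\<in>V. ennreal (norm (m (Z c)))) + ennreal e"
    using \<open>e > 0\<close> by (simp add: ennreal_plus sum_nonneg sum_ennreal)
  also have "\<dots> \<le> variation m A + ennreal e"
    using Z zero_sets_subset_zero_algebra
    by (intro add_right_mono sum_norm_le_variation A fin_V disj_Z) (auto simp: E_def)
  finally show "emeasure abs_m A \<le> variation m A + ennreal e" .
qed

lemma variation_m: "A \<in> zero_algebra \<Longrightarrow> variation m A = emeasure abs_m A"
  by (intro antisym variation_le le_variation)

lemma var_measure_m: "var_measure m = abs_m"
  by (intro baire_extension_eq finite_abs_m sets_abs_m variation_m)

lemma AE_var_measure_m: "(AE x in var_measure m. P x) \<longleftrightarrow> (AE x in M. \<theta> x \<noteq> 0 \<longrightarrow> P x)"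
  unfolding var_measure_m abs_m_def by (subst AE_density) auto

text \<open>No positive part is needed in the density below because \<^const>\<open>ennreal\<close> truncates at \<open>0\<close>.\<close>

lemma pos_part_density:
  fixes t :: "'a \<Rightarrow> real"
  assumes t: "integrable M t" and A: "A \<in> zero_algebra"
  shows "pos_part (\<lambda>A. LINT x:A|M. t x) A = emeasure (density M (\<lambda>x. ennreal (t x))) A"
proof (rule antisym)
  let ?N = "density M (\<lambda>x. ennreal (t x))"
  interpret N: finite_measure ?N by (rule finite_density[OF t])
  have [measurable]: "t \<in> borel_measurable M"
    using t by (rule borel_measurable_integrable)
  have t': "integrable M (\<lambda>x. max 0 (t x))"
    using t by auto
  have N_eq: "?N = density M (\<lambda>x. ennreal (max 0 (t x)))"
    by (intro density_cong) (auto simp: max_def ennreal_neg)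
  have A_sets: "A \<in> sets M" by (rule zero_algebra_sets[OF A])
  show "pos_part (\<lambda>A. LINT x:A|M. t x) A \<le> emeasure ?N A"
    unfolding pos_part_def
  proof (rule SUP_least, clarify)
    fix B assume B: "B \<in> zero_algebra" "B \<subseteq> A"
    have B_sets: "B \<in> sets M" by (rule zero_algebra_sets[OF B(1)])
    have "ennreal (LINT x:B|M. t x) \<le> ennreal (LINT x:B|M. max 0 (t x))"
      by (intro ennreal_leI set_integral_mono set_integrableI t t' B_sets) simp
    also have "\<dots> = emeasure ?N B"
      unfolding N_eq by (intro density_emeasure[symmetric] t' B_sets) simp
    also have "\<dots> \<le> emeasure ?N A"
      using A_sets B by (intro emeasure_mono) auto
    finally show "ennreal (LINT x:B|M. t x) \<le> emeasure ?N A" .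
  qed
  show "emeasure ?N A \<le> pos_part (\<lambda>A. LINT x:A|M. t x) A"
  proof (rule ennreal_le_epsilon)
    fix e :: real assume "e > 0"
    define E where "E = A \<inter> {x \<in> space M. 0 < t x}"
    have E: "E \<in> sets M"
      unfolding E_def using A_sets by auto
    obtain Z where Z: "Z \<in> zero_sets" "Z \<subseteq> E" "measure ?N (E - Z) < e"
      using baire_inner_regular[OF finite_density[OF t], of E e] E \<open>e > 0\<close> by (auto simp: sets_M)
    have Z_sets: "Z \<in> sets M" by (rule zero_sets_sets[OF Z(1)])
    have "emeasure ?N A = (\<integral>\<^sup>+x. ennreal (t x) * indicator A x \<partial>M)"
      using A_sets by (intro emeasure_density) auto
    also have "\<dots> = (\<integral>\<^sup>+x. ennreal (t x) * indicator E x \<partial>M)"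
      by (intro nn_integral_cong) (auto simp: E_def indicator_def ennreal_neg not_less)
    also have "\<dots> = emeasure ?N E"
      using E by (intro emeasure_density[symmetric]) auto
    also have "\<dots> = ennreal (measure ?N Z + measure ?N (E - Z))"
      using N.finite_measure_Diff[of E Z] E Z_sets Z(2) by (simp add: N.emeasure_eq_measure)
    also have "\<dots> \<le> ennreal (measure ?N Z + e)"
      using Z(3) by (intro ennreal_leI) simp
    also have "\<dots> = emeasure ?N Z + ennreal e"
      using \<open>e > 0\<close> by (simp add: N.emeasure_eq_measure ennreal_plus)
    also have "emeasure ?N Z = ennreal (LINT x:Z|M. t x)"
      using Z(2) by (intro density_emeasure t Z_sets) (auto simp: E_def)
    also have "ennreal (LINT x:Z|M. t x) \<le> pos_part (\<lambda>A. LINT x:A|M. t x) A"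
      unfolding pos_part_def using Z zero_sets_subset_zero_algebra
      by (intro SUP_upper) (auto simp: E_def)
    finally show "emeasure ?N A \<le> pos_part (\<lambda>A. LINT x:A|M. t x) A + ennreal e"
      by (simp add: add_right_mono)
  qed
qed

lemma real_measure_integral_density:
  fixes t :: "'a \<Rightarrow> real" and f :: "'a \<Rightarrow> complex"
  assumes t: "integrable M t" and \<nu>: "\<And>A. A \<in> zero_algebra \<Longrightarrow> \<nu> A = (LINT x:A|M. t x)"
    and [measurable]: "f \<in> borel_measurable M" and tf: "integrable M (\<lambda>x. t x *\<^sub>R f x)"
  shows "real_measure_integral \<nu> f = (\<integral>x. t x *\<^sub>R f x \<partial>M)"
proof -
  have [measurable]: "t \<in> borel_measurable M"
    using t by (rule borel_measurable_integrable)
  have part: "(\<integral>x. f x \<partial>baire_extension (pos_part \<nu>')) = (\<integral>x. max 0 (t' x) *\<^sub>R f x \<partial>M)"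
    if t': "integrable M t'" and \<nu>': "\<And>A. A \<in> zero_algebra \<Longrightarrow> \<nu>' A = (LINT x:A|M. t' x)"
    for \<nu>' and t' :: "'a \<Rightarrow> real"
  proof -
    have [measurable]: "t' \<in> borel_measurable M"
      using t' by (rule borel_measurable_integrable)
    have "pos_part \<nu>' A = pos_part (\<lambda>A. LINT x:A|M. t' x) A" for A
      unfolding pos_part_def by (intro SUP_cong) (auto simp: \<nu>')
    then have "baire_extension (pos_part \<nu>') = density M (\<lambda>x. ennreal (t' x))"
      using pos_part_density[OF t'] by (intro baire_extension_eq finite_density t') (auto simp: sets_M)
    also have "\<dots> = density M (\<lambda>x. ennreal (max 0 (t' x)))"
      by (intro density_cong) (auto simp: max_def ennreal_neg)
    finally show ?thesis
      by (simp add: integral_density)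
  qed
  have "real_measure_integral \<nu> f
      = (\<integral>x. max 0 (t x) *\<^sub>R f x \<partial>M) - (\<integral>x. max 0 (- t x) *\<^sub>R f x \<partial>M)"
  proof -
    have "- \<nu> A = (LINT x:A|M. - t x)" if "A \<in> zero_algebra" for A
      using set_integrableI[OF t zero_algebra_sets[OF that]] by (simp add: \<nu>[OF that] set_integral_uminus)
    then have "(\<integral>x. f x \<partial>baire_extension (pos_part (\<lambda>A. - \<nu> A))) = (\<integral>x. max 0 (- t x) *\<^sub>R f x \<partial>M)"
      by (intro part) (use t in simp)
    then show ?thesis
      unfolding real_measure_integral_def by (simp only: part[OF t \<nu>])
  qed
  also have "\<dots> = (\<integral>x. max 0 (t x) *\<^sub>R f x - max 0 (- t x) *\<^sub>R f x \<partial>M)"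
  proof (rule Bochner_Integration.integral_diff[symmetric])
    have bound: "norm (c *\<^sub>R f x) \<le> norm (t x *\<^sub>R f x)" if "\<bar>c\<bar> \<le> \<bar>t x\<bar>" for c x
      using that by (simp add: mult_right_mono)
    show "integrable M (\<lambda>x. max 0 (t x) *\<^sub>R f x)"
      by (rule Bochner_Integration.integrable_bound[OF tf]) (measurable, rule AE_I2, rule bound, simp)
    show "integrable M (\<lambda>x. max 0 (- t x) *\<^sub>R f x)"
      by (rule Bochner_Integration.integrable_bound[OF tf]) (measurable, rule AE_I2, rule bound, simp)
  qed
  also have "(\<lambda>x. max 0 (t x) *\<^sub>R f x - max 0 (- t x) *\<^sub>R f x) = (\<lambda>x. t x *\<^sub>R f x)"
    by (auto simp: max_def fun_eq_iff)
  finally show ?thesis .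
qed

lemma has_measure_integral_m:
  assumes f [measurable]: "f \<in> borel_measurable M" and int: "integrable M (\<lambda>x. f x * \<theta> x)"
  shows "has_measure_integral m f (\<integral>x. f x * \<theta> x \<partial>M)"
  unfolding has_measure_integral_def
proof
  have bound: "norm (c *\<^sub>R f x) \<le> norm (f x * \<theta> x)" if "\<bar>c\<bar> \<le> norm (\<theta> x)" for c x
    using mult_right_mono[OF that, of "norm (f x)"] by (simp add: norm_mult mult.commute)
  have "integrable M (\<lambda>x. norm (\<theta> x) *\<^sub>R f x)"
    by (rule Bochner_Integration.integrable_bound[OF int]) (measurable, rule AE_I2, rule bound, simp)
  then show "integrable (var_measure m) f"
    unfolding var_measure_m abs_m_def by (subst integrable_density) auto
  have Re_int: "integrable M (\<lambda>x. Re (\<theta> x) *\<^sub>R f x)"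
    by (rule Bochner_Integration.integrable_bound[OF int])
      (measurable, rule AE_I2, rule bound, rule abs_Re_le_cmod)
  have Im_int: "integrable M (\<lambda>x. Im (\<theta> x) *\<^sub>R f x)"
    by (rule Bochner_Integration.integrable_bound[OF int])
      (measurable, rule AE_I2, rule bound, rule abs_Im_le_cmod)
  have m_int: "set_integrable M A \<theta>" if "A \<in> zero_algebra" for A
    by (intro set_integrableI integrable_\<theta> zero_algebra_sets that)
  have "real_measure_integral (\<lambda>A. Re (m A)) f = (\<integral>x. Re (\<theta> x) *\<^sub>R f x \<partial>M)"
  proof (rule real_measure_integral_density[OF _ _ f Re_int])
    show "Re (m A) = (LINT x:A|M. Re (\<theta> x))" if "A \<in> zero_algebra" for A
      using m_int[OF that] by (simp add: m_def set_lebesgue_integral_def set_integrable_def flip: integral_Re)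
  qed (use integrable_\<theta> in simp)
  moreover have "real_measure_integral (\<lambda>A. Im (m A)) f = (\<integral>x. Im (\<theta> x) *\<^sub>R f x \<partial>M)"
  proof (rule real_measure_integral_density[OF _ _ f Im_int])
    show "Im (m A) = (LINT x:A|M. Im (\<theta> x))" if "A \<in> zero_algebra" for A
      using m_int[OF that] by (simp add: m_def set_lebesgue_integral_def set_integrable_def flip: integral_Im)
  qed (use integrable_\<theta> in simp)
  ultimately have "measure_integral m f = (\<integral>x. Re (\<theta> x) *\<^sub>R f x \<partial>M) + \<i> * (\<integral>x. Im (\<theta> x) *\<^sub>R f x \<partial>M)"
    by (simp add: measure_integral_def)
  also have "\<dots> = (\<integral>x. Re (\<theta> x) *\<^sub>R f x + \<i> * (Im (\<theta> x) *\<^sub>R f x) \<partial>M)"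
    by (simp only: Bochner_Integration.integral_add[OF Re_int integrable_mult_right[OF Im_int]]
        integral_mult_right_zero)
  also have "(\<lambda>x. Re (\<theta> x) *\<^sub>R f x + \<i> * (Im (\<theta> x) *\<^sub>R f x)) = (\<lambda>x. f x * \<theta> x)"
    by (auto simp: fun_eq_iff complex_eq_iff algebra_simps)
  finally show "measure_integral m f = (\<integral>x. f x * \<theta> x \<partial>M)" .
qed

lemma regular_measure_m:
  assumes "\<And>A. A \<in> zero_algebra \<Longrightarrow> m A \<in> F"
  shows "regular_measure F m"
  unfolding regular_measure_def
proof (intro conjI ballI allI impI)
  interpret abs: finite_measure abs_m by (rule finite_abs_m)
  show "additive zero_algebra m"
    by (auto simp: additive_def intro: m_Un zero_algebra_sets)
  show "bounded (m ` zero_algebra)"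
  proof (rule boundedI)
    fix y assume "y \<in> m ` zero_algebra"
    then obtain A where "A \<in> zero_algebra" "y = m A" by blast
    then show "norm y \<le> measure abs_m (space abs_m)"
      using norm_m_le[OF zero_algebra_sets] abs.bounded_measure order_trans by blast
  qed
  fix A :: "'a set" and \<epsilon> :: real assume A: "A \<in> zero_algebra" and "\<epsilon> > 0"
  have "A \<in> sets baire" using A zero_algebra_subset_baire by blast
  then obtain Z where Z: "Z \<in> zero_sets" "Z \<subseteq> A" "measure abs_m (A - Z) < \<epsilon>"
    using baire_inner_regular[OF finite_abs_m sets_abs_m _ \<open>\<epsilon> > 0\<close>] by metis
  have "A - Z \<in> zero_algebra"
    using A Z(1) zero_sets_subset_zero_algebra by blast
  then have "variation m (A - Z) < ennreal \<epsilon>"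
    using Z(3) \<open>\<epsilon> > 0\<close> by (simp add: variation_m abs.emeasure_eq_measure ennreal_lessI)
  then show "\<exists>Z\<in>zero_sets. Z \<subseteq> A \<and> variation m (A - Z) < ennreal \<epsilon>"
    using Z by blast
qed (rule assms)

end

text \<open>Two limits of Riemann sums agree because any two partitions have a common refinement.\<close>

lemma has_fa_integral_unique:
  assumes I: "has_fa_integral m f I" and J: "has_fa_integral m f J"
  shows "I = J"
proof (rule ccontr)
  assume "I \<noteq> J"
  define \<epsilon> where "\<epsilon> = norm (I - J) / 2"
  have "\<epsilon> > 0" using \<open>I \<noteq> J\<close> by (simp add: \<epsilon>_def)
  let ?close = "\<lambda>P I. \<forall>Q \<xi>. finite Q \<and> Q \<subseteq> zero_algebra \<and> refines UNIV Q P \<and> (\<forall>A\<in>Q. \<xi> A \<in> A) \<longrightarrow>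
    norm ((\<Sum>A\<in>Q. f (\<xi> A) * m A) - I) < \<epsilon>"
  have "\<exists>P. finite P \<and> P \<subseteq> zero_algebra \<and> partition_on UNIV P \<and> ?close P I"
    using I \<open>\<epsilon> > 0\<close> by (simp only: has_fa_integral_def)
  then obtain P where P: "finite P" "P \<subseteq> zero_algebra" "partition_on UNIV P" and P_close: "?close P I"
    by (elim exE conjE)
  have "\<exists>P. finite P \<and> P \<subseteq> zero_algebra \<and> partition_on UNIV P \<and> ?close P J"
    using J \<open>\<epsilon> > 0\<close> by (simp only: has_fa_integral_def)
  then obtain P' where P': "finite P'" "P' \<subseteq> zero_algebra" "partition_on UNIV P'" and P'_close: "?close P' J"
    by (elim exE conjE)
  define Q where "Q = (\<lambda>(A, B). A \<inter> B) ` (P \<times> P') - {{}}"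
  have Q: "finite Q" "Q \<subseteq> zero_algebra"
    using P P' by (auto simp: Q_def)
  have uniq: "A = B" if "A \<in> S" "B \<in> S" "x \<in> A" "x \<in> B" "partition_on UNIV S" for A B S and x :: 'a
    using that by (auto simp: partition_on_def pairwise_def disjnt_iff)
  have part: "partition_on UNIV Q"
  proof (rule partition_onI)
    have "x \<in> \<Union>Q" for x
    proof -
      have "x \<in> \<Union>P" "x \<in> \<Union>P'"
        using P(3) P'(3) by (simp_all add: partition_on_def)
      then obtain A B where "A \<in> P" "x \<in> A" "B \<in> P'" "x \<in> B"
        by blast
      then have "A \<inter> B \<in> Q" "x \<in> A \<inter> B" by (auto simp: Q_def)
      then show ?thesis by blast
    qed
    then show "\<Union>Q = UNIV" by blast
    show "disjnt C D" if "C \<in> Q" "D \<in> Q" "C \<noteq> D" for C D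
    proof -
      obtain A B where C: "A \<in> P" "B \<in> P'" "C = A \<inter> B"
        using \<open>C \<in> Q\<close> by (auto simp: Q_def)
      obtain A' B' where D: "A' \<in> P" "B' \<in> P'" "D = A' \<inter> B'"
        using \<open>D \<in> Q\<close> by (auto simp: Q_def)
      have "A = A'" "B = B'" if "x \<in> C" "x \<in> D" for x
        using that C D uniq[OF _ _ _ _ P(3), of A A' x] uniq[OF _ _ _ _ P'(3), of B B' x] by auto
      then show ?thesis
        using \<open>C \<noteq> D\<close> C(3) D(3) by (auto simp: disjnt_iff)
    qed
  qed (auto simp: Q_def)
  have ref: "refines UNIV Q P" "refines UNIV Q P'"
    using part P(3) P'(3) by (auto simp: refines_def Q_def)
  define \<xi> where "\<xi> A = (SOME x. x \<in> A)" for A :: "'a set"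
  have \<xi>: "\<forall>A\<in>Q. \<xi> A \<in> A"
    by (auto simp: Q_def \<xi>_def some_in_eq)
  let ?S = "\<Sum>A\<in>Q. f (\<xi> A) * m A"
  have "norm (?S - I) < \<epsilon>"
    by (rule P_close[THEN spec, THEN spec, THEN mp]) (intro conjI Q ref \<xi>)
  moreover have "norm (?S - J) < \<epsilon>"
    by (rule P'_close[THEN spec, THEN spec, THEN mp]) (intro conjI Q ref \<xi>)
  moreover have "norm (I - J) \<le> norm (?S - J) + norm (?S - I)"
    using norm_triangle_ineq4[of "?S - J" "?S - I"] by simp
  ultimately have "norm (I - J) < \<epsilon> + \<epsilon>"
    by linarith
  then show False by (simp add: \<epsilon>_def)
qed

context baire_density
begin

text \<open>Partitions finer than the one into level bands of width \<open>\<delta>\<close> have Riemann sums that differ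
  from the integral by at most \<open>\<delta>\<close> times the total variation.\<close>

lemma has_fa_integral_m:
  assumes f: "f \<in> Cont_bdd \<real>"
  shows "has_fa_integral m f (\<integral>x. f x * \<theta> x \<partial>M)"
  unfolding has_fa_integral_def
proof (intro allI impI)
  interpret abs: finite_measure abs_m by (rule finite_abs_m)
  fix \<epsilon> :: real assume "\<epsilon> > 0"
  define K where "K = measure abs_m UNIV"
  define \<delta> where "\<delta> = \<epsilon> / (K + 1)"
  have "K \<ge> 0" by (simp add: K_def)
  then have \<delta>: "\<delta> > 0" "\<delta> * K < \<epsilon>"
    using \<open>\<epsilon> > 0\<close> by (auto simp: \<delta>_def field_simps)
  have cont: "continuous_on UNIV f"
    using f by (simp add: Cont_bdd_def Cont_def)
  have f_real: "f x = of_real (Re (f x))" for x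
    by (rule Cont_bdd_real_eq[OF f])
  obtain B where B: "norm (f x) \<le> B" for x
    using f by (auto simp: Cont_bdd_def bounded_iff)
  have f_meas [measurable]: "f \<in> borel_measurable M"
    using continuous_baire_measurable[OF cont] by (simp add: measurable_cong_sets[OF sets_M refl])
  have f_int: "integrable M (\<lambda>x. f x * \<theta> x)"
    by (rule Bochner_Integration.integrable_bound[of M "\<lambda>x. B * norm (\<theta> x)"])
       (use integrable_\<theta> B in \<open>auto simp: norm_mult intro!: mult_right_mono order_trans[OF _ abs_ge_self]\<close>)
  define C where "C k = {x. \<lfloor>Re (f x) / \<delta>\<rfloor> = k}" for k :: int
  define n where "n = \<lceil>B / \<delta>\<rceil> + 1"
  define P where "P = C ` {-n..n} - {{}}"
  have C_eq: "C k = {x. of_int k * \<delta> \<le> Re (f x) \<and> Re (f x) < (of_int k + 1) * \<delta>}" for k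
    using \<delta>(1) by (auto simp: C_def floor_eq_iff field_simps)
  have "C k \<in> zero_algebra" for k
    unfolding C_eq by (intro continuous_le_less_in_zero_algebra continuous_intros cont)
  then have P: "finite P" "P \<subseteq> zero_algebra"
    by (auto simp: P_def)
  have "\<lfloor>Re (f x) / \<delta>\<rfloor> \<in> {-n..n}" for x
  proof -
    have "\<bar>Re (f x)\<bar> \<le> B"
      using B[of x] abs_Re_le_cmod[of "f x"] by linarith
    then have "Re (f x) / \<delta> \<le> B / \<delta>" "- (B / \<delta>) \<le> Re (f x) / \<delta>"
      using \<delta>(1) by (auto simp: field_simps)
    moreover have "B / \<delta> \<le> of_int \<lceil>B / \<delta>\<rceil>"
      by (rule le_of_int_ceiling)
    moreover have "of_int \<lfloor>Re (f x) / \<delta>\<rfloor> \<le> Re (f x) / \<delta>" "Re (f x) / \<delta> < of_int \<lfloor>Re (f x) / \<delta>\<rfloor> + 1"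
      using floor_correct[of "Re (f x) / \<delta>"] by auto
    ultimately have "real_of_int \<lfloor>Re (f x) / \<delta>\<rfloor> \<le> of_int n" "- real_of_int n \<le> of_int \<lfloor>Re (f x) / \<delta>\<rfloor>"
      unfolding n_def of_int_add of_int_1 by linarith+
    then show ?thesis
      by (simp only: atLeastAtMost_iff of_int_le_iff flip: of_int_minus)
  qed
  then have "C \<lfloor>Re (f x) / \<delta>\<rfloor> \<in> P" for x
    unfolding P_def by (auto simp: C_def)
  then have "x \<in> \<Union>P" for x
    by (rule UnionI) (simp add: C_def)
  then have part: "partition_on UNIV P"
    by (intro partition_onI) (auto simp: P_def C_def disjnt_iff)
  have approx: "norm ((\<Sum>A\<in>Q. f (\<xi> A) * m A) - (\<integral>x. f x * \<theta> x \<partial>M)) < \<epsilon>"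
    if Q: "finite Q" "Q \<subseteq> zero_algebra" "refines UNIV Q P" and \<xi>: "\<forall>A\<in>Q. \<xi> A \<in> A" for Q \<xi>
  proof -
    have Q_sets: "A \<in> sets M" if "A \<in> Q" for A
      using that Q(2) zero_algebra_sets by blast
    have Q_part: "partition_on UNIV Q"
      using Q(3) by (simp add: refines_def)
    then have disj: "disjoint_family_on (\<lambda>A. A) Q"
      by (auto simp: partition_on_def disjoint_family_on_def pairwise_def disjnt_def)
    have Un: "(\<Union>A\<in>Q. A) = UNIV"
      using Q_part by (simp add: partition_on_def)
    have osc: "norm (f (\<xi> A) - f x) \<le> \<delta>" if "A \<in> Q" "x \<in> A" for A x
    proof -
      obtain k where "A \<subseteq> C k"
        using Q(3) \<open>A \<in> Q\<close> by (auto simp: refines_def P_def)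
      then have "\<xi> A \<in> C k" "x \<in> C k"
        using \<xi> that by auto
      then have "\<bar>Re (f (\<xi> A)) - Re (f x)\<bar> \<le> \<delta>"
        by (auto simp: C_eq abs_le_iff algebra_simps)
      moreover have "f (\<xi> A) - f x = of_real (Re (f (\<xi> A)) - Re (f x))"
        by (subst (1 2) f_real) simp
      ultimately show ?thesis
        by (simp only: norm_of_real)
    qed
    have "(\<integral>x. f x * \<theta> x \<partial>M) = (LINT x:(\<Union>A\<in>Q. A)|M. f x * \<theta> x)"
      unfolding Un by (simp add: set_lebesgue_integral_def)
    also have "\<dots> = (\<Sum>A\<in>Q. LINT x:A|M. f x * \<theta> x)"
      by (intro set_integral_finite_Union Q disj set_integrableI f_int Q_sets)
    finally have "(\<Sum>A\<in>Q. f (\<xi> A) * m A) - (\<integral>x. f x * \<theta> x \<partial>M)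
        = (\<Sum>A\<in>Q. f (\<xi> A) * m A - (LINT x:A|M. f x * \<theta> x))"
      by (simp add: sum_subtractf)
    also have "norm \<dots> \<le> (\<Sum>A\<in>Q. \<delta> * measure abs_m A)"
    proof (rule sum_norm_le)
      fix A assume A: "A \<in> Q"
      have cell: "set_integrable M A (\<lambda>x. f (\<xi> A) * \<theta> x)" "set_integrable M A (\<lambda>x. f x * \<theta> x)"
        by (intro set_integrableI Q_sets[OF A] f_int integrable_mult_right integrable_\<theta>)+
      have "f (\<xi> A) * m A - (LINT x:A|M. f x * \<theta> x) = (LINT x:A|M. f (\<xi> A) * \<theta> x - f x * \<theta> x)"
        using cell by (simp add: m_def)
      also have "norm \<dots> \<le> (LINT x:A|M. norm (f (\<xi> A) * \<theta> x - f x * \<theta> x))"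
        by (rule norm_set_integral_le)
      also have "\<dots> \<le> (LINT x:A|M. \<delta> * norm (\<theta> x))"
      proof (rule set_integral_mono)
        show "set_integrable M A (\<lambda>x. norm (f (\<xi> A) * \<theta> x - f x * \<theta> x))"
          by (intro set_integrableI Q_sets[OF A] integrable_norm Bochner_Integration.integrable_diff
              f_int integrable_mult_right integrable_\<theta>)
        show "set_integrable M A (\<lambda>x. \<delta> * norm (\<theta> x))"
          by (intro set_integrableI Q_sets[OF A] integrable_norm integrable_mult_right integrable_\<theta>)
        show "norm (f (\<xi> A) * \<theta> x - f x * \<theta> x) \<le> \<delta> * norm (\<theta> x)" if "x \<in> A" for x
          using osc[OF A that] by (simp add: norm_mult mult_right_mono flip: left_diff_distrib)
      qed
      also have "\<dots> = \<delta> * measure abs_m A"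
        by (simp add: measure_abs_m Q_sets[OF A])
      finally show "norm (f (\<xi> A) * m A - (LINT x:A|M. f x * \<theta> x)) \<le> \<delta> * measure abs_m A" .
    qed
    also have "\<dots> = \<delta> * measure abs_m (\<Union>A\<in>Q. A)"
      using Q_sets by (subst abs.finite_measure_finite_Union[OF Q(1) _ disj])
        (auto simp: sets_abs_m sets_M sum_distrib_left)
    also have "\<dots> < \<epsilon>"
      unfolding Un K_def[symmetric] by (rule \<delta>(2))
    finally show ?thesis .
  qed
  show "\<exists>P. finite P \<and> P \<subseteq> zero_algebra \<and> partition_on UNIV P \<and>
      (\<forall>Q \<xi>. finite Q \<and> Q \<subseteq> zero_algebra \<and> refines UNIV Q P \<and> (\<forall>A\<in>Q. \<xi> A \<in> A) \<longrightarrow>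
        norm ((\<Sum>A\<in>Q. f (\<xi> A) * m A) - (\<integral>x. f x * \<theta> x \<partial>M)) < \<epsilon>)"
    by (intro exI[of _ P] conjI allI impI P part) (elim conjE, rule approx)
qed

lemma fa_integral_m: "f \<in> Cont_bdd \<real> \<Longrightarrow> fa_integral m f = (\<integral>x. f x * \<theta> x \<partial>M)"
  unfolding fa_integral_def
  by (intro the_equality has_fa_integral_m) (auto intro: has_fa_integral_unique has_fa_integral_m)

lemma sigma_smooth_m: "sigma_smooth m"
  unfolding sigma_smooth_def
proof (intro allI impI, elim conjE)
  fix f :: "nat \<Rightarrow> 'a \<Rightarrow> complex"
  assume f: "\<forall>n. f n \<in> Cont_bdd \<real>" and dec: "\<forall>x. decseq (\<lambda>n. Re (f n x))"
    and lim: "\<forall>x. (\<lambda>n. f n x) \<longlonglongrightarrow> 0"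
  obtain B where B: "norm (f 0 x) \<le> B" for x
    using f by (auto simp: Cont_bdd_def bounded_iff)
  have f_meas [measurable]: "f n \<in> borel_measurable M" for n
    using f continuous_baire_measurable[of "f n"]
    by (simp add: measurable_cong_sets[OF sets_M refl] Cont_bdd_def Cont_def)
  have bound: "norm (f n x) \<le> B" for n x
  proof -
    have real: "f n x = of_real (Re (f n x))" for n
      using f by (intro Cont_bdd_real_eq) simp
    have "(\<lambda>n. Re (f n x)) \<longlonglongrightarrow> 0"
      using lim tendsto_Re by fastforce
    then have "0 \<le> Re (f n x)"
      using dec by (intro decseq_ge) auto
    moreover have "Re (f n x) \<le> Re (f 0 x)"
      using dec by (auto simp: decseq_def)
    ultimately have "norm (f n x) \<le> norm (f 0 x)"
      using real[of n] real[of 0] by (metis abs_of_nonneg norm_of_real order_trans)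
    then show ?thesis using B[of x] by linarith
  qed
  have "(\<lambda>n. \<integral>x. f n x * \<theta> x \<partial>M) \<longlonglongrightarrow> (\<integral>x. 0 \<partial>M)"
  proof (rule integral_dominated_convergence[where w = "\<lambda>x. B * norm (\<theta> x)"])
    show "AE x in M. (\<lambda>n. f n x * \<theta> x) \<longlonglongrightarrow> 0"
      using lim tendsto_mult_right[of _ 0] by (intro always_eventually allI tendsto_mult_left_zero) auto
    show "AE x in M. norm (f n x * \<theta> x) \<le> B * norm (\<theta> x)" for n
      using bound by (simp add: norm_mult mult_right_mono)
  qed (use integrable_\<theta> in auto)
  then show "(\<lambda>n. fa_integral m (f n)) \<longlonglongrightarrow> 0"
    using f by (simp add: fa_integral_m)
qed

end


section \<open>Uniqueness of densities and change of variables\<close>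

text \<open>An identity between integrals of continuous functions extends to indicators of Baire sets,
  by the \<open>\<pi>\<close>-\<open>\<lambda>\<close> theorem for the intersection-stable generator of zero sets.\<close>

lemma indicator_integral_eq:
  fixes \<phi> \<psi> :: "'a::topological_space \<Rightarrow> complex"
  assumes sets_M: "sets M = sets baire" and T: "T \<in> measurable M M"
    and \<phi>: "integrable M \<phi>" and \<psi>: "integrable M \<psi>"
    and eq: "\<And>f. continuous_on UNIV f \<Longrightarrow> (\<And>x. 0 \<le> f x) \<Longrightarrow> (\<And>x. f x \<le> 1) \<Longrightarrow>
      (\<integral>x. complex_of_real (f (T x)) * \<phi> x \<partial>M) = (\<integral>x. complex_of_real (f x) * \<psi> x \<partial>M)"
    and A: "A \<in> sets M"
  shows "(\<integral>x. indicator A (T x) *\<^sub>R \<phi> x \<partial>M) = (\<integral>x. indicator A x *\<^sub>R \<psi> x \<partial>M)"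
proof -
  have space_M: "space M = UNIV" by (rule space_if_sets_baire[OF sets_M])
  have T_id: "(\<lambda>x. x) \<in> measurable M M" by simp
  have ind_meas: "(\<lambda>x. indicator A (S x) :: real) \<in> borel_measurable M"
    if "S \<in> measurable M M" "A \<in> sets M" for S A
    using that by measurable
  have ind_int: "integrable M (\<lambda>x. indicator A (S x) *\<^sub>R \<zeta> x)"
    if "S \<in> measurable M M" "A \<in> sets M" "integrable M \<zeta>" for S A and \<zeta> :: "'a \<Rightarrow> complex"
  proof (rule Bochner_Integration.integrable_bound[OF that(3)])
    show "(\<lambda>x. indicator A (S x) *\<^sub>R \<zeta> x) \<in> borel_measurable M"
      using ind_meas[OF that(1,2)] borel_measurable_integrable[OF that(3)] by measurable
  qed (auto simp: indicator_def)
  have limit: "(\<lambda>n. \<integral>x. complex_of_real (u n (S x)) * \<zeta> x \<partial>M) \<longlonglongrightarrow> (\<integral>x. indicator A (S x) *\<^sub>R \<zeta> x \<partial>M)"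
    if S: "S \<in> measurable M M" and A: "A \<in> sets M" and \<zeta>: "integrable M \<zeta>"
      and u: "\<And>n. u n \<in> borel_measurable M" "\<And>n x. 0 \<le> u n x" "\<And>n x. u n x \<le> 1"
        "\<And>x. (\<lambda>n. u n x) \<longlonglongrightarrow> indicator A x"
    for S A u and \<zeta> :: "'a \<Rightarrow> complex"
  proof (rule integral_dominated_convergence[where w = "\<lambda>x. norm (\<zeta> x)"])
    note [measurable] = borel_measurable_integrable[OF \<zeta>] S u(1) ind_meas[OF S A]
    show "(\<lambda>x. complex_of_real (u n (S x)) * \<zeta> x) \<in> borel_measurable M" for n
      by measurable
    show "(\<lambda>x. indicator A (S x) *\<^sub>R \<zeta> x) \<in> borel_measurable M"
      by measurable
    show "integrable M (\<lambda>x. norm (\<zeta> x))" using \<zeta> by simp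
    have "(\<lambda>n. complex_of_real (u n (S x)) * \<zeta> x) \<longlonglongrightarrow> complex_of_real (indicator A (S x)) * \<zeta> x" for x
      by (intro tendsto_intros u(4))
    then show "AE x in M. (\<lambda>n. complex_of_real (u n (S x)) * \<zeta> x) \<longlonglongrightarrow> indicator A (S x) *\<^sub>R \<zeta> x"
      by (simp add: scaleR_conv_of_real)
    show "AE x in M. norm (complex_of_real (u n (S x)) * \<zeta> x) \<le> norm (\<zeta> x)" for n
      using u(2,3) by (simp add: norm_mult mult_left_le_one_le)
  qed
  have gen: "zero_sets \<subseteq> Pow (UNIV :: 'a set)"
    by simp
  have "A \<in> sigma_sets UNIV zero_sets"
    using A by (simp add: sets_M sets_baire)
  from Int_stable_zero_sets gen this show ?thesis
  proof (induction A rule: sigma_sets_induct_disjoint)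
    case (basic Z)
    obtain u :: "nat \<Rightarrow> 'a \<Rightarrow> real" where u: "\<And>n. continuous_on UNIV (u n)" "\<And>n x. 0 \<le> u n x"
        "\<And>n x. u n x \<le> 1" "\<And>x. (\<lambda>n. u n x) \<longlonglongrightarrow> indicator Z x"
      using zero_set_indicator_limit[OF basic] by metis
    have Z: "Z \<in> sets M"
      using basic zero_sets_subset_baire by (auto simp: sets_M)
    have u_meas: "u n \<in> borel_measurable M" for n
      using continuous_baire_measurable_real[OF u(1)] by (simp add: measurable_cong_sets[OF sets_M refl])
    have "(\<integral>x. complex_of_real (u n (T x)) * \<phi> x \<partial>M) = (\<integral>x. complex_of_real (u n x) * \<psi> x \<partial>M)" for n
      by (intro eq u)
    with limit[OF T Z \<phi> u_meas u(2,3,4)]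
    have "(\<lambda>n. \<integral>x. complex_of_real (u n x) * \<psi> x \<partial>M) \<longlonglongrightarrow> (\<integral>x. indicator Z (T x) *\<^sub>R \<phi> x \<partial>M)"
      by (simp only:)
    then show ?case
      using limit[OF T_id Z \<psi> u_meas u(2,3,4)] by (rule LIMSEQ_unique)
  next
    case empty
    then show ?case by simp
  next
    case (compl A)
    have A: "A \<in> sets M" using compl by (simp add: sets_M sets_baire)
    have ind: "indicator (UNIV - A) x *\<^sub>R z = z - indicator A x *\<^sub>R z" for x and z :: complex
      by (simp add: indicator_def)
    have "(\<integral>x. \<phi> x \<partial>M) = (\<integral>x. \<psi> x \<partial>M)"
      using eq[of "\<lambda>x. 1"] by simp
    then show ?case
      unfolding ind using compl(2) \<phi> \<psi> ind_int[OF T A \<phi>] ind_int[OF T_id A \<psi>] by simp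
  next
    case (union A)
    have A: "A i \<in> sets M" for i
      using union(2) by (auto simp: sets_M sets_baire)
    have disj: "disjoint_family_on A {..<n}" for n
      using union(1) by (auto simp: disjoint_family_on_def)
    have partial: "(\<integral>x. complex_of_real (indicator (\<Union>i<n. A i) (S x)) * \<zeta> x \<partial>M)
        = (\<Sum>i<n. \<integral>x. indicator (A i) (S x) *\<^sub>R \<zeta> x \<partial>M)"
      if "S \<in> measurable M M" "integrable M \<zeta>" for S n and \<zeta> :: "'a \<Rightarrow> complex"
    proof -
      have pointwise: "complex_of_real (indicator (\<Union>i<n. A i) (S x)) * \<zeta> x = (\<Sum>i<n. indicator (A i) (S x) *\<^sub>R \<zeta> x)" for x
        by (simp add: indicator_UN_disjoint[OF _ disj] sum_distrib_right scaleR_conv_of_real)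
      show ?thesis
        unfolding pointwise by (intro Bochner_Integration.integral_sum ind_int that A)
    qed
    have meas: "(\<lambda>x. indicator (\<Union>i<n. A i) x :: real) \<in> borel_measurable M" for n
      using A by (intro borel_measurable_indicator) auto
    have UN: "(\<Union>i. A i) \<in> sets M" using A by auto
    note lim = limit[OF _ UN _ meas _ _ LIMSEQ_indicator_UN]
    have "(\<lambda>n. \<Sum>i<n. \<integral>x. indicator (A i) (T x) *\<^sub>R \<phi> x \<partial>M) \<longlonglongrightarrow> (\<integral>x. indicator (\<Union>i. A i) (T x) *\<^sub>R \<phi> x \<partial>M)"
      using lim[OF T \<phi>] by (simp add: partial[OF T \<phi>])
    moreover have "(\<lambda>n. \<Sum>i<n. \<integral>x. indicator (A i) x *\<^sub>R \<psi> x \<partial>M) \<longlonglongrightarrow> (\<integral>x. indicator (\<Union>i. A i) x *\<^sub>R \<psi> x \<partial>M)"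
      using lim[OF T_id \<psi>] by (simp add: partial[OF T_id \<psi>])
    ultimately show ?case
      unfolding union(3) by (rule LIMSEQ_unique)
  qed
qed

lemma AE_zero_if_continuous_integrals_zero:
  fixes \<phi> :: "'a::topological_space \<Rightarrow> complex"
  assumes "finite_measure M" and sets_M: "sets M = sets baire" and \<phi>: "integrable M \<phi>"
    and zero: "\<And>f. continuous_on UNIV f \<Longrightarrow> (\<And>x. 0 \<le> f x) \<Longrightarrow> (\<And>x. f x \<le> 1) \<Longrightarrow>
      (\<integral>x. complex_of_real (f x) * \<phi> x \<partial>M) = 0"
  shows "AE x in M. \<phi> x = 0"
proof -
  interpret finite_measure M by fact
  show ?thesis
  proof (rule density_zero[OF \<phi>])
    fix A assume "A \<in> sets M"
    then have "(\<integral>x. indicator A x *\<^sub>R \<phi> x \<partial>M) = (\<integral>x. indicator A x *\<^sub>R (\<lambda>x. 0 :: complex) x \<partial>M)"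
      by (intro indicator_integral_eq[OF sets_M _ \<phi>]) (simp_all add: zero)
    then show "set_lebesgue_integral M A \<phi> = 0"
      by (simp add: set_lebesgue_integral_def)
  qed
qed

text \<open>In a Tychonoff space the topology is determined by the bounded continuous functions.\<close>

lemma continuous_if_compositions_continuous:
  fixes T :: "'b::topological_space \<Rightarrow> 'a::topological_space"
  assumes cr: "completely_regular_space (euclidean :: 'a topology)"
    and comp: "\<And>f :: 'a \<Rightarrow> real. continuous_on UNIV f \<Longrightarrow> (\<And>x. 0 \<le> f x) \<Longrightarrow> (\<And>x. f x \<le> 1) \<Longrightarrow>
      continuous_on UNIV (\<lambda>x. f (T x))"
  shows "continuous_on UNIV T"
proof -
  have "open (T -` U)" if U: "open U" for U
  proof (subst open_subopen, intro ballI)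
    fix x assume x: "x \<in> T -` U"
    have "closedin euclidean (- U)" "T x \<in> topspace euclidean - (- U)"
      using U x by auto
    then obtain f :: "'a \<Rightarrow> real" where f: "continuous_map euclidean (top_of_set {0..1}) f"
        "f (T x) = 0" "f ` (- U) \<subseteq> {1}"
      using cr unfolding completely_regular_space_def by blast
    have f_cont: "continuous_on UNIV f" and f_ran: "\<And>x. 0 \<le> f x" "\<And>x. f x \<le> 1"
      using f(1) by (auto simp: continuous_map_in_subtopology image_subset_iff)
    have "open {y. f (T y) < 1}"
      by (intro open_Collect_less comp f_cont f_ran continuous_on_const)
    moreover have "{y. f (T y) < 1} \<subseteq> T -` U"
      using f(3) by force
    ultimately show "\<exists>V. open V \<and> x \<in> V \<and> V \<subseteq> T -` U"
      using f(2) by (intro exI[of _ "{y. f (T y) < 1}"]) auto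
  qed
  then show ?thesis
    by (simp add: continuous_on_open_vimage)
qed

text \<open>A set function has zero variation on \<open>A\<close> exactly if it vanishes on the members of the algebra
  inside \<open>A\<close>; no additivity is needed.\<close>

lemma variation_eq_0_iff:
  assumes A: "A \<in> zero_algebra" and "\<mu> {} = 0"
  shows "variation \<mu> A = 0 \<longleftrightarrow> (\<forall>B\<in>zero_algebra. B \<subseteq> A \<longrightarrow> \<mu> B = 0)"
proof
  assume var: "variation \<mu> A = 0"
  show "\<forall>B\<in>zero_algebra. B \<subseteq> A \<longrightarrow> \<mu> B = 0"
  proof (intro ballI impI)
    fix B assume B: "B \<in> zero_algebra" "B \<subseteq> A"
    show "\<mu> B = 0"
    proof (cases "B = {}")
      case False
      define P where "P = {B, A - B} - {{}}"
      have P: "finite P" "P \<subseteq> zero_algebra" "partition_on A P"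
        using A B by (auto simp: P_def partition_on_def pairwise_def disjnt_def)
      then have "(\<Sum>B\<in>P. ennreal (norm (\<mu> B))) \<le> variation \<mu> A"
        unfolding variation_def by (intro SUP_upper) auto
      then have "(\<Sum>B\<in>P. ennreal (norm (\<mu> B))) = 0"
        using var by simp
      then have "ennreal (norm (\<mu> B)) = 0"
        using False P(1) by (subst (asm) sum_eq_0_iff) (auto simp: P_def)
      then show ?thesis by simp
    qed (use \<open>\<mu> {} = 0\<close> in simp)
  qed
next
  assume zero: "\<forall>B\<in>zero_algebra. B \<subseteq> A \<longrightarrow> \<mu> B = 0"
  have "(\<Sum>B\<in>P. ennreal (norm (\<mu> B))) = 0" if "P \<subseteq> zero_algebra" "partition_on A P" for P
  proof (rule sum.neutral, rule ballI)
    fix B assume "B \<in> P"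
    then have "B \<in> zero_algebra" "B \<subseteq> A"
      using that by (auto simp: partition_on_def)
    then show "ennreal (norm (\<mu> B)) = 0" using zero by simp
  qed
  then show "variation \<mu> A = 0"
    unfolding variation_def by (intro antisym SUP_least) auto
qed

section \<open>Bounded functionals as integrals\<close>

lemma Cont_of_real: "continuous_on UNIV f \<Longrightarrow> F = \<real> \<or> F = UNIV \<Longrightarrow> (\<lambda>x. complex_of_real (f x)) \<in> Cont F"
  by (auto simp: Cont_def intro!: continuous_intros)

lemma Cont_bdd_of_real:
  assumes "continuous_on UNIV f" "F = \<real> \<or> F = UNIV" "\<And>x. 0 \<le> f x" "\<And>x. f x \<le> 1"
  shows "(\<lambda>x. complex_of_real (f x)) \<in> Cont_bdd F"
proof -
  have "bounded (range (\<lambda>x. complex_of_real (f x)))"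
    by (rule boundedI[of _ 1]) (use assms in auto)
  then show ?thesis
    using Cont_of_real[OF assms(1,2)] by (simp add: Cont_bdd_def)
qed

lemma Cont_mult: "f \<in> Cont F \<Longrightarrow> g \<in> Cont F \<Longrightarrow> F = \<real> \<or> F = UNIV \<Longrightarrow> (\<lambda>x. f x * g x) \<in> Cont F"
  by (auto simp: Cont_def image_subset_iff intro!: continuous_intros)

lemma Cont_real_eq: "f \<in> Cont \<real> \<Longrightarrow> complex_of_real (Re (f x)) = f x"
  by (auto simp: Cont_def image_subset_iff)

lemma Cont_continuous: "f \<in> Cont F \<Longrightarrow> continuous_on UNIV f"
  by (simp add: Cont_def)

lemma order_bounded_Re:
  fixes p :: "('a::topological_space \<Rightarrow> complex) \<Rightarrow> complex"
  assumes F: "F = \<real> \<or> F = UNIV" and lin: "linear_functional F p" and bdd: "real_and_bounded_on_reals p"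
  shows "order_bounded (\<lambda>f. Re (p (\<lambda>x. complex_of_real (f x))))"
  unfolding order_bounded_def
proof (intro conjI allI impI ballI)
  fix f g :: "'a \<Rightarrow> real" and c :: real assume f: "continuous_on UNIV f"
  note f' = Cont_of_real[OF f F]
  have "complex_of_real c \<in> F" using F by auto
  then have "p (\<lambda>x. complex_of_real c * complex_of_real (f x)) = complex_of_real c * p (\<lambda>x. complex_of_real (f x))"
    using lin f' by (simp add: linear_functional_def)
  then show "Re (p (\<lambda>x. complex_of_real (c * f x))) = c * Re (p (\<lambda>x. complex_of_real (f x)))"
    by simp
  assume g: "continuous_on UNIV g"
  have "p (\<lambda>x. complex_of_real (f x) + complex_of_real (g x)) = p (\<lambda>x. complex_of_real (f x)) + p (\<lambda>x. complex_of_real (g x))"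
    using lin f' Cont_of_real[OF g F] by (simp add: linear_functional_def)
  then show "Re (p (\<lambda>x. complex_of_real (f x + g x))) = Re (p (\<lambda>x. complex_of_real (f x))) + Re (p (\<lambda>x. complex_of_real (g x)))"
    by simp
next
  fix h :: "'a \<Rightarrow> real" assume h: "h \<in> nonneg_cont"
  define V where "V = (\<lambda>u x. complex_of_real (u x)) ` {u\<in>nonneg_cont. \<forall>x. u x \<le> h x}"
  have "bounded_family V"
    unfolding bounded_family_def
  proof
    show "V \<subseteq> Cont \<real>"
      by (auto simp: V_def intro!: Cont_of_real nonneg_contD)
    have "(\<lambda>x. complex_of_real 0) \<in> Cont \<real>" "(\<lambda>x. complex_of_real (h x)) \<in> Cont \<real>"
      using nonneg_contD(1)[OF h] by (intro Cont_of_real continuous_on_const; simp)+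
    moreover have "\<forall>u\<in>V. \<forall>x. Re (complex_of_real 0) \<le> Re (u x) \<and> Re (u x) \<le> Re (complex_of_real (h x))"
      by (auto simp: V_def nonneg_contD)
    ultimately show "\<exists>f\<in>Cont \<real>. \<exists>h\<in>Cont \<real>. \<forall>u\<in>V. \<forall>x. Re (f x) \<le> Re (u x) \<and> Re (u x) \<le> Re (h x)"
      by (intro bexI[of _ "\<lambda>x. complex_of_real 0"] bexI[of _ "\<lambda>x. complex_of_real (h x)"])
  qed
  then have "bounded (p ` V)"
    using bdd by (simp add: real_and_bounded_on_reals_def)
  then obtain B where B: "\<And>z. z \<in> p ` V \<Longrightarrow> norm z \<le> B"
    by (auto simp: bounded_iff)
  show "bdd_above ((\<lambda>f. Re (p (\<lambda>x. complex_of_real (f x)))) ` {u\<in>nonneg_cont. \<forall>x. u x \<le> h x})"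
  proof (rule bdd_aboveI2)
    fix u assume "u \<in> {u\<in>nonneg_cont. \<forall>x. u x \<le> h x}"
    then have "p (\<lambda>x. complex_of_real (u x)) \<in> p ` V"
      unfolding V_def by blast
    then have "norm (p (\<lambda>x. complex_of_real (u x))) \<le> B" by (rule B)
    then show "Re (p (\<lambda>x. complex_of_real (u x))) \<le> B"
      using complex_Re_le_cmod order_trans by blast
  qed
qed

lemma order_bounded_zero: "order_bounded (\<lambda>f. 0)"
  by (auto simp: order_bounded_def)

text \<open>The definition of a bounded functional depends on the scalars; in both cases its restriction to
  real functions is a pair of order-bounded functionals, the second of which is \<open>0\<close> for real
  scalars.\<close>

theorem bounded_functional_representation:
  fixes p :: "('a::topological_space \<Rightarrow> complex) \<Rightarrow> complex"
  assumes F: "F = \<real> \<or> F = UNIV" and p: "bounded_functional F p"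
  obtains M :: "'a measure" and \<theta> :: "'a \<Rightarrow> complex"
  where "finite_measure M" "sets M = sets baire"
    "\<And>f. f \<in> Cont F \<Longrightarrow> has_bochner_integral M (\<lambda>x. f x * \<theta> x) (p f)"
proof -
  let ?c = "\<lambda>f x. complex_of_real (f x)"
  have lin: "linear_functional F p"
    using p by (simp add: bounded_functional_def)
  have ne: "(UNIV :: complex set) \<noteq> \<real>"
    by (metis UNIV_I complex_i_not_one complex_is_Real_iff imaginary_unit.simps(2) zero_neq_one)
  obtain q1 q2 :: "('a \<Rightarrow> real) \<Rightarrow> real" where q: "order_bounded q1" "order_bounded q2"
    and pq: "\<And>f. continuous_on UNIV f \<Longrightarrow> p (?c f) = Complex (q1 f) (q2 f)"
  proof (cases "F = \<real>")
    case True
    then have bdd: "real_and_bounded_on_reals p"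
      using p by (simp add: bounded_functional_def)
    have "p (?c f) = Complex (Re (p (?c f))) 0" if "continuous_on UNIV f" for f
    proof -
      have "p (?c f) \<in> \<real>"
        using bdd Cont_of_real[OF that, of \<real>] by (simp add: real_and_bounded_on_reals_def)
      then show ?thesis by (simp add: complex_is_Real_iff complex_eq_iff)
    qed
    with order_bounded_Re[OF F lin bdd] order_bounded_zero show ?thesis by (rule that)
  next
    case False
    then obtain p1 p2 where p12: "linear_functional UNIV p1" "linear_functional UNIV p2"
        "real_and_bounded_on_reals p1" "real_and_bounded_on_reals p2"
        "\<And>f. f \<in> Cont UNIV \<Longrightarrow> p f = p1 f + \<i> * p2 f"
      using p unfolding bounded_functional_def by auto
    have "p (?c f) = Complex (Re (p1 (?c f))) (Re (p2 (?c f)))" if f: "continuous_on UNIV f" for f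
    proof -
      have "p1 (?c f) \<in> \<real>" "p2 (?c f) \<in> \<real>"
        using p12(3,4) Cont_of_real[OF f, of \<real>] by (simp_all add: real_and_bounded_on_reals_def)
      then show ?thesis
        using p12(5)[OF Cont_of_real[OF f]] by (simp add: complex_is_Real_iff complex_eq_iff)
    qed
    with order_bounded_Re[OF _ p12(1,3)] order_bounded_Re[OF _ p12(2,4)] show ?thesis
      by (intro that) auto
  qed
  obtain M :: "'a measure" and \<theta> where M: "finite_measure M" "sets M = sets baire"
    and int: "\<And>f. continuous_on UNIV f \<Longrightarrow> has_bochner_integral M (\<lambda>x. ?c f x * \<theta> x) (Complex (q1 f) (q2 f))"
    using order_bounded_pair_representation[OF q] by metis
  show ?thesis
  proof (rule that[OF M])
    fix f :: "'a \<Rightarrow> complex" assume f: "f \<in> Cont F"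
    have f_cont: "continuous_on UNIV (\<lambda>x. Re (f x))" "continuous_on UNIV (\<lambda>x. Im (f x))"
      using Cont_continuous[OF f] by (auto intro!: continuous_intros)
    show "has_bochner_integral M (\<lambda>x. f x * \<theta> x) (p f)"
    proof (cases "F = \<real>")
      case True
      then have "(\<lambda>x. ?c (\<lambda>x. Re (f x)) x) = f"
        using Cont_real_eq[of f] f by (auto simp: fun_eq_iff)
      then show ?thesis
        using int[OF f_cont(1)] pq[OF f_cont(1)] by (metis (no_types, lifting) ext)
    next
      case False
      then have UNIV: "F = UNIV" using F by simp
      note Re_C = Cont_of_real[OF f_cont(1) F] and Im_C = Cont_of_real[OF f_cont(2) F]
      have iIm_C: "(\<lambda>x. \<i> * ?c (\<lambda>x. Im (f x)) x) \<in> Cont F"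
        using f_cont(2) by (auto simp: UNIV Cont_def intro!: continuous_intros)
      have "p f = p (\<lambda>x. ?c (\<lambda>x. Re (f x)) x + \<i> * ?c (\<lambda>x. Im (f x)) x)"
        by (rule arg_cong[where f = p]) (simp add: fun_eq_iff complex_eq_iff)
      also have "\<dots> = p (?c (\<lambda>x. Re (f x))) + \<i> * p (?c (\<lambda>x. Im (f x)))"
        using lin Re_C Im_C iIm_C by (simp add: linear_functional_def UNIV)
      finally have p_eq: "p f = p (?c (\<lambda>x. Re (f x))) + \<i> * p (?c (\<lambda>x. Im (f x)))" .
      have "has_bochner_integral M (\<lambda>x. ?c (\<lambda>x. Re (f x)) x * \<theta> x + \<i> * (?c (\<lambda>x. Im (f x)) x * \<theta> x)) (p f)"
        unfolding p_eq pq[OF f_cont(1)] pq[OF f_cont(2)]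
        by (intro has_bochner_integral_add has_bochner_integral_mult_right int f_cont)
      moreover have "(\<lambda>x. ?c (\<lambda>x. Re (f x)) x * \<theta> x + \<i> * (?c (\<lambda>x. Im (f x)) x * \<theta> x)) = (\<lambda>x. f x * \<theta> x)"
        by (simp add: fun_eq_iff complex_eq_iff algebra_simps)
      ultimately show ?thesis by simp
    qed
  qed
qed

section \<open>Quasi-invariance\<close>

text \<open>A density representing, on all continuous functions, a functional that satisfies the translation
  identity for an action by homeomorphisms.\<close>

locale translated_density = baire_density M \<theta> + act: group_action G UNIV h
  for M :: "'a::topological_space measure" and \<theta>
    and G :: "('g, 'b) monoid_scheme" and h :: "'g \<Rightarrow> 'a \<Rightarrow> 'a" +
  fixes F :: "complex set" and d :: "'g \<Rightarrow> 'a \<Rightarrow> complex" and p :: "('a \<Rightarrow> complex) \<Rightarrow> complex"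
  assumes scalars: "F = \<real> \<or> F = UNIV"
    and functional_values: "f \<in> Cont F \<Longrightarrow> p f \<in> F"
    and preserves: "g \<in> carrier G \<Longrightarrow> A \<in> zero_algebra \<Longrightarrow> h g ` A \<in> zero_algebra"
    and d_cont: "g \<in> carrier G \<Longrightarrow> d g \<in> Cont F"
    and action_cont: "g \<in> carrier G \<Longrightarrow> continuous_on UNIV (h g)"
    and represents: "f \<in> Cont F \<Longrightarrow> has_bochner_integral M (\<lambda>x. f x * \<theta> x) (p f)"
    and p_translate: "g \<in> carrier G \<Longrightarrow> f \<in> Cont_bdd F \<Longrightarrow> p (\<lambda>x. f (h g x)) = p (\<lambda>x. d g x * f x)"
begin

lemma group_G: "group G"
  using act.group_hom by (simp add: group_hom_def)

lemma inv_closed: "g \<in> carrier G \<Longrightarrow> inv\<^bsub>G\<^esub> g \<in> carrier G"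
  by (rule group.inv_closed[OF group_G])

lemma action_inv: "g \<in> carrier G \<Longrightarrow> h (inv\<^bsub>G\<^esub> g) (h g x) = x" "g \<in> carrier G \<Longrightarrow> h g (h (inv\<^bsub>G\<^esub> g) x) = x"
proof -
  have *: "h (inv\<^bsub>G\<^esub> g) (h g x) = x" if "g \<in> carrier G" for g x
    using act.orbit_sym_aux[OF that UNIV_I refl] by simp
  show "g \<in> carrier G \<Longrightarrow> h (inv\<^bsub>G\<^esub> g) (h g x) = x"
    by (rule *)
  show "g \<in> carrier G \<Longrightarrow> h g (h (inv\<^bsub>G\<^esub> g) x) = x"
    using *[OF inv_closed[of g], of x] by (simp add: group.inv_inv[OF group_G])
qed

lemma image_inv: "g \<in> carrier G \<Longrightarrow> h (inv\<^bsub>G\<^esub> g) ` A = h g -` A"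
  using action_inv[of g] by (auto simp: image_iff) metis

lemma vimage_zero_algebra: "g \<in> carrier G \<Longrightarrow> A \<in> zero_algebra \<Longrightarrow> h g -` A \<in> zero_algebra"
  using preserves[OF inv_closed] by (simp add: image_inv)

lemma translate_measure_eq: "g \<in> carrier G \<Longrightarrow> translate_measure G h g m A = m (h g -` A)"
  by (simp add: translate_measure_def image_inv)

lemma Cont_measurable: "f \<in> Cont F \<Longrightarrow> f \<in> borel_measurable M"
  using continuous_baire_measurable[OF Cont_continuous] by (simp add: measurable_cong_sets[OF sets_M refl])

lemma Cont_integrable: "f \<in> Cont F \<Longrightarrow> integrable M (\<lambda>x. f x * \<theta> x)"
  using represents by (rule integrable.intros)

lemma p_eq: "f \<in> Cont F \<Longrightarrow> p f = (\<integral>x. f x * \<theta> x \<partial>M)"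
  by (rule has_bochner_integral_integral_eq[OF represents, symmetric])

lemma Cont_translate: "g \<in> carrier G \<Longrightarrow> f \<in> Cont F \<Longrightarrow> (\<lambda>x. f (h g x)) \<in> Cont F"
  using continuous_on_compose2[OF _ action_cont] by (auto simp: Cont_def image_subset_iff)

lemma action_measurable: "g \<in> carrier G \<Longrightarrow> h g \<in> measurable M M"
  using continuous_measurable_baire_baire[OF action_cont] by (simp add: measurable_cong_sets[OF sets_M sets_M])

lemma m_vimage:
  assumes g: "g \<in> carrier G" and A: "A \<in> sets M"
  shows "m (h g -` A) = (LINT x:A|M. d g x * \<theta> x)"
proof -
  have "(\<integral>x. indicator A (h g x) *\<^sub>R \<theta> x \<partial>M) = (\<integral>x. indicator A x *\<^sub>R (d g x * \<theta> x) \<partial>M)"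
  proof (rule indicator_integral_eq[OF sets_M action_measurable[OF g] integrable_\<theta> Cont_integrable[OF d_cont[OF g]] _ A])
    fix f :: "'a \<Rightarrow> real" assume f: "continuous_on UNIV f" "\<And>x. 0 \<le> f x" "\<And>x. f x \<le> 1"
    note b = Cont_bdd_of_real[OF f(1) scalars f(2,3)] and c = Cont_of_real[OF f(1) scalars]
    show "(\<integral>x. complex_of_real (f (h g x)) * \<theta> x \<partial>M) = (\<integral>x. complex_of_real (f x) * (d g x * \<theta> x) \<partial>M)"
      using p_translate[OF g b] p_eq[OF Cont_translate[OF g c]] p_eq[OF Cont_mult[OF d_cont[OF g] c scalars]]
      by (simp add: mult_ac)
  qed
  moreover have "indicator A (h g x) = (indicator (h g -` A) x :: real)" for x
    by (simp add: indicator_def)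
  ultimately show ?thesis
    by (simp add: m_def set_lebesgue_integral_def)
qed

text \<open>If the scalars are real, the imaginary part of the density vanishes almost everywhere.\<close>

lemma m_values: "A \<in> zero_algebra \<Longrightarrow> m A \<in> F"
proof (cases "F = \<real>")
  case True
  assume A: "A \<in> zero_algebra"
  have "AE x in M. complex_of_real (Im (\<theta> x)) = 0"
  proof (rule AE_zero_if_continuous_integrals_zero[OF finite_measure_axioms sets_M])
    show "integrable M (\<lambda>x. complex_of_real (Im (\<theta> x)))"
      using integrable_\<theta> by simp
    fix f :: "'a \<Rightarrow> real" assume f: "continuous_on UNIV f"
    note c = Cont_of_real[OF f scalars]
    have "(\<integral>x. complex_of_real (f x) * complex_of_real (Im (\<theta> x)) \<partial>M)
        = complex_of_real (\<integral>x. Im (complex_of_real (f x) * \<theta> x) \<partial>M)"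
      by (simp flip: integral_complex_of_real)
    also have "(\<integral>x. Im (complex_of_real (f x) * \<theta> x) \<partial>M) = Im (p (\<lambda>x. complex_of_real (f x)))"
      using Cont_integrable[OF c] p_eq[OF c] by (simp only: integral_Im)
    also have "\<dots> = 0"
      using functional_values[OF c] True by (simp add: complex_is_Real_iff)
    finally show "(\<integral>x. complex_of_real (f x) * complex_of_real (Im (\<theta> x)) \<partial>M) = 0"
      by simp
  qed
  then have AE: "AE x in M. Im (\<theta> x) = 0" by simp
  have "set_integrable M A \<theta>"
    by (intro set_integrableI integrable_\<theta> zero_algebra_sets A)
  then have "Im (m A) = (\<integral>x. Im (indicator A x *\<^sub>R \<theta> x) \<partial>M)"
    unfolding m_def set_lebesgue_integral_def set_integrable_def by (simp only: integral_Im)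
  also have "\<dots> = 0"
    using AE by (intro integral_eq_zero_AE) auto
  finally show ?thesis
    using True by (simp add: complex_is_Real_iff)
qed (use scalars in auto)

lemma has_measure_integral_Cont: "f \<in> Cont F \<Longrightarrow> has_measure_integral m f (p f)"
  using has_measure_integral_m[OF Cont_measurable Cont_integrable] by (simp add: p_eq)

lemma is_RN_derivative_translate:
  assumes g: "g \<in> carrier G"
  shows "is_RN_derivative m (translate_measure G h g m) (d g)"
  unfolding is_RN_derivative_def
proof (intro conjI ballI)
  show "integrable (var_measure m) (d g)"
    using has_measure_integral_Cont[OF d_cont[OF g]] by (simp add: has_measure_integral_def)
  fix A :: "'a set" assume A: "A \<in> zero_algebra"
  have A_sets: "A \<in> sets M" by (rule zero_algebra_sets[OF A])
  have ind: "indicator A x * d g x * \<theta> x = indicator A x *\<^sub>R (d g x * \<theta> x)" for x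
    by (simp add: indicator_def)
  have [measurable]: "d g \<in> borel_measurable M" "A \<in> sets M"
    by (rule Cont_measurable[OF d_cont[OF g]], rule A_sets)
  have "has_measure_integral m (\<lambda>x. indicator A x * d g x) (\<integral>x. indicator A x * d g x * \<theta> x \<partial>M)"
  proof (rule has_measure_integral_m)
    show "(\<lambda>x. indicator A x * d g x) \<in> borel_measurable M"
      by measurable
    show "integrable M (\<lambda>x. indicator A x * d g x * \<theta> x)"
      unfolding ind by (intro integrable_mult_indicator A_sets Cont_integrable d_cont g)
  qed
  then show "has_measure_integral m (\<lambda>x. indicator A x * d g x) (translate_measure G h g m A)"
    by (simp add: translate_measure_eq[OF g] m_vimage[OF g A_sets] set_lebesgue_integral_def ind)
qed

text \<open>The translate of \<open>m\<close> is absolutely continuous, because it has a density.\<close>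

lemma m_vimage_zero:
  assumes g: "g \<in> carrier G" and A: "A \<in> zero_algebra" and var: "variation m A = 0"
  shows "m (h g -` A) = 0"
proof -
  have A_sets: "A \<in> sets M" by (rule zero_algebra_sets[OF A])
  have [measurable]: "\<theta> \<in> borel_measurable M" by (rule measurable_\<theta>)
  have "emeasure abs_m A = 0"
    using var by (simp add: variation_m[OF A])
  then have "A \<in> null_sets abs_m"
    using A_sets by (simp add: null_sets_def sets_abs_m sets_M)
  then have "AE x in abs_m. x \<notin> A"
    by (rule AE_not_in)
  then have "AE x in var_measure m. x \<notin> A"
    by (simp only: var_measure_m)
  then have "AE x in M. \<theta> x \<noteq> 0 \<longrightarrow> x \<notin> A"
    by (simp only: AE_var_measure_m)
  then have "(LINT x:A|M. d g x * \<theta> x) = 0"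
    unfolding set_lebesgue_integral_def by (intro integral_eq_zero_AE) (auto simp: indicator_def)
  then show ?thesis by (simp add: m_vimage[OF g A_sets])
qed

lemma variation_translate_zero:
  assumes g: "g \<in> carrier G" and A: "A \<in> zero_algebra"
  shows "variation (translate_measure G h g m) A = 0 \<longleftrightarrow> (\<forall>B\<in>zero_algebra. B \<subseteq> A \<longrightarrow> m (h g -` B) = 0)"
  by (subst variation_eq_0_iff[OF A]) (simp_all add: translate_measure_eq[OF g])

lemma quasi_invariant_m: "quasi_invariant G h m"
  unfolding quasi_invariant_def
proof (intro ballI)
  fix g and A :: "'a set" assume g: "g \<in> carrier G" and A: "A \<in> zero_algebra"
  have mono: "variation m B = 0" if "variation m A = 0" "A \<in> zero_algebra" "B \<in> zero_algebra" "B \<subseteq> A" for A B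
    using that by (auto simp: variation_eq_0_iff)
  have h_vimage: "h g ` (h g -` B) = B" for B
    using act.surj_prop[OF g] by (simp add: surj_image_vimage_eq)
  show "variation (translate_measure G h g m) A = 0 \<longleftrightarrow> variation m A = 0"
  proof
    assume "variation m A = 0"
    then show "variation (translate_measure G h g m) A = 0"
      using mono[OF _ A] m_vimage_zero[OF g] by (simp add: variation_translate_zero[OF g A])
  next
    assume "variation (translate_measure G h g m) A = 0"
    then have zero: "m (h g -` B) = 0" if "B \<in> zero_algebra" "B \<subseteq> A" for B
      using that by (simp add: variation_translate_zero[OF g A])
    have A': "h g -` A \<in> zero_algebra"
      by (rule vimage_zero_algebra[OF g A])
    have inj: "h g -` (h g ` C) = C" for C
      using act.inj_prop[OF g] by (simp add: inj_vimage_image_eq)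
    \<comment> \<open>Every member of the algebra inside the preimage of \<open>A\<close> is the preimage of its image; absolute
      continuity of the translate by the inverse element then brings the null set back to \<open>A\<close>.\<close>
    have "variation m (h g -` A) = 0"
      unfolding variation_eq_0_iff[where \<mu> = m, OF A' m_empty]
    proof (intro ballI impI)
      fix C assume "C \<in> zero_algebra" "C \<subseteq> h g -` A"
      then show "m C = 0"
        using zero[OF preserves[OF g, of C]] by (simp add: inj image_subset_iff_subset_vimage)
    qed
    then have "m (h (inv\<^bsub>G\<^esub> g) -` (h g -` B)) = 0" if "B \<in> zero_algebra" "B \<subseteq> A" for B
      using that mono[OF _ A' vimage_zero_algebra[OF g that(1)]]
      by (intro m_vimage_zero inv_closed g vimage_zero_algebra) auto
    moreover have "h (inv\<^bsub>G\<^esub> g) -` (h g -` B) = B" for B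
      using action_inv(2)[OF g] by auto
    ultimately show "variation m A = 0"
      by (simp add: variation_eq_0_iff[where \<mu> = m, OF A m_empty])
  qed
qed

lemma m_in_Q_sigma: "m \<in> Q_sigma G h F d"
  unfolding Q_sigma_def
  using regular_measure_m[OF m_values] sigma_smooth_m quasi_invariant_m is_RN_derivative_translate
  by blast

text \<open>Continuous multipliers with the same effect on the functional agree \<open>m\<close>-almost everywhere.\<close>

lemma AE_eq_if_functional_eq:
  assumes a: "a \<in> Cont F" and b: "b \<in> Cont F"
    and eq: "\<And>f. continuous_on UNIV f \<Longrightarrow> (\<And>x. 0 \<le> f x) \<Longrightarrow> (\<And>x. f x \<le> 1) \<Longrightarrow>
      p (\<lambda>x. a x * complex_of_real (f x)) = p (\<lambda>x. b x * complex_of_real (f x))"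
  shows "AE x in var_measure m. a x = b x"
proof -
  have "AE x in M. a x * \<theta> x - b x * \<theta> x = 0"
  proof (rule AE_zero_if_continuous_integrals_zero[OF finite_measure_axioms sets_M])
    show "integrable M (\<lambda>x. a x * \<theta> x - b x * \<theta> x)"
      using Cont_integrable[OF a] Cont_integrable[OF b] by (rule Bochner_Integration.integrable_diff)
    fix f :: "'a \<Rightarrow> real" assume f: "continuous_on UNIV f" "\<And>x. 0 \<le> f x" "\<And>x. f x \<le> 1"
    note af = Cont_mult[OF a Cont_of_real[OF f(1) scalars] scalars]
      and bf = Cont_mult[OF b Cont_of_real[OF f(1) scalars] scalars]
    have "(\<integral>x. complex_of_real (f x) * (a x * \<theta> x - b x * \<theta> x) \<partial>M)
        = (\<integral>x. a x * complex_of_real (f x) * \<theta> x - b x * complex_of_real (f x) * \<theta> x \<partial>M)"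
      by (simp add: algebra_simps)
    also have "\<dots> = p (\<lambda>x. a x * complex_of_real (f x)) - p (\<lambda>x. b x * complex_of_real (f x))"
      unfolding p_eq[OF af] p_eq[OF bf]
      by (intro Bochner_Integration.integral_diff Cont_integrable af bf)
    finally show "(\<integral>x. complex_of_real (f x) * (a x * \<theta> x - b x * \<theta> x) \<partial>M) = 0"
      using eq[OF f] by simp
  qed
  then show ?thesis
    unfolding AE_var_measure_m by eventually_elim auto
qed

text \<open>The translation identity extends from bounded to all continuous functions by truncation, since
  all continuous functions are integrable.\<close>

lemma p_translate_Cont:
  assumes g: "g \<in> carrier G" and k: "k \<in> Cont F"
  shows "p (\<lambda>x. k (h g x)) = p (\<lambda>x. d g x * k x)"
proof -
  define r where "r n x = complex_of_real (inverse (max 1 (norm (k x) / real (Suc n))))" for n x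
  define K where "K n x = k x * r n x" for n x
  have k_cont: "continuous_on UNIV k" by (rule Cont_continuous[OF k])
  have r_cont: "continuous_on UNIV (\<lambda>x. inverse (max 1 (norm (k x) / real (Suc n))))" for n
    by (intro continuous_intros k_cont) auto
  have K_Cont: "K n \<in> Cont F" for n
    unfolding K_def r_def by (intro Cont_mult k Cont_of_real r_cont scalars)
  have norm_K: "norm (K n x) = norm (k x) / max 1 (norm (k x) / real (Suc n))" for n x
    by (simp add: K_def r_def norm_mult divide_inverse del: of_real_inverse)
  have K_le: "norm (K n x) \<le> norm (k x)" for n x
  proof -
    have "norm (k x) * 1 \<le> norm (k x) * max 1 (norm (k x) / real (Suc n))"
      by (rule mult_left_mono) auto
    moreover have "0 < max 1 (norm (k x) / real (Suc n))"
      by (rule less_le_trans[OF zero_less_one]) simp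
    ultimately show ?thesis
      unfolding norm_K by (simp only: pos_divide_le_eq mult_1_right)
  qed
  have K_le': "norm (K n x) \<le> real (Suc n)" for n x
    unfolding norm_K by (auto simp: max_def field_simps simp del: of_nat_Suc)
  have K_bdd: "K n \<in> Cont_bdd F" for n
    using K_Cont[of n] boundedI[of "range (K n)" "real (Suc n)"] K_le' by (auto simp: Cont_bdd_def)
  have K_lim: "(\<lambda>n. K n x) \<longlonglongrightarrow> k x" for x
  proof -
    obtain N where N: "norm (k x) \<le> real N" using real_arch_simple by blast
    have "K n x = k x" if "n \<ge> N" for n
    proof -
      have "norm (k x) / real (Suc n) \<le> 1"
        using N that by (simp add: divide_le_eq)
      then show ?thesis by (simp add: K_def r_def max_def)
    qed
    then show ?thesis
      by (intro tendsto_eventually) (auto simp: eventually_sequentially)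
  qed
  note kh = Cont_translate[OF g k] and Kh = Cont_translate[OF g K_Cont]
  note dk = Cont_mult[OF d_cont[OF g] k scalars] and dK = Cont_mult[OF d_cont[OF g] K_Cont scalars]
  have "(\<lambda>n. \<integral>x. K n (h g x) * \<theta> x \<partial>M) \<longlonglongrightarrow> (\<integral>x. k (h g x) * \<theta> x \<partial>M)"
  proof (rule integral_dominated_convergence[where w = "\<lambda>x. norm (k (h g x) * \<theta> x)"])
    show "integrable M (\<lambda>x. norm (k (h g x) * \<theta> x))"
      using Cont_integrable[OF kh] by (rule integrable_norm)
    show "AE x in M. (\<lambda>n. K n (h g x) * \<theta> x) \<longlonglongrightarrow> k (h g x) * \<theta> x"
      by (intro always_eventually allI tendsto_intros K_lim)
    show "AE x in M. norm (K n (h g x) * \<theta> x) \<le> norm (k (h g x) * \<theta> x)" for n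
      by (intro always_eventually allI) (simp add: norm_mult mult_right_mono K_le)
  qed (use Cont_integrable[OF kh] Cont_integrable[OF Kh] in auto)
  then have lim1: "(\<lambda>n. p (\<lambda>x. K n (h g x))) \<longlonglongrightarrow> p (\<lambda>x. k (h g x))"
    by (simp only: p_eq[OF kh] p_eq[OF Kh])
  have "(\<lambda>n. \<integral>x. d g x * K n x * \<theta> x \<partial>M) \<longlonglongrightarrow> (\<integral>x. d g x * k x * \<theta> x \<partial>M)"
  proof (rule integral_dominated_convergence[where w = "\<lambda>x. norm (d g x * k x * \<theta> x)"])
    show "integrable M (\<lambda>x. norm (d g x * k x * \<theta> x))"
      using Cont_integrable[OF dk] by (rule integrable_norm)
    show "AE x in M. (\<lambda>n. d g x * K n x * \<theta> x) \<longlonglongrightarrow> d g x * k x * \<theta> x"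
      by (intro always_eventually allI tendsto_intros K_lim)
    show "AE x in M. norm (d g x * K n x * \<theta> x) \<le> norm (d g x * k x * \<theta> x)" for n
      by (intro always_eventually allI) (simp add: norm_mult mult_right_mono mult_left_mono K_le)
  qed (use Cont_integrable[OF dk] Cont_integrable[OF dK] in auto)
  then have lim2: "(\<lambda>n. p (\<lambda>x. d g x * K n x)) \<longlonglongrightarrow> p (\<lambda>x. d g x * k x)"
    by (simp only: p_eq[OF dk] p_eq[OF dK])
  have "p (\<lambda>x. K n (h g x)) = p (\<lambda>x. d g x * K n x)" for n
    by (rule p_translate[OF g K_bdd])
  with lim1 lim2 show ?thesis
    by (simp add: LIMSEQ_unique)
qed

lemma d_one: "AE x in var_measure m. d \<one>\<^bsub>G\<^esub> x = 1"
proof (rule AE_eq_if_functional_eq)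
  have one: "\<one>\<^bsub>G\<^esub> \<in> carrier G"
    using group_G by (simp add: group.is_monoid monoid.one_closed)
  show "d \<one>\<^bsub>G\<^esub> \<in> Cont F" by (rule d_cont[OF one])
  show "(\<lambda>x. 1) \<in> Cont F"
    using Cont_of_real[of "\<lambda>x. 1", OF _ scalars] by simp
  fix f :: "'a \<Rightarrow> real" assume f: "continuous_on UNIV f"
  have "h \<one>\<^bsub>G\<^esub> x = x" for x
    using act.id_eq_one by (metis UNIV_I restrict_apply)
  then show "p (\<lambda>x. d \<one>\<^bsub>G\<^esub> x * complex_of_real (f x)) = p (\<lambda>x. 1 * complex_of_real (f x))"
    using p_translate_Cont[OF one Cont_of_real[OF f scalars]] by simp
qed

lemma d_nonzero:
  assumes g: "g \<in> carrier G"
  shows "AE x in var_measure m. d g x \<noteq> 0"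
proof -
  define A where "A = {x. d g x = 0}"
  have "continuous_on UNIV (\<lambda>x. norm (d g x))"
    using Cont_continuous[OF d_cont[OF g]] by (intro continuous_intros)
  from zero_setI[OF this] have A: "A \<in> zero_algebra"
    using zero_sets_subset_zero_algebra by (auto simp: A_def)
  have "m (h g -` B) = 0" if "B \<in> zero_algebra" "B \<subseteq> A" for B
  proof -
    have "(\<lambda>x. indicator B x *\<^sub>R (d g x * \<theta> x)) = (\<lambda>x. 0)"
      using that(2) by (auto simp: A_def indicator_def fun_eq_iff)
    then show ?thesis
      by (simp add: m_vimage[OF g zero_algebra_sets[OF that(1)]] set_lebesgue_integral_def)
  qed
  then have "variation (translate_measure G h g m) A = 0"
    by (simp add: variation_translate_zero[OF g A])
  then have "variation m A = 0"
    using quasi_invariant_m g A by (simp add: quasi_invariant_def)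
  then have "A \<in> null_sets (var_measure m)"
    using zero_algebra_sets[OF A] by (simp add: null_sets_def var_measure_m variation_m[OF A] sets_abs_m sets_M)
  then have "AE x in var_measure m. x \<notin> A"
    by (rule AE_not_in)
  then show ?thesis by (simp add: A_def)
qed

lemma d_cocycle:
  assumes s: "s \<in> carrier G" and g: "g \<in> carrier G"
  shows "AE x in var_measure m. d (s \<otimes>\<^bsub>G\<^esub> g) x = d g (h (inv\<^bsub>G\<^esub> s) x) * d s x"
proof (rule AE_eq_if_functional_eq)
  have sg: "s \<otimes>\<^bsub>G\<^esub> g \<in> carrier G"
    using group_G s g by (simp add: group.is_monoid monoid.m_closed)
  have dg: "(\<lambda>x. d g (h (inv\<^bsub>G\<^esub> s) x)) \<in> Cont F"
    by (intro Cont_translate inv_closed s d_cont g)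
  show "d (s \<otimes>\<^bsub>G\<^esub> g) \<in> Cont F" by (rule d_cont[OF sg])
  show "(\<lambda>x. d g (h (inv\<^bsub>G\<^esub> s) x) * d s x) \<in> Cont F"
    by (intro Cont_mult dg d_cont s scalars)
  fix f :: "'a \<Rightarrow> real" assume "continuous_on UNIV f"
  then have f: "(\<lambda>x. complex_of_real (f x)) \<in> Cont F"
    by (rule Cont_of_real[OF _ scalars])
  have k: "(\<lambda>x. d g (h (inv\<^bsub>G\<^esub> s) x) * complex_of_real (f x)) \<in> Cont F"
    by (intro Cont_mult dg f scalars)
  have "p (\<lambda>x. d (s \<otimes>\<^bsub>G\<^esub> g) x * complex_of_real (f x)) = p (\<lambda>x. complex_of_real (f (h (s \<otimes>\<^bsub>G\<^esub> g) x)))"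
    by (rule p_translate_Cont[OF sg f, symmetric])
  also have "\<dots> = p (\<lambda>x. complex_of_real (f (h s (h g x))))"
    by (simp add: act.composition_rule s g)
  also have "\<dots> = p (\<lambda>x. d g x * complex_of_real (f (h s x)))"
    by (rule p_translate_Cont[OF g Cont_translate[OF s f]])
  also have "\<dots> = p (\<lambda>x. d g (h (inv\<^bsub>G\<^esub> s) (h s x)) * complex_of_real (f (h s x)))"
    by (simp add: action_inv(1)[OF s])
  also have "\<dots> = p (\<lambda>x. d s x * (d g (h (inv\<^bsub>G\<^esub> s) x) * complex_of_real (f x)))"
    by (rule p_translate_Cont[OF s k])
  finally show "p (\<lambda>x. d (s \<otimes>\<^bsub>G\<^esub> g) x * complex_of_real (f x))
      = p (\<lambda>x. d g (h (inv\<^bsub>G\<^esub> s) x) * d s x * complex_of_real (f x))"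
    by (simp add: mult_ac)
qed

end

theorem theorem6:
  fixes G :: "('g, 'b) monoid_scheme"
    and h :: "'g \<Rightarrow> 'a::t2_space \<Rightarrow> 'a"
    and F :: "complex set"
    and d :: "'g \<Rightarrow> 'a \<Rightarrow> complex"
    and p :: "('a \<Rightarrow> complex) \<Rightarrow> complex"
  assumes tychonoff: "completely_regular_space (euclidean :: 'a topology)"
    and scalars: "F = \<real> \<or> F = UNIV"
    and action: "group_action G UNIV h"
    and preserves: "\<forall>g\<in>carrier G. \<forall>A\<in>zero_algebra. h g ` A \<in> zero_algebra"
    and d_cont: "\<forall>g\<in>carrier G. d g \<in> Cont F"
    and p_bounded: "bounded_functional F p"
    and translate_cont:
      "\<forall>g\<in>carrier G. \<forall>f\<in>Cont_bdd F. translate_fun G h (inv\<^bsub>G\<^esub> g) f \<in> Cont F"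
    and p_translate:
      "\<forall>g\<in>carrier G. \<forall>f\<in>Cont_bdd F.
         p (translate_fun G h (inv\<^bsub>G\<^esub> g) f) = p (\<lambda>x. d g x * f x)"
  shows "\<exists>m\<in>Q_sigma G h F d.
    (\<forall>f\<in>Cont \<real>. has_measure_integral m f (p f)) \<and>
    (AE x in var_measure m. d \<one>\<^bsub>G\<^esub> x = 1) \<and>
    (\<forall>g\<in>carrier G. AE x in var_measure m. d g x \<noteq> 0) \<and>
    (\<forall>s\<in>carrier G. \<forall>g\<in>carrier G. AE x in var_measure m.
       d (s \<otimes>\<^bsub>G\<^esub> g) x = d g (h (inv\<^bsub>G\<^esub> s) x) * d s x)"
proof -
  have group: "group G"
    using group_action.group_hom[OF action] by (simp add: group_hom_def)
  have translate: "translate_fun G h (inv\<^bsub>G\<^esub> g) f = (\<lambda>x. f (h g x))" if "g \<in> carrier G" for g f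
    using that by (simp add: translate_fun_def fun_eq_iff group.inv_inv[OF group])
  have h_cont: "continuous_on UNIV (h g)" if g: "g \<in> carrier G" for g
  proof (rule continuous_if_compositions_continuous[OF tychonoff])
    fix f :: "'a \<Rightarrow> real" assume f: "continuous_on UNIV f" "\<And>x. 0 \<le> f x" "\<And>x. f x \<le> 1"
    have "translate_fun G h (inv\<^bsub>G\<^esub> g) (\<lambda>x. complex_of_real (f x)) \<in> Cont F"
      by (rule translate_cont[rule_format, OF g Cont_bdd_of_real[OF f(1) scalars f(2,3)]])
    then have "(\<lambda>x. complex_of_real (f (h g x))) \<in> Cont F"
      by (simp only: translate[OF g])
    then have "continuous_on UNIV (\<lambda>x. Re (complex_of_real (f (h g x))))"
      by (intro continuous_intros Cont_continuous)
    then show "continuous_on UNIV (\<lambda>x. f (h g x))" by simp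
  qed
  obtain M :: "'a measure" and \<theta> where M: "finite_measure M" "sets M = sets baire"
    and rep: "\<And>f. f \<in> Cont F \<Longrightarrow> has_bochner_integral M (\<lambda>x. f x * \<theta> x) (p f)"
    using bounded_functional_representation[OF scalars p_bounded] by metis
  have \<theta>: "integrable M \<theta>"
    using integrable.intros[OF rep[OF Cont_of_real[of "\<lambda>x. 1", OF _ scalars]]] by simp
  have vals: "p f \<in> F" if "f \<in> Cont F" for f
    using p_bounded that by (simp add: bounded_functional_def linear_functional_def)
  interpret translated_density M \<theta> G h F d p
  proof (intro translated_density.intro baire_density.intro baire_density_axioms.intro
      translated_density_axioms.intro)
    show "p (\<lambda>x. f (h g x)) = p (\<lambda>x. d g x * f x)" if "g \<in> carrier G" "f \<in> Cont_bdd F" for g f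
      using p_translate[rule_format, OF that] by (simp only: translate[OF that(1)])
  qed (use M \<theta> action scalars vals preserves d_cont h_cont rep in auto)
  have "Cont \<real> \<subseteq> Cont F"
    using scalars by (auto simp: Cont_def)
  then show ?thesis
    using m_in_Q_sigma has_measure_integral_Cont d_one d_nonzero d_cocycle by blast
qed

end
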